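(* For all integers $s\ge 1$ and $k\ge s$, the method HBVM$(k,s)$ (based on the $k+1$ Lobatto abscissae in $[0,1]$), applied to the canonical Hamiltonian problem $y'=J\nabla H(y)$, $y(0)=y_0\in\mathbb{R}^{2m}$: (1) has order of accuracy $2s$; (2) is energy-preserving for polynomial Hamiltonians $H$ of degree not larger than $2k/s$; (3) for general Hamiltonians $H$ of class $C^{(2k+1)}$, has an energy error at each integration step that is $O(h^{2k+1})$, where $h$ is the stepsize; (4) is symmetric and, therefore, precisely $A$-stable.
   Context: Here $J=\begin{pmatrix}0&I_m\\-I_m&0\end{pmatrix}$ and $f(y)=J\nabla H(y)$. Let $P_n$ ($n\ge 0$) be the shifted Legendre polynomials on $[0,1]$: $\deg P_n=n$, $\int_0^1P_nP_l\,dx=\frac{1}{2n+1}\delta_{nl}$, $P_n(1)=1$. Abscissae and weights. $0=t_0<t_1<\dots<t_k=1$ are the Lobatto abscissae on $[0,1]$ (the zeros of $(x^2-x)P_k'(x)$), and $b_i=\int_0^1\prod_{j\ne i}\frac{t-t_j}{t_i-t_j}\,dt$, $i=0,\dots,k$, the corresponding quadrature weights (the quadrature formula has order $2k$, i.e. it is exact for polynomials of degree at most $2k-1$). The set $\{t_0,\dots,t_k\}$ is split as $\{c_0,\dots,c_s\}\cup\{\tau_1,\dots,\tau_r\}$, $r=k-s$, with $0=c_0<c_1<\dots<c_s=1$ (fundamental abscissae) and $0<\tau_1<\dots<\tau_r<1$ (silent abscissae). The method HBVM$(k,s)$ ("Hamiltonian Boundary Value Method with $k$ steps and degree $s$"). Let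 $D_s=\mathrm{diag}(1,3,\dots,2s-1)$, $\bar{\mathcal P}=(P_{j-1}(t_{i-1}))\in\mathbb{R}^{(k+1)\times s}$, $\bar\Omega=\mathrm{diag}(b_0,\dots,b_k)$, $\mathcal I_{s-1}=\left(\int_0^{c_i}P_{j-1}(x)dx\right)_{i,j=1}^s\in\mathbb{R}^{s\times s}$ (nonsingular), and $\bar{\mathcal I}_r=\left(\int_0^{\tau_i}P_{j-1}(x)dx\right)\in\mathbb{R}^{r\times s}$. Let $y_0,y_1,\dots,y_s$ be the unknowns (with $y_0$ given) associated with $c_0,\dots,c_s$, let $w_1,\dots,w_r$ be those associated with $\tau_1,\dots,\tau_r$, and let $\mathbf y=(y_1^T,\dots,y_s^T)^T$, $\mathbf w=(w_1^T,\dots,w_r^T)^T$. Let $\hat{\mathbf f}$ be the block vector of the values of $f$ at all $k+1$ unknowns, ordered according to $t_0<\dots<t_k$. With $e=(1,\dots,1)^T\in\mathbb{R}^s$ and $\bar e=(1,\dots,1)^T\in\mathbb{R}^r$, the method is $$\mathbf y-e\otimes y_0=h\,(\mathcal I_{s-1}D_s\bar{\mathcal P}^T\bar\Omega)\otimes I_{2m}\,\hat{\mathbf f},\qquad \mathbf w=\bar e\otimes y_0+(\bar{\mathcal I}_r\mathcal I_{s-1}^{-1})\otimes I_{2m}\,(\mathbf y-e\otimes y_0),$$ and $y_s\approx y(h)$ is the new approximation after one step. Equivalently, HBVM$(k,s)$ is the $(k+1)$-stage Runge-Kutta method with abscissae $t_0,\dots,t_k$, weights $b_0,\dots,b_k$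 and coefficient matrix $C=\bar{\mathcal I}D_s\bar{\mathcal P}^T\bar\Omega$, where $\bar{\mathcal I}=\left(\int_0^{t_{i-1}}P_{j-1}(x)dx\right)\in\mathbb{R}^{(k+1)\times s}$. Terminology. Order of accuracy $p$: the usual order of a one-step (Runge-Kutta) method, i.e. local error $O(h^{p+1})$ for sufficiently smooth problems. Energy-preserving: $H(y_s)=H(y_0)$ at each step, i.e. for any stepsize and any solution of the system defining the step. The energy error at a step is $H(y_s)-H(y_0)$; the $O(\cdot)$ is as $h\to0$, with the step defined by the solution of the system close to the initial value. Symmetric: the method coincides with its adjoint, i.e. its one-step map satisfies $\Phi_h=\Phi_{-h}^{-1}$. Precisely $A$-stable: when the method is applied to $y'=\lambda y$, with $q=h\lambda$ and stability function $R(q)$, the region of absolute stability $\{q\in\mathbb{C}:|R(q)|<1\}$ coincides with the open left half plane. *)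

theory Defs
  imports
    "HOL-Analysis.Analysis"
    "HOL-Library.Landau_Symbols"
    "HOL-Computational_Algebra.Polynomial"
    "Jordan_Normal_Form.Gauss_Jordan_Elimination"
begin

hide_const (open) Matrix.mat Matrix.vec
no_notation vec_index (infixl "$" 100)

section \<open>Hamiltonian problems\<close>

text \<open>Indices \<open>Inl i\<close> address the first \<open>m\<close> components of a vector in \<open>R^2m\<close>, indices
  \<open>Inr i\<close> the last \<open>m\<close>.\<close>

definition symplectic_J :: "real ^ ('m::finite + 'm) ^ ('m + 'm)" where
  "symplectic_J = (\<chi> i j. case (i, j) of
      (Inl a, Inr b) \<Rightarrow> if a = b then 1 else 0
    | (Inr a, Inl b) \<Rightarrow> if a = b then - 1 else 0
    | _ \<Rightarrow> 0)"

definition gradient :: "(real ^ 'n \<Rightarrow> real) \<Rightarrow> real ^ 'n \<Rightarrow> real ^ 'n::finite" where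
  "gradient H y = (\<chi> i. frechet_derivative H (at y) (axis i 1))"

definition hamiltonian_field ::
    "(real ^ ('m + 'm) \<Rightarrow> real) \<Rightarrow> real ^ ('m + 'm) \<Rightarrow> real ^ ('m::finite + 'm)" where
  "hamiltonian_field H y = symplectic_J *v gradient H y"

text \<open>Class \<open>C^n\<close> on the whole space, by recursion on directional derivatives. For a
  finite-dimensional domain this is the usual notion.\<close>

primrec of_class_C :: "nat \<Rightarrow> ('a::real_normed_vector \<Rightarrow> 'b::real_normed_vector) \<Rightarrow> bool" where
  "of_class_C 0 f \<longleftrightarrow> continuous_on UNIV f"
| "of_class_C (Suc n) f \<longleftrightarrow>
     (\<forall>y. f differentiable (at y)) \<and> (\<forall>v. of_class_C n (\<lambda>y. frechet_derivative f (at y) v))"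

text \<open>Real polynomial functions of total degree at most \<open>d\<close>; \<open>\<alpha>\<close> ranges over the (finitely
  many) multi-indices of size at most \<open>d\<close>.\<close>

definition polynomial_of_degree_le :: "nat \<Rightarrow> (real ^ 'n::finite \<Rightarrow> real) \<Rightarrow> bool" where
  "polynomial_of_degree_le d H \<longleftrightarrow>
     (\<exists>a :: ('n \<Rightarrow> nat) \<Rightarrow> real. \<forall>y.
        H y = (\<Sum>\<alpha> | (\<Sum>i\<in>UNIV. \<alpha> i) \<le> d. a \<alpha> * (\<Prod>i\<in>UNIV. (y $ i) ^ \<alpha> i)))"

section \<open>Legendre polynomials, Lobatto abscissae and weights\<close>

definition shifted_legendre :: "(nat \<Rightarrow> real poly) \<Rightarrow> bool" where
  "shifted_legendre P \<longleftrightarrow>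
     (\<forall>n. degree (P n) = n \<and> poly (P n) 1 = 1) \<and>
     (\<forall>n l. integral {0..1} (\<lambda>x. poly (P n) x * poly (P l) x) =
              (if n = l then 1 / (2 * real n + 1) else 0))"

definition lobatto_abscissae :: "(nat \<Rightarrow> real poly) \<Rightarrow> nat \<Rightarrow> (nat \<Rightarrow> real) \<Rightarrow> bool" where
  "lobatto_abscissae P k t \<longleftrightarrow>
     strict_mono_on {0..k} t \<and> t 0 = 0 \<and> t k = 1 \<and>
     t ` {0..k} = {x. (x\<^sup>2 - x) * poly (pderiv (P k)) x = 0}"

definition quadrature_weight :: "nat \<Rightarrow> (nat \<Rightarrow> real) \<Rightarrow> nat \<Rightarrow> real" where
  "quadrature_weight k t i = integral {0..1} (\<lambda>x. \<Prod>j\<in>{0..k} - {i}. (x - t j) / (t i - t j))"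

text \<open>Fundamental abscissae \<open>c 0, \<dots>, c s\<close> and silent abscissae \<open>\<tau> 1, \<dots>, \<tau> (k - s)\<close>.\<close>

definition abscissae_split ::
    "nat \<Rightarrow> nat \<Rightarrow> (nat \<Rightarrow> real) \<Rightarrow> (nat \<Rightarrow> real) \<Rightarrow> (nat \<Rightarrow> real) \<Rightarrow> bool" where
  "abscissae_split k s t c \<tau> \<longleftrightarrow>
     strict_mono_on {0..s} c \<and> c 0 = 0 \<and> c s = 1 \<and>
     strict_mono_on {1..k - s} \<tau> \<and> (\<forall>i\<in>{1..k - s}. 0 < \<tau> i \<and> \<tau> i < 1) \<and>
     t ` {0..k} = c ` {0..s} \<union> \<tau> ` {1..k - s} \<and>
     c ` {0..s} \<inter> \<tau> ` {1..k - s} = {}"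

section \<open>The method\<close>

text \<open>Matrix rows and columns are numbered from 0, so row \<open>i\<close> of \<open>I_fund\<close> and \<open>I_silent\<close>
  belongs to \<open>c (i + 1)\<close> and \<open>\<tau> (i + 1)\<close>, and column \<open>j\<close> of \<open>P_bar\<close> to \<open>P j\<close>.\<close>

definition D_mat :: "nat \<Rightarrow> real mat" where
  "D_mat s = mat_diag s (\<lambda>j. 2 * real j + 1)"

definition P_bar :: "nat \<Rightarrow> nat \<Rightarrow> (nat \<Rightarrow> real poly) \<Rightarrow> (nat \<Rightarrow> real) \<Rightarrow> real mat" where
  "P_bar k s P t = Matrix.mat (k + 1) s (\<lambda>(i, j). poly (P j) (t i))"

definition Omega_bar :: "nat \<Rightarrow> (nat \<Rightarrow> real) \<Rightarrow> real mat" where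
  "Omega_bar k t = mat_diag (k + 1) (quadrature_weight k t)"

definition I_fund :: "nat \<Rightarrow> (nat \<Rightarrow> real poly) \<Rightarrow> (nat \<Rightarrow> real) \<Rightarrow> real mat" where
  "I_fund s P c = Matrix.mat s s (\<lambda>(i, j). integral {0..c (i + 1)} (poly (P j)))"

definition I_silent ::
    "nat \<Rightarrow> nat \<Rightarrow> (nat \<Rightarrow> real poly) \<Rightarrow> (nat \<Rightarrow> real) \<Rightarrow> real mat" where
  "I_silent k s P \<tau> = Matrix.mat (k - s) s (\<lambda>(i, j). integral {0..\<tau> (i + 1)} (poly (P j)))"

text \<open>Block \<open>i\<close> of \<open>(A \<otimes> I) v\<close> for a block vector \<open>v\<close>, both numbered from 0.\<close>

definition kron_apply :: "real mat \<Rightarrow> (nat \<Rightarrow> 'a) \<Rightarrow> nat \<Rightarrow> 'a::real_vector" where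
  "kron_apply A v i = (\<Sum>j<dim_col A. A $$ (i, j) *\<^sub>R v j)"

text \<open>The vector \<open>u\<close> lists all the unknowns in the order of the abscissae \<open>t 0, \<dots>, t k\<close>.
  The matrix \<open>I_fund s P c\<close> is nonsingular, so that \<open>the\<close> below is its inverse.\<close>

definition hbvm_system ::
    "nat \<Rightarrow> nat \<Rightarrow> (nat \<Rightarrow> real poly) \<Rightarrow> (nat \<Rightarrow> real) \<Rightarrow> (nat \<Rightarrow> real) \<Rightarrow> (nat \<Rightarrow> real) \<Rightarrow>
     ('a \<Rightarrow> 'a) \<Rightarrow> real \<Rightarrow> 'a::real_vector \<Rightarrow> (nat \<Rightarrow> 'a) \<Rightarrow> (nat \<Rightarrow> 'a) \<Rightarrow> bool" where
  "hbvm_system k s P t c \<tau> f h y0 y w \<longleftrightarrow>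
     y 0 = y0 \<and>
     (\<exists>u.
        (\<forall>j\<in>{0..k}. (\<forall>i\<in>{0..s}. t j = c i \<longrightarrow> u j = y i) \<and>
                     (\<forall>i\<in>{1..k - s}. t j = \<tau> i \<longrightarrow> u j = w i)) \<and>
        (\<forall>i<s. y (i + 1) - y0 =
           h *\<^sub>R kron_apply (I_fund s P c * D_mat s * transpose_mat (P_bar k s P t) * Omega_bar k t)
                 (\<lambda>j. f (u j)) i)) \<and>
     (\<forall>i<k - s. w (i + 1) =
        y0 + kron_apply (I_silent k s P \<tau> * the (mat_inverse (I_fund s P c)))
               (\<lambda>j. y (j + 1) - y0) i)"

text \<open>A step is a relation between old and new approximation, since for arbitrary \<open>h\<close> the system
  need not have exactly one solution.\<close>

definition hbvm ::
    "nat \<Rightarrow> nat \<Rightarrow> (nat \<Rightarrow> real poly) \<Rightarrow> (nat \<Rightarrow> real) \<Rightarrow> (nat \<Rightarrow> real) \<Rightarrow> (nat \<Rightarrow> real) \<Rightarrow>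
     ('a \<Rightarrow> 'a) \<Rightarrow> real \<Rightarrow> ('a::real_vector \<times> 'a) set" where
  "hbvm k s P t c \<tau> f h = {(y0, y s) | y0 y w. hbvm_system k s P t c \<tau> f h y0 y w}"

text \<open>Steps whose unknowns all lie within distance \<open>\<rho>\<close> of the initial value.\<close>

definition hbvm_near ::
    "nat \<Rightarrow> nat \<Rightarrow> (nat \<Rightarrow> real poly) \<Rightarrow> (nat \<Rightarrow> real) \<Rightarrow> (nat \<Rightarrow> real) \<Rightarrow> (nat \<Rightarrow> real) \<Rightarrow>
     real \<Rightarrow> ('a \<Rightarrow> 'a) \<Rightarrow> real \<Rightarrow> ('a::real_normed_vector \<times> 'a) set" where
  "hbvm_near k s P t c \<tau> \<rho> f h = {(y0, y s) | y0 y w.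
     hbvm_system k s P t c \<tau> f h y0 y w \<and>
     (\<forall>i\<in>{1..s}. dist y0 (y i) \<le> \<rho>) \<and> (\<forall>i\<in>{1..k - s}. dist y0 (w i) \<le> \<rho>)}"

section \<open>Properties of one-step methods\<close>

text \<open>In the following \<open>\<Phi> f h\<close> is the step relation of a method, and \<open>\<Phi> \<rho> f h\<close> its restriction
  to steps that stay within distance \<open>\<rho>\<close> of the initial value. \<open>numerical_branch \<Phi> f y0 \<psi>\<close> says
  that for all small \<open>h\<close> the step from \<open>y0\<close> close to the initial value exists, is unique, and
  has result \<open>\<psi> h\<close>.\<close>

definition numerical_branch ::
    "(real \<Rightarrow> ('a \<Rightarrow> 'a) \<Rightarrow> real \<Rightarrow> ('a \<times> 'a) set) \<Rightarrow> ('a \<Rightarrow> 'a) \<Rightarrow> 'a \<Rightarrow> (real \<Rightarrow> 'a) \<Rightarrow> bool" where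
  "numerical_branch \<Phi> f y0 \<psi> \<longleftrightarrow>
     (\<exists>\<rho>>0. \<forall>\<^sub>F h in at 0. {y1. (y0, y1) \<in> \<Phi> \<rho> f h} = {\<psi> h})"

definition has_order ::
    "(real \<Rightarrow> ('a \<Rightarrow> 'a) \<Rightarrow> real \<Rightarrow> ('a::real_normed_vector \<times> 'a) set) \<Rightarrow> nat \<Rightarrow> bool" where
  "has_order \<Phi> p \<longleftrightarrow>
     (\<forall>f y0 T \<phi>. of_class_C p f \<and> T > 0 \<and> \<phi> 0 = y0 \<and>
        (\<forall>x\<in>{-T..T}. (\<phi> has_vector_derivative f (\<phi> x)) (at x within {-T..T})) \<longrightarrow>
        (\<exists>\<psi>. numerical_branch \<Phi> f y0 \<psi> \<and>
             (\<lambda>h. norm (\<psi> h - \<phi> h)) \<in> O[at 0](\<lambda>h. h ^ (p + 1))))"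

definition energy_preserving ::
    "(('a \<Rightarrow> 'a) \<Rightarrow> real \<Rightarrow> ('a \<times> 'a) set) \<Rightarrow> ('a \<Rightarrow> 'a) \<Rightarrow> ('a \<Rightarrow> real) \<Rightarrow> bool" where
  "energy_preserving \<Phi> f H \<longleftrightarrow> (\<forall>h y0 y1. (y0, y1) \<in> \<Phi> f h \<longrightarrow> H y1 = H y0)"

definition has_energy_error ::
    "(real \<Rightarrow> ('a \<Rightarrow> 'a) \<Rightarrow> real \<Rightarrow> ('a \<times> 'a) set) \<Rightarrow> ('a \<Rightarrow> 'a) \<Rightarrow> ('a \<Rightarrow> real) \<Rightarrow> nat \<Rightarrow> bool" where
  "has_energy_error \<Phi> f H p \<longleftrightarrow>
     (\<forall>y0. \<exists>\<psi>. numerical_branch \<Phi> f y0 \<psi> \<and>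
        (\<lambda>h. H (\<psi> h) - H y0) \<in> O[at 0](\<lambda>h. h ^ p))"

definition adjoint_method ::
    "(('a \<Rightarrow> 'a) \<Rightarrow> real \<Rightarrow> ('a \<times> 'a) set) \<Rightarrow> ('a \<Rightarrow> 'a) \<Rightarrow> real \<Rightarrow> ('a \<times> 'a) set" where
  "adjoint_method \<Phi> f h = (\<Phi> f (- h))\<inverse>"

definition symmetric_method :: "(('a \<Rightarrow> 'a) \<Rightarrow> real \<Rightarrow> ('a \<times> 'a) set) \<Rightarrow> bool" where
  "symmetric_method \<Phi> \<longleftrightarrow> \<Phi> = adjoint_method \<Phi>"

text \<open>\<open>R\<close> is the value at \<open>q\<close> of the stability function: a step for \<open>y' = \<mu> y\<close> with \<open>h \<mu> = q\<close>
  multiplies by \<open>R\<close>. There is no such \<open>R\<close> at the poles.\<close>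

definition stability_value ::
    "((complex \<Rightarrow> complex) \<Rightarrow> real \<Rightarrow> (complex \<times> complex) set) \<Rightarrow> complex \<Rightarrow> complex \<Rightarrow> bool" where
  "stability_value \<Phi> q R \<longleftrightarrow>
     (\<forall>h \<mu>. of_real h * \<mu> = q \<longrightarrow> \<Phi> (\<lambda>y. \<mu> * y) h = {(y0, y1). y1 = R * y0})"

definition stability_region ::
    "((complex \<Rightarrow> complex) \<Rightarrow> real \<Rightarrow> (complex \<times> complex) set) \<Rightarrow> complex set" where
  "stability_region \<Phi> = {q. \<exists>R. stability_value \<Phi> q R \<and> cmod R < 1}"

definition precisely_A_stable ::
    "((complex \<Rightarrow> complex) \<Rightarrow> real \<Rightarrow> (complex \<times> complex) set) \<Rightarrow> bool" where
  "precisely_A_stable \<Phi> \<longleftrightarrow> stability_region \<Phi> = {q. Re q < 0}"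

end

theory Submission
  imports Defs "Jordan_Normal_Form.Determinant"
begin

text \<open>The stages are the values at the nodes of a polynomial curve \<open>u\<close> of degree \<open>s\<close>, whose slope is the
  projection of \<open>f \<circ> u\<close> to degree less than \<open>s\<close> in the discrete inner product of the Lobatto
  quadrature.

  Energy: the quadrature evaluates the increment of \<open>H\<close> along \<open>u\<close> from the values of
  \<open>(H \<circ> u)' = \<nabla>H(u) \<bullet> u'\<close> at the nodes, exactly if \<open>H \<circ> u\<close> has degree at most \<open>2 k\<close>, and the
  sum vanishes by skew-symmetry of \<open>J\<close>. For general \<open>H\<close>, a bootstrap shows that the \<open>i\<close>-th derivative
  of \<open>u\<close> is \<open>O(h^i)\<close>, so the quadrature error is \<open>O(h^(2 k + 1))\<close>. The same computation with
  \<open>|y|^2\<close> instead of \<open>H\<close> gives A-stability: for \<open>y' = \<mu> y\<close> the increment is \<open>2 Re q\<close> times a sum of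
  squares.

  Symmetry follows from the reflection \<open>x \<mapsto> 1 - x\<close> of nodes, weights and Legendre polynomials.

  Order: the global error formula with an approximate solution of the adjoint variational equation
  reduces the error to the integral of the projection residual against a smooth function. Residual
  and smooth function each contribute \<open>O(h^s)\<close>.\<close>

hide_const (open) Matrix.mat Matrix.vec Module.smult
no_notation vec_index (infixl "$" 100)

section \<open>Polynomials and Lobatto quadrature\<close>

text \<open>For arbitrary step sizes the stage system may have several solutions or none, so energy
  preservation and symmetry are proved for every solution, by identities between stages. Only order
  and energy error select a branch, by a contraction in the unit ball around the initial value.

  Symmetry alone would give R(q) R(-q) = 1, hence modulus 1 on the imaginary axis, but it would not
  locate the poles of R. The norm identity settles solvability, uniqueness and strict decrease in
  the left half plane together, so A-stability is obtained from it.

  The estimates must be uniform in \<open>h\<close> although the curve changes with \<open>h\<close>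
  and is given only implicitly. The way out is that the discrete Legendre moment of index
  \<open>j\<close> annihilates polynomials of degree less than \<open>j\<close>: smoothness of
  \<open>f\<close> along the curve shows as decay h^j of the coefficient of \<open>P j\<close>,
  which pays for the derivatives of that term. Thus control of \<open>m\<close> derivatives of the
  curve yields control of \<open>m + 1\<close>. The value h = 0 is left out so that powers of
  \<open>h\<close> can be divided out.\<close>

definition antideriv :: "real poly \<Rightarrow> real poly" where
  "antideriv p = (\<Sum>i\<le>degree p. monom (coeff p i / real (Suc i)) (Suc i))"

lemma pderiv_sum: "pderiv (\<Sum>i\<in>A. p i) = (\<Sum>i\<in>A. pderiv (p i))"
  by (induction A rule: infinite_finite_induct) (simp_all add: pderiv_add)

lemma pderiv_antideriv [simp]: "pderiv (antideriv p) = p"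
proof -
  have "pderiv (antideriv p) = (\<Sum>i\<le>degree p. monom (coeff p i) i)"
    unfolding antideriv_def by (simp add: pderiv_sum pderiv_monom)
  then show ?thesis by (simp add: poly_as_sum_of_monoms)
qed

lemma poly_antideriv_0 [simp]: "poly (antideriv p) 0 = 0"
  by (simp add: antideriv_def poly_sum poly_monom)

lemma degree_antideriv: "degree (antideriv p) \<le> Suc (degree p)"
  unfolding antideriv_def
  by (rule degree_sum_le) (auto intro: order.trans[OF degree_monom_le])

lemma antideriv_DERIV:
  "(poly (antideriv p) has_real_derivative poly p x) (at x within A)"
  using poly_DERIV[of "antideriv p" x] by (auto intro: DERIV_subset)

lemma has_integral_poly:
  fixes p :: "real poly"
  assumes "a \<le> b"
  shows "(poly p has_integral poly (antideriv p) b - poly (antideriv p) a) {a..b}"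
  using assms
  by (intro fundamental_theorem_of_calculus)
     (auto intro: antideriv_DERIV simp flip: has_real_derivative_iff_has_vector_derivative)

lemma integral_poly: "0 \<le> b \<Longrightarrow> integral {0..b} (poly p) = poly (antideriv p) b"
  using has_integral_poly[of 0 b p] by (simp add: integral_unique)

lemma integral_pderiv: "integral {0..1} (poly (pderiv p)) = poly p 1 - poly p (0::real)"
proof -
  have "(poly (pderiv p) has_integral poly p 1 - poly p 0) {0..1}"
    by (intro fundamental_theorem_of_calculus)
       (auto intro: DERIV_subset[OF poly_DERIV]
             simp flip: has_real_derivative_iff_has_vector_derivative)
  then show ?thesis by (simp add: integral_unique)
qed

lemma integrable_poly [simp]: "poly p integrable_on {0..(1::real)}"
  using has_integral_poly[of 0 1 p] by (auto simp: integrable_on_def)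

lemma integral_poly_add:
  "integral {0..1} (poly (p + q)) = integral {0..1} (poly p) + integral {0..(1::real)} (poly q)"
  using integral_add[OF integrable_poly[of p] integrable_poly[of q]] by (simp add: poly_add[abs_def])

lemma integral_poly_smult:
  "integral {0..1} (poly (smult c p)) = c * integral {0..(1::real)} (poly p)"
  using integral_mult_right[of "{0..1}" c "poly p"] by (simp add: poly_smult[abs_def])

lemma integral_poly_sum:
  "integral {0..1} (poly (\<Sum>i\<in>I. p i)) = (\<Sum>i\<in>I. integral {0..(1::real)} (poly (p i)))"
proof (induction I rule: infinite_finite_induct)
  case (insert x F)
  have "integral {0..1} (poly (\<Sum>i\<in>insert x F. p i))
      = integral {0..1} (poly (p x + (\<Sum>i\<in>F. p i)))"
    using insert.hyps by simp
  also have "\<dots> = integral {0..1} (poly (p x)) + integral {0..1} (poly (\<Sum>i\<in>F. p i))"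
    by (rule integral_poly_add)
  finally show ?case by (simp only: insert.IH sum.insert[OF insert.hyps])
qed simp_all

lemma integral_poly_reflect:
  "integral {0..1} (poly (pcompose p [:1, -1:])) = integral {0..(1::real)} (poly p)"
proof -
  have "pcompose p [:1, -1:] = pderiv (- pcompose (antideriv p) [:1, -1:])"
    by (simp add: pderiv_pcompose pderiv_minus pderiv_pCons)
  then have "integral {0..1} (poly (pcompose p [:1, -1:])) = poly (antideriv p) 1"
    by (simp only: integral_pderiv) (simp add: poly_pcompose)
  then show ?thesis by (simp add: integral_poly)
qed

lemma poly_eqI_card:
  fixes p q :: "real poly"
  assumes "finite A" "card A > n" "degree p \<le> n" "degree q \<le> n"
    and "\<And>x. x \<in> A \<Longrightarrow> poly p x = poly q x"
  shows "p = q"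
  using assms by (intro poly_eqI_degree[of A]) auto

section \<open>Shifted Legendre polynomials: expansion, orthogonality, reflection\<close>

locale legendre =
  fixes P :: "nat \<Rightarrow> real poly"
  assumes shifted_legendre: "shifted_legendre P"
begin

lemma degree_P [simp]: "degree (P n) = n"
  and poly_P_1 [simp]: "poly (P n) 1 = 1"
  using shifted_legendre by (auto simp: shifted_legendre_def)

lemma P_orthogonal:
  "integral {0..1} (poly (P n * P l)) = (if n = l then 1 / (2 * real n + 1) else 0)"
  using shifted_legendre by (simp add: shifted_legendre_def poly_mult[abs_def])

lemma P_nonzero [simp]: "P n \<noteq> 0"
  using poly_P_1[of n] by fastforce

lemma P_0 [simp]: "P 0 = 1"
proof -
  obtain c where "P 0 = [:c:]" using degree_P[of 0] by (meson degree_eq_zeroE)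
  then show ?thesis using poly_P_1[of 0] by (simp add: one_pCons)
qed

lemma legendre_expansion:
  assumes "degree p \<le> n"
  shows "\<exists>a. p = (\<Sum>j\<le>n. smult (a j) (P j))"
  using assms
proof (induction n arbitrary: p)
  case 0
  then obtain c where "p = [:c:]" by (meson degree_eq_zeroE le_zero_eq)
  then show ?case by (intro exI[of _ "\<lambda>_. c"]) simp
next
  case (Suc n)
  define c where "c = coeff p (Suc n) / lead_coeff (P (Suc n))"
  have "degree (p - smult c (P (Suc n))) \<le> n"
  proof (rule degree_le, intro allI impI)
    fix i assume "n < i"
    then consider "i = Suc n" | "i > Suc n" by linarith
    then show "coeff (p - smult c (P (Suc n))) i = 0"
    proof cases
      case 1
      then show ?thesis using P_nonzero[of "Suc n"] unfolding c_def
        by (simp del: P_nonzero) (metis degree_P leading_coeff_0_iff P_nonzero)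
    next
      case 2
      then show ?thesis using Suc.prems by (simp add: coeff_eq_0)
    qed
  qed
  from Suc.IH[OF this] obtain a where
    a: "p - smult c (P (Suc n)) = (\<Sum>j\<le>n. smult (a j) (P j))" by blast
  have "p = (\<Sum>j\<le>Suc n. smult ((a(Suc n := c)) j) (P j))"
    using a by (simp add: algebra_simps)
  then show ?case by blast
qed

lemma orthogonal_lower_degree:
  assumes "degree p < n"
  shows "integral {0..1} (poly (p * P n)) = 0"
proof -
  obtain a where "p = (\<Sum>j\<le>n-1. smult (a j) (P j))"
    using legendre_expansion[of p "n - 1"] assms by (metis less_imp_le_nat less_Suc_eq_le Suc_pred' gr_implies_not0 neq0_conv)
  then have "p * P n = (\<Sum>j\<le>n-1. smult (a j) (P j * P n))" by (simp add: sum_distrib_right)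
  then have "integral {0..1} (poly (p * P n)) = (\<Sum>j\<le>n-1. a j * integral {0..1} (poly (P j * P n)))"
    by (simp only: integral_poly_sum integral_poly_smult)
  also have "\<dots> = 0"
    using assms by (intro sum.neutral) (auto simp: P_orthogonal)
  finally show ?thesis .
qed

lemma eq_0_if_orthogonal:
  assumes "degree p < n" and "\<And>j. j < n \<Longrightarrow> integral {0..1} (poly (p * P j)) = 0"
  shows "p = 0"
proof -
  obtain a where a: "p = (\<Sum>j\<le>n-1. smult (a j) (P j))"
    using legendre_expansion[of p "n - 1"] assms(1) by (metis less_imp_le_nat less_Suc_eq_le Suc_pred' gr_implies_not0 neq0_conv)
  have "a i = 0" if "i < n" for i
  proof -
    have "p * P i = (\<Sum>j\<le>n-1. smult (a j) (P j * P i))" by (simp add: a sum_distrib_right)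
    then have "0 = (\<Sum>j\<le>n-1. a j * integral {0..1} (poly (P j * P i)))"
      using assms(2)[OF that] by (simp only: integral_poly_sum integral_poly_smult)
    also have "\<dots> = a i / (2 * real i + 1)"
      using that by (simp add: P_orthogonal if_distrib cong: if_cong)
    finally show ?thesis by (simp add: add_nonneg_eq_0_iff)
  qed
  then show ?thesis using a assms(1) by (simp add: sum.neutral)
qed

text \<open>Reflection keeps degree and integral, hence orthogonality. Matching the leading
  coefficients leaves a difference of degree below \<open>n\<close> that is orthogonal to all lower
  \<open>P j\<close>, so it vanishes. Reflecting twice is the identity, which makes \<open>c\<close>
  a sign.\<close>

lemma legendre_reflect: "\<exists>c. c\<^sup>2 = 1 \<and> pcompose (P n) [:1, -1:] = smult c (P n)"
proof -
  let ?r = "\<lambda>p. pcompose p [:1, -1::real:]"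
  have deg: "degree (?r p) = degree p" for p by (simp add: degree_pcompose)
  have rr: "?r (?r p) = p" for p
    by (simp flip: pcompose_assoc add: pcompose_pCons)
  define c where "c = lead_coeff (?r (P n)) / lead_coeff (P n)"
  have lc: "coeff (P n) n \<noteq> 0" using P_nonzero[of n] by (metis degree_P leading_coeff_0_iff)
  let ?d = "?r (P n) - smult c (P n)"
  have "?d = 0"
  proof (cases "n = 0")
    case True
    then show ?thesis by (simp add: c_def pcompose_1)
  next
    case False
    have d: "degree ?d < n"
    proof -
      have "coeff ?d i = 0" if "i \<ge> n" for i
      proof (cases "i = n")
        case True
        then show ?thesis using lc by (simp add: c_def deg)
      next
        case False
        then show ?thesis using that by (simp add: coeff_eq_0 deg)
      qed
      then show ?thesis using False by (intro degree_lessI) auto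
    qed
    then show ?thesis
    proof (rule eq_0_if_orthogonal)
      fix j assume j: "j < n"
      have "?r (P n) * P j = ?r (P n * ?r (P j))" by (simp add: pcompose_mult rr)
      then have "integral {0..1} (poly (?r (P n) * P j)) = integral {0..1} (poly (?r (P j) * P n))"
        by (simp only: integral_poly_reflect mult.commute)
      also have "\<dots> = 0" using j by (intro orthogonal_lower_degree) (simp add: deg)
      finally have 1: "integral {0..1} (poly (?r (P n) * P j)) = 0" .
      have "?d * P j = ?r (P n) * P j + smult (- c) (P n * P j)" by (simp add: algebra_simps)
      then show "integral {0..1} (poly (?d * P j)) = 0"
        using j by (simp only: integral_poly_add integral_poly_smult 1) (simp add: P_orthogonal)
    qed
  qed
  then have eq: "?r (P n) = smult c (P n)" by simp
  then have "P n = smult (c * c) (P n)" using rr[of "P n"] by (simp add: pcompose_smult)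
  then have "c * c = 1" by (metis poly_P_1 poly_smult mult.right_neutral)
  with eq show ?thesis by (auto simp: power2_eq_square)
qed

end

section \<open>Lobatto quadrature: exactness and mirror symmetry\<close>

locale lobatto = legendre P for P :: "nat \<Rightarrow> real poly" +
  fixes k :: nat and t :: "nat \<Rightarrow> real"
  assumes k_pos: "1 \<le> k" and abscissae: "lobatto_abscissae P k t"
begin

abbreviation "b \<equiv> quadrature_weight k t"

definition nodal :: "real poly" where "nodal = [:0, -1, 1:] * pderiv (P k)"

lemma t_0 [simp]: "t 0 = 0" and t_k [simp]: "t k = 1"
  using abscissae by (auto simp: lobatto_abscissae_def)

lemma t_strict_mono: "strict_mono_on {..k} t"
  using abscissae by (simp add: lobatto_abscissae_def atLeast0AtMost)

lemma t_inj: "inj_on t {..k}"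
  using t_strict_mono by (rule strict_mono_on_imp_inj_on)

lemma t_range: "t ` {..k} = {x. poly nodal x = 0}"
  using abscissae
  by (simp add: lobatto_abscissae_def nodal_def atLeast0AtMost power2_eq_square algebra_simps)

lemma degree_nodal: "degree nodal = Suc k" and nodal_nonzero: "nodal \<noteq> 0"
proof -
  have "pderiv (P k) \<noteq> 0" using k_pos by (simp add: pderiv_eq_0_iff)
  then show "degree nodal = Suc k" "nodal \<noteq> 0"
    unfolding nodal_def using k_pos
    by (simp_all add: degree_mult_eq degree_pderiv del: mult_pCons_left mult_pCons_right)
qed

definition lagrange :: "nat \<Rightarrow> real poly" where
  "lagrange i = (\<Prod>j\<in>{..k} - {i}. smult (1 / (t i - t j)) [:- t j, 1:])"

lemma poly_lagrange: "poly (lagrange i) x = (\<Prod>j\<in>{..k} - {i}. (x - t j) / (t i - t j))"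
  by (simp add: lagrange_def poly_prod diff_divide_distrib)

lemma degree_lagrange: "i \<le> k \<Longrightarrow> degree (lagrange i) \<le> k"
proof -
  assume "i \<le> k"
  have "degree (lagrange i) \<le> sum (degree \<circ> (\<lambda>j. smult (1 / (t i - t j)) [:- t j, 1:])) ({..k} - {i})"
    unfolding lagrange_def by (intro degree_prod_sum_le) simp
  also have "\<dots> \<le> (\<Sum>j\<in>{..k} - {i}. 1)"
    by (intro sum_mono) (simp add: degree_smult_le[THEN order.trans])
  finally show ?thesis using \<open>i \<le> k\<close> by simp
qed

lemma lagrange_node:
  assumes "i \<le> k" "j \<le> k"
  shows "poly (lagrange i) (t j) = (if i = j then 1 else 0)"
proof (cases "i = j")
  case True
  have "t j \<noteq> t l" if "l \<in> {..k} - {j}" for l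
    using inj_onD[OF t_inj, of j l] assms that by auto
  then show ?thesis using True by (auto simp: poly_lagrange intro!: prod.neutral)
next
  case False
  then have "(\<Prod>l\<in>{..k} - {i}. (t j - t l) / (t i - t l)) = 0"
    using assms by (intro prod_zero) auto
  then show ?thesis using False by (simp add: poly_lagrange)
qed

lemma b_eq: "b i = integral {0..1} (poly (lagrange i))"
  unfolding quadrature_weight_def poly_lagrange[abs_def] atLeast0AtMost ..

lemma quadrature_exact_interpolation:
  assumes "degree p \<le> k"
  shows "(\<Sum>i\<le>k. b i * poly p (t i)) = integral {0..1} (poly p)"
proof -
  have "p = (\<Sum>i\<le>k. smult (poly p (t i)) (lagrange i))" (is "_ = ?q")
  proof (rule poly_eqI_card[of "t ` {..k}" k])
    show "card (t ` {..k}) > k" by (simp add: card_image t_inj)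
    show "degree ?q \<le> k"
      by (intro degree_sum_le) (auto intro: degree_smult_le[THEN order.trans] degree_lagrange)
    show "poly p x = poly ?q x" if "x \<in> t ` {..k}" for x
      using that by (auto simp: poly_sum lagrange_node if_distrib cong: if_cong)
  qed (use assms in auto)
  then have "integral {0..1} (poly p) = (\<Sum>i\<le>k. poly p (t i) * b i)"
    by (metis (no_types, lifting) integral_poly_sum integral_poly_smult b_eq sum.cong)
  then show ?thesis by (simp add: mult.commute)
qed

text \<open>Division by \<open>nodal\<close> leaves a remainder of degree at most \<open>k\<close>
  with the same node values, for which the interpolatory rule is exact. The multiple of
  \<open>nodal\<close> contributes nothing to the integral: integration by parts moves the
  derivative off \<open>P k\<close>, the factor x^2 - x kills the boundary terms, and the other
  factor has degree less than \<open>k\<close>.\<close>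

lemma quadrature_exact:
  assumes "degree p \<le> 2 * k - 1"
  shows "(\<Sum>i\<le>k. b i * poly p (t i)) = integral {0..1} (poly p)"
proof -
  let ?q = "p div nodal" and ?r = "p mod nodal"
  have p: "p = ?q * nodal + ?r" by (rule div_mult_mod_eq[symmetric])
  have r: "degree ?r \<le> k"
    using degree_mod_less'[of nodal p] degree_nodal nodal_nonzero by (cases "?r = 0") auto
  have "integral {0..1} (poly (?q * nodal)) = 0"
  proof (cases "?q = 0")
    case False
    define g where "g = ?q * [:0, -1, 1:]"
    \<comment> \<open>The product equals \<open>p - ?r\<close>. The second alternative of the next
      claim is contradictory and only reflects the maximum.\<close>
    have "degree (?q * nodal) \<le> max (degree p) (degree ?r)"
      using degree_diff_le_max[of p ?r] by (simp add: minus_mod_eq_div_mult)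
    then have "degree ?q + Suc k \<le> 2 * k - 1 \<or> degree ?q + Suc k \<le> k"
      using False nodal_nonzero degree_nodal assms r by (auto simp: degree_mult_eq)
    then have "degree (pderiv g) < k"
      using False k_pos unfolding g_def degree_pderiv
      by (subst degree_mult_eq) auto
    then have "integral {0..1} (poly (pderiv g * P k)) = 0" by (rule orthogonal_lower_degree)
    moreover have "?q * nodal = g * pderiv (P k)" by (simp only: g_def nodal_def mult.assoc)
    then have "?q * nodal = pderiv (g * P k) + smult (-1) (pderiv g * P k)"
      by (simp add: pderiv_mult)
    moreover have "integral {0..1} (poly (pderiv (g * P k))) = 0"
      by (simp only: integral_pderiv) (simp add: g_def)
    ultimately show ?thesis by (simp only: integral_poly_add integral_poly_smult)
  qed (simp add: poly_0[abs_def])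
  then have "integral {0..1} (poly p) = integral {0..1} (poly ?r)"
    by (subst p, subst integral_poly_add) simp
  also have "\<dots> = (\<Sum>i\<le>k. b i * poly ?r (t i))"
    using quadrature_exact_interpolation[OF r] by simp
  also have "\<dots> = (\<Sum>i\<le>k. b i * poly p (t i))"
  proof (rule sum.cong)
    fix i assume "i \<in> {..k}"
    then have "poly nodal (t i) = 0" using t_range by auto
    then show "b i * poly ?r (t i) = b i * poly p (t i)"
      by (metis p poly_add poly_mult mult_zero_right add.left_neutral)
  qed simp
  finally show ?thesis by simp
qed

text \<open>Differentiation lowers the degree by one, so the increment of \<open>p\<close> is exact
  up to degree \<open>2 * k\<close>. This is the source of the bound on the degree of polynomial
  Hamiltonians.\<close>

lemma quadrature_pderiv:
  assumes "degree p \<le> 2 * k"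
  shows "(\<Sum>i\<le>k. b i * poly (pderiv p) (t i)) = poly p 1 - poly p 0"
  using assms by (subst quadrature_exact) (simp_all add: integral_pderiv degree_pderiv)

lemma discrete_orthogonal:
  assumes "i + j \<le> 2 * k - 1"
  shows "(\<Sum>l\<le>k. b l * (poly (P i) (t l) * poly (P j) (t l)))
    = (if i = j then 1 / (2 * real i + 1) else 0)"
  using quadrature_exact[of "P i * P j"] assms degree_mult_le[of "P i" "P j"]
  by (simp add: P_orthogonal)

lemma t_bounds: assumes "i \<le> k" shows "0 \<le> t i" "t i \<le> 1"
proof -
  show "0 \<le> t i" using strict_mono_on_leD[OF t_strict_mono, of 0 i] assms by simp
  show "t i \<le> 1" using strict_mono_on_leD[OF t_strict_mono, of i k] assms by simp
qed

lemma nodal_reflect: "poly nodal x = 0 \<Longrightarrow> poly nodal (1 - x) = 0"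
proof -
  assume x: "poly nodal x = 0"
  obtain c where c: "c\<^sup>2 = 1" "pcompose (P k) [:1, -1:] = smult c (P k)"
    using legendre_reflect by blast
  from arg_cong[OF c(2), of pderiv]
  have "- pcompose (pderiv (P k)) [:1, -1:] = smult c (pderiv (P k))"
    by (simp add: pderiv_pcompose pderiv_smult pderiv_pCons)
  from arg_cong[OF this, of "\<lambda>p. poly p x"]
  have "poly (pderiv (P k)) (1 - x) = - c * poly (pderiv (P k)) x"
    by (simp add: poly_pcompose)
  then show ?thesis using x by (auto simp: nodal_def algebra_simps)
qed

text \<open>Reflection maps the node set into itself and reverses the order, so the induced map
  \<open>\<sigma>\<close> on indices is strictly decreasing. Induction from either end squeezes
  \<open>\<sigma> i\<close> to \<open>k - i\<close>.\<close>

lemma t_reflect: assumes "i \<le> k" shows "t (k - i) = 1 - t i"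
proof -
  have sub: "(\<lambda>x. 1 - x) ` t ` {..k} \<subseteq> t ` {..k}"
    using nodal_reflect unfolding t_range by auto
  have "\<exists>j\<le>k. 1 - t i = t j" if "i \<le> k" for i using sub that by auto
  then obtain \<sigma> where \<sigma>: "\<And>i. i \<le> k \<Longrightarrow> \<sigma> i \<le> k \<and> 1 - t i = t (\<sigma> i)" by metis
  have mono: "\<sigma> j < \<sigma> i" if "i < j" "j \<le> k" for i j
  proof -
    have "t (\<sigma> j) < t (\<sigma> i)"
      using strict_mono_onD[OF t_strict_mono, of i j] \<sigma>[of i] \<sigma>[of j] that by auto
    then show ?thesis
      using strict_mono_on_leD[OF t_strict_mono, of "\<sigma> i" "\<sigma> j"] \<sigma>[of i] \<sigma>[of j] that
      by (meson atMost_iff leD le_less_linear less_imp_le_nat order.trans)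
  qed
  have up: "\<sigma> i \<le> k - i" if "i \<le> k" for i
    using that
  proof (induction i)
    case 0
    then show ?case using \<sigma>[of 0] by simp
  next
    case (Suc i)
    then show ?case using mono[of i "Suc i"] by fastforce
  qed
  have lo: "d \<le> \<sigma> (k - d)" if "d \<le> k" for d
    using that
  proof (induction d)
    case (Suc d)
    then show ?case using mono[of "k - Suc d" "k - d"] by fastforce
  qed simp
  have "\<sigma> i = k - i" using up[of i] lo[of "k - i"] assms by simp
  then show ?thesis using \<sigma>[OF assms] by simp
qed

text \<open>At the nodes the reflected Lagrange polynomial of index \<open>i\<close> takes the
  values of the one of index \<open>k - i\<close>. Integrating it exactly with the rule itself
  therefore picks out \<open>b (k - i)\<close>, while reflection leaves the integral at
  \<open>b i\<close>.\<close>

lemma b_reflect: assumes "i \<le> k" shows "b (k - i) = b i"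
proof -
  have "b i = integral {0..1} (poly (pcompose (lagrange i) [:1, -1:]))"
    by (simp add: b_eq integral_poly_reflect)
  also have "\<dots> = (\<Sum>l\<le>k. b l * poly (pcompose (lagrange i) [:1, -1:]) (t l))"
    using degree_lagrange[OF assms]
    by (intro quadrature_exact_interpolation[symmetric]) (simp add: degree_pcompose)
  also have "\<dots> = (\<Sum>l\<le>k. b l * (if k - i = l then 1 else 0))"
  proof (rule sum.cong)
    fix l assume "l \<in> {..k}"
    then have "poly (pcompose (lagrange i) [:1, -1:]) (t l) = poly (lagrange i) (t (k - l))"
      by (simp add: poly_pcompose t_reflect)
    also have "\<dots> = (if i = k - l then 1 else 0)"
      using assms by (simp add: lagrange_node)
    also have "\<dots> = (if k - i = l then 1 else 0)" using assms \<open>l \<in> {..k}\<close> by auto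
    finally show "b l * poly (pcompose (lagrange i) [:1, -1:]) (t l)
      = b l * (if k - i = l then 1 else 0)" by simp
  qed simp
  also have "\<dots> = b (k - i)" by (simp add: if_distrib cong: if_cong)
  finally show ?thesis ..
qed

end



section \<open>Runge-Kutta form of the method\<close>

text \<open>Injectivity gives a nonzero determinant, hence a unit in the matrix ring. It serves
  twice: for \<open>I_fund\<close>, and for the complex stage matrix of the linear test
  equation.\<close>

lemma mat_inverse_if_injective:
  fixes A :: "'a::field mat"
  assumes A: "A \<in> carrier_mat n n"
    and inj: "\<And>v. v \<in> carrier_vec n \<Longrightarrow> A *\<^sub>v v = 0\<^sub>v n \<Longrightarrow> v = 0\<^sub>v n"
  obtains B where "mat_inverse A = Some B" "A * B = 1\<^sub>m n" "B * A = 1\<^sub>m n" "B \<in> carrier_mat n n"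
proof -
  have "Determinant.det A \<noteq> 0"
    using inj by (auto simp: det_0_iff_vec_prod_zero_field[OF A])
  then have "A \<in> Units (ring_mat TYPE('a) n ())" by (rule det_non_zero_imp_unit[OF A])
  then obtain B where "mat_inverse A = Some B"
    using mat_inverse(1)[OF A, where b="()"] by (cases "mat_inverse A") auto
  then show thesis using mat_inverse(2)[OF A, of B] that by blast
qed

lemma kron_apply_mult:
  assumes "A \<in> carrier_mat n m" "B \<in> carrier_mat m p" "i < n"
  shows "kron_apply (A * B) v i = kron_apply A (kron_apply B v) i"
proof -
  have "kron_apply (A * B) v i = (\<Sum>j<p. (\<Sum>l<m. A $$ (i, l) * B $$ (l, j)) *\<^sub>R v j)"
    using assms by (auto simp: kron_apply_def scalar_prod_def atLeast0LessThan intro!: sum.cong)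
  also have "\<dots> = (\<Sum>l<m. \<Sum>j<p. (A $$ (i, l) * B $$ (l, j)) *\<^sub>R v j)"
    by (subst sum.swap) (simp add: scaleR_left.sum)
  also have "\<dots> = kron_apply A (kron_apply B v) i"
    using assms by (auto simp: kron_apply_def scaleR_sum_right intro!: sum.cong)
  finally show ?thesis .
qed

lemma kron_apply_cong:
  "(\<And>j. j < dim_col A \<Longrightarrow> v j = w j) \<Longrightarrow> kron_apply A v i = kron_apply A w i"
  by (simp add: kron_apply_def)

lemma kron_apply_diag: "i < n \<Longrightarrow> kron_apply (mat_diag n d) v i = d i *\<^sub>R v i"
  by (simp add: kron_apply_def mat_diag_def if_distrib [where f="\<lambda>x. x *\<^sub>R _"] cong: if_cong)

lemma kron_apply_one: "i < n \<Longrightarrow> kron_apply (1\<^sub>m n) v i = v i"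
  using kron_apply_diag[of i n "\<lambda>_. 1" v] by simp

locale hbvm_scheme = lobatto P k t for P k t +
  fixes s :: nat and c \<tau> :: "nat \<Rightarrow> real"
  assumes s_pos: "1 \<le> s" and s_le_k: "s \<le> k"
    and split: "abscissae_split k s t c \<tau>"
begin

definition moment :: "nat \<Rightarrow> (nat \<Rightarrow> 'a) \<Rightarrow> 'a::real_vector" where
  "moment j v = (\<Sum>l\<le>k. (b l * poly (P j) (t l)) *\<^sub>R v l)"

text \<open>The factor is the reciprocal of the squared norm of \<open>P j\<close>, so these are the
  coefficients of the discrete orthogonal projection.\<close>

definition coef :: "nat \<Rightarrow> (nat \<Rightarrow> 'a) \<Rightarrow> 'a::real_vector" where
  "coef j v = (2 * real j + 1) *\<^sub>R moment j v"

definition slope :: "(nat \<Rightarrow> 'a) \<Rightarrow> real \<Rightarrow> 'a::real_vector" where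
  "slope v x = (\<Sum>j<s. poly (P j) x *\<^sub>R coef j v)"

text \<open>This is \<open>y0\<close> plus \<open>h\<close> times the integral of
  \<open>slope v\<close> from 0. The node values \<open>v\<close> are a free argument, so that the
  implicitness of the method is confined to \<open>stages\<close>.\<close>

definition curve :: "real \<Rightarrow> 'a \<Rightarrow> (nat \<Rightarrow> 'a) \<Rightarrow> real \<Rightarrow> 'a::real_vector" where
  "curve h y0 v x = y0 + h *\<^sub>R (\<Sum>j<s. poly (antideriv (P j)) x *\<^sub>R coef j v)"

definition stages :: "('a \<Rightarrow> 'a) \<Rightarrow> real \<Rightarrow> 'a \<Rightarrow> (nat \<Rightarrow> 'a::real_vector) \<Rightarrow> bool" where
  "stages f h y0 u \<longleftrightarrow> (\<forall>i\<le>k. u i = curve h y0 (\<lambda>l. f (u l)) (t i))"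

text \<open>Entries of the Runge-Kutta matrix C. They express stages directly through node values,
  the form suited to reflection, to the linear test equation and to the contraction
  argument.\<close>

definition rk :: "nat \<Rightarrow> nat \<Rightarrow> real" where
  "rk i l = (\<Sum>j<s. poly (antideriv (P j)) (t i) * (2 * real j + 1) * poly (P j) (t l)) * b l"

lemma curve_rk: "curve h y0 v (t i) = y0 + h *\<^sub>R (\<Sum>l\<le>k. rk i l *\<^sub>R v l)"
proof -
  have "(\<Sum>j<s. poly (antideriv (P j)) (t i) *\<^sub>R coef j v) = (\<Sum>l\<le>k. rk i l *\<^sub>R v l)"
    unfolding coef_def moment_def rk_def scaleR_sum_right scaleR_left.sum sum_distrib_right
    by (subst sum.swap) (simp add: mult_ac)
  then show ?thesis by (simp add: curve_def)
qed

lemma curve_0 [simp]: "curve h y0 v 0 = y0"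
  by (simp add: curve_def)

lemma stages_0: "stages f h y0 u \<Longrightarrow> u 0 = y0"
  by (auto simp: stages_def)

lemma moment_cong: "(\<And>l. l \<le> k \<Longrightarrow> v l = w l) \<Longrightarrow> moment j v = moment j w"
  by (simp add: moment_def)

lemma c_0 [simp]: "c 0 = 0" and c_s [simp]: "c s = 1"
  using split by (auto simp: abscissae_split_def)

lemma c_inj: "inj_on c {..s}"
  using split by (auto simp: abscissae_split_def atLeast0AtMost intro: strict_mono_on_imp_inj_on)

lemma t_cases:
  assumes "j \<le> k"
  obtains i where "i \<le> s" "t j = c i" | i where "i \<in> {1..k - s}" "t j = \<tau> i"
proof -
  have "t j \<in> c ` {0..s} \<union> \<tau> ` {1..k - s}"
    using split assms by (metis abscissae_split_def atLeastAtMost_iff image_eqI zero_le)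
  then show thesis using that by auto
qed

lemma c_node: assumes "i \<le> s" shows "\<exists>j\<le>k. t j = c i"
proof -
  have "c i \<in> t ` {0..k}" using split assms by (auto simp: abscissae_split_def)
  then show ?thesis by auto
qed

lemma \<tau>_node: assumes "i \<in> {1..k - s}" shows "\<exists>j\<le>k. t j = \<tau> i"
proof -
  have "\<tau> i \<in> t ` {0..k}" using split assms by (auto simp: abscissae_split_def)
  then show ?thesis by auto
qed

lemma c_nonneg: "i \<le> s \<Longrightarrow> 0 \<le> c i"
  using c_node t_bounds by metis

lemma \<tau>_nonneg: "i \<in> {1..k - s} \<Longrightarrow> 0 \<le> \<tau> i"
  using \<tau>_node t_bounds by metis

lemma I_fund_carrier [simp]: "I_fund s P c \<in> carrier_mat s s"
  and I_silent_carrier [simp]: "I_silent k s P \<tau> \<in> carrier_mat (k - s) s"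
  and P_bar_carrier [simp]: "P_bar k s P t \<in> carrier_mat (Suc k) s"
  by (simp_all add: I_fund_def I_silent_def P_bar_def)

lemma D_mat_carrier [simp]: "D_mat s \<in> carrier_mat s s"
  and Omega_carrier [simp]: "Omega_bar k t \<in> carrier_mat (Suc k) (Suc k)"
  by (simp_all add: D_mat_def Omega_bar_def)

lemma kron_I_fund:
  assumes "i < s"
  shows "kron_apply (I_fund s P c) v i = (\<Sum>j<s. poly (antideriv (P j)) (c (i + 1)) *\<^sub>R v j)"
  using assms c_nonneg[of "i + 1"] by (auto simp: kron_apply_def I_fund_def integral_poly)

lemma kron_I_silent:
  assumes "i < k - s"
  shows "kron_apply (I_silent k s P \<tau>) v i = (\<Sum>j<s. poly (antideriv (P j)) (\<tau> (i + 1)) *\<^sub>R v j)"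
  using assms \<tau>_nonneg[of "i + 1"] by (auto simp: kron_apply_def I_silent_def integral_poly)

lemma kron_projection:
  assumes "j < s"
  shows "kron_apply (D_mat s * transpose_mat (P_bar k s P t) * Omega_bar k t) v j = coef j v"
proof -
  have T: "transpose_mat (P_bar k s P t) \<in> carrier_mat s (Suc k)" by simp
  have "kron_apply (D_mat s * transpose_mat (P_bar k s P t) * Omega_bar k t) v j
      = kron_apply (D_mat s) (kron_apply (transpose_mat (P_bar k s P t)) (kron_apply (Omega_bar k t) v)) j"
    using kron_apply_mult[OF mult_carrier_mat[OF D_mat_carrier T] Omega_carrier assms]
      kron_apply_mult[OF D_mat_carrier T assms] by metis
  also have "\<dots> = (2 * real j + 1) *\<^sub>R
      kron_apply (transpose_mat (P_bar k s P t)) (kron_apply (Omega_bar k t) v) j"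
    using assms by (simp add: D_mat_def kron_apply_diag)
  also have "kron_apply (transpose_mat (P_bar k s P t)) (kron_apply (Omega_bar k t) v) j
      = (\<Sum>l<k + 1. poly (P j) (t l) *\<^sub>R kron_apply (Omega_bar k t) v l)"
    using assms by (auto simp: kron_apply_def P_bar_def intro!: sum.cong)
  also have "\<dots> = moment j v"
    unfolding moment_def
    by (intro sum.cong) (auto simp: Omega_bar_def kron_apply_diag mult.commute)
  finally show ?thesis by (simp add: coef_def)
qed

lemma kron_fundamental:
  assumes "i < s"
  shows "y0 + h *\<^sub>R kron_apply (I_fund s P c * D_mat s * transpose_mat (P_bar k s P t) * Omega_bar k t) v i
    = curve h y0 v (c (i + 1))"
proof -
  let ?B = "D_mat s * transpose_mat (P_bar k s P t) * Omega_bar k t"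
  have T: "transpose_mat (P_bar k s P t) \<in> carrier_mat s (Suc k)" by simp
  have B: "?B \<in> carrier_mat s (Suc k)" by (intro mult_carrier_mat[OF mult_carrier_mat[OF D_mat_carrier T] Omega_carrier])
  have "I_fund s P c * D_mat s * transpose_mat (P_bar k s P t) * Omega_bar k t = I_fund s P c * ?B"
    by (simp add: assoc_mult_mat[OF I_fund_carrier D_mat_carrier T]
        assoc_mult_mat[OF I_fund_carrier mult_carrier_mat[OF D_mat_carrier T] Omega_carrier])
  then have "kron_apply (I_fund s P c * D_mat s * transpose_mat (P_bar k s P t) * Omega_bar k t) v i
      = kron_apply (I_fund s P c) (kron_apply ?B v) i"
    using kron_apply_mult[OF I_fund_carrier B assms] by simp
  also have "\<dots> = (\<Sum>j<s. poly (antideriv (P j)) (c (i + 1)) *\<^sub>R coef j v)"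
    using assms by (simp add: kron_I_fund kron_projection)
  finally show ?thesis by (simp add: curve_def)
qed

text \<open>A kernel vector combines the antiderivatives into a polynomial \<open>Q\<close> of
  degree at most \<open>s\<close> that vanishes at \<open>c 1\<close>, ..., \<open>c s\<close>, and
  also at \<open>c 0 = 0\<close> where all antiderivatives vanish. With \<open>s + 1\<close> zeros
  it is zero, and its derivative is a vanishing combination of Legendre polynomials.\<close>

lemma I_fund_injective:
  assumes v: "v \<in> carrier_vec s" and 0: "I_fund s P c *\<^sub>v v = 0\<^sub>v s"
  shows "v = 0\<^sub>v s"
proof -
  define a where "a = vec_index v"
  define Q where "Q = (\<Sum>j<s. smult (a j) (antideriv (P j)))"
  have "poly Q (c (i + 1)) = 0" if "i < s" for i
  proof -
    have "0 = vec_index (I_fund s P c *\<^sub>v v) i" using that 0 by simp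
    also have "\<dots> = (\<Sum>j<s. poly (antideriv (P j)) (c (i + 1)) * a j)"
      using that v c_nonneg[of "i + 1"]
      by (auto simp: I_fund_def scalar_prod_def atLeast0LessThan a_def integral_poly intro!: sum.cong)
    finally show ?thesis by (simp add: Q_def poly_sum mult.commute)
  qed
  moreover have "poly Q (c 0) = 0" by (simp add: Q_def poly_sum)
  ultimately have "poly Q (c i) = 0" if "i \<le> s" for i
    using that by (cases i) auto
  moreover have "degree (antideriv (P j)) \<le> s" if "j < s" for j
    using degree_antideriv[of "P j"] that by simp
  ultimately have "Q = 0"
    by (intro poly_eqI_card[of "c ` {..s}" s])
       (auto simp: card_image c_inj Q_def intro!: degree_sum_le
         intro: degree_smult_le[THEN order.trans])
  have "(\<Sum>j<s. smult (a j) (P j)) = pderiv Q" by (simp add: Q_def pderiv_sum pderiv_smult)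
  then have Z: "(\<Sum>j<s. smult (a j) (P j)) = 0" using \<open>Q = 0\<close> by simp
  have "a i = 0" if "i < s" for i
  proof -
    have "(\<Sum>j<s. smult (a j) (P j * P i)) = 0"
      using Z by (simp flip: sum_distrib_right mult_smult_left)
    then have "(\<Sum>j<s. a j * integral {0..1} (poly (P j * P i))) = 0"
      by (metis (no_types, lifting) integral_poly_sum integral_poly_smult integral_0 poly_0 sum.cong integral_cong)
    then show ?thesis
      using that by (simp add: P_orthogonal if_distrib add_nonneg_eq_0_iff cong: if_cong)
  qed
  then show ?thesis using v by (intro eq_vecI) (auto simp: a_def)
qed

text \<open>The fundamental values determine the polynomial curve: the inverse of
  \<open>I_fund\<close> recovers its scaled Legendre coefficients, and \<open>I_silent\<close>
  evaluates the same curve at the silent abscissae. Hence silent and fundamental stages obey one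
  formula.\<close>

lemma kron_silent:
  assumes "i < k - s" and y: "\<And>j. j < s \<Longrightarrow> y (j + 1) = curve h y0 v (c (j + 1))"
  shows "y0 + kron_apply (I_silent k s P \<tau> * the (mat_inverse (I_fund s P c))) (\<lambda>j. y (j + 1) - y0) i
    = curve h y0 v (\<tau> (i + 1))"
proof -
  obtain B where B: "mat_inverse (I_fund s P c) = Some B" "B * I_fund s P c = 1\<^sub>m s" "B \<in> carrier_mat s s"
    using mat_inverse_if_injective[OF I_fund_carrier I_fund_injective] by blast
  let ?g = "\<lambda>j. h *\<^sub>R coef j v"
  have y': "y (j + 1) - y0 = kron_apply (I_fund s P c) ?g j" if "j < s" for j
    using that y[OF that] by (simp add: curve_def kron_I_fund scaleR_sum_right mult.commute)
  have inv: "kron_apply B (\<lambda>j. y (j + 1) - y0) j = ?g j" if "j < s" for j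
  proof -
    have "kron_apply B (\<lambda>j. y (j + 1) - y0) j = kron_apply B (kron_apply (I_fund s P c) ?g) j"
      using B(3) y' by (intro kron_apply_cong) auto
    also have "\<dots> = kron_apply (1\<^sub>m s) ?g j"
      using kron_apply_mult[OF B(3) I_fund_carrier that] B(2) by metis
    finally show ?thesis using that by (simp add: kron_apply_one)
  qed
  have "kron_apply (I_silent k s P \<tau> * B) (\<lambda>j. y (j + 1) - y0) i
      = kron_apply (I_silent k s P \<tau>) (kron_apply B (\<lambda>j. y (j + 1) - y0)) i"
    using assms(1) B(3) by (intro kron_apply_mult) auto
  also have "\<dots> = kron_apply (I_silent k s P \<tau>) ?g i"
    using inv by (intro kron_apply_cong) (simp add: I_silent_def)
  also have "\<dots> = h *\<^sub>R (\<Sum>j<s. poly (antideriv (P j)) (\<tau> (i + 1)) *\<^sub>R coef j v)"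
    using assms(1) by (simp add: kron_I_silent scaleR_sum_right mult.commute)
  finally show ?thesis using B(1) by (simp add: curve_def)
qed

text \<open>The last conclusion carries bounds on \<open>y\<close> and \<open>w\<close> over to all
  stages. The alternative \<open>y0\<close> is the stage at \<open>c 0\<close>, which such bounds do
  not mention.\<close>

lemma stages_if_hbvm_system:
  assumes "hbvm_system k s P t c \<tau> f h y0 y w"
  obtains u where "stages f h y0 u" "u k = y s"
    and "\<And>j. j \<le> k \<Longrightarrow> u j = y0 \<or> (\<exists>i\<in>{1..s}. u j = y i) \<or> (\<exists>i\<in>{1..k - s}. u j = w i)"
proof -
  let ?K = "I_fund s P c * D_mat s * transpose_mat (P_bar k s P t) * Omega_bar k t"
  let ?M = "I_silent k s P \<tau> * the (mat_inverse (I_fund s P c))"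
  from assms obtain u where y0: "y 0 = y0"
    and u: "\<forall>j\<in>{0..k}. (\<forall>i\<in>{0..s}. t j = c i \<longrightarrow> u j = y i) \<and>
                     (\<forall>i\<in>{1..k - s}. t j = \<tau> i \<longrightarrow> u j = w i)"
    and y: "\<forall>i<s. y (i + 1) - y0 = h *\<^sub>R kron_apply ?K (\<lambda>j. f (u j)) i"
    and w: "\<forall>i<k - s. w (i + 1) = y0 + kron_apply ?M (\<lambda>j. y (j + 1) - y0) i"
    unfolding hbvm_system_def by (elim conjE exE)
  have uc: "u j = y i" if "j \<le> k" "i \<le> s" "t j = c i" for i j using u that by simp
  have u\<tau>: "u j = w i" if "j \<le> k" "i \<in> {1..k - s}" "t j = \<tau> i" for i j using u that by simp
  let ?u = "curve h y0 (\<lambda>j. f (u j))"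
  have y': "y (i + 1) = ?u (c (i + 1))" if "i < s" for i
    using y that kron_fundamental[OF that, of y0 h "\<lambda>j. f (u j)"] by (simp add: algebra_simps)
  have yc: "y i = ?u (c i)" if "i \<le> s" for i
    using y'[of "i - 1"] that y0 by (cases i) auto
  have w': "w (i + 1) = ?u (\<tau> (i + 1))" if "i < k - s" for i
    using w that kron_silent[OF that y'] by simp
  have w\<tau>: "w i = ?u (\<tau> i)" if "i \<in> {1..k - s}" for i
    using w'[of "i - 1"] that by auto
  show thesis
  proof (rule that)
    show "stages f h y0 u"
      unfolding stages_def
    proof (intro allI impI)
      fix j assume j: "j \<le> k"
      then show "u j = ?u (t j)"
        by (cases rule: t_cases) (use j uc u\<tau> yc w\<tau> in auto)
    qed
    show "u k = y s" using uc[of k s] by simp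
    fix j assume j: "j \<le> k"
    then show "u j = y0 \<or> (\<exists>i\<in>{1..s}. u j = y i) \<or> (\<exists>i\<in>{1..k - s}. u j = w i)"
    proof (cases rule: t_cases)
      case (1 i)
      then show ?thesis using uc[OF j, of i] y0 by (cases "i = 0") auto
    next
      case (2 i)
      then show ?thesis using u\<tau>[OF j, of i] by auto
    qed
  qed
qed

lemma hbvm_system_if_stages:
  assumes u: "stages f h y0 u"
  obtains y w where "hbvm_system k s P t c \<tau> f h y0 y w" "u k = y s"
    and "\<And>i. i \<le> s \<Longrightarrow> \<exists>j\<le>k. y i = u j" and "\<And>i. i \<in> {1..k - s} \<Longrightarrow> \<exists>j\<le>k. w i = u j"
proof -
  let ?u = "curve h y0 (\<lambda>j. f (u j))"
  have ut: "u j = ?u (t j)" if "j \<le> k" for j using u that by (simp add: stages_def)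
  show thesis
  proof (rule that[of "\<lambda>i. ?u (c i)" "\<lambda>i. ?u (\<tau> i)"])
    show "hbvm_system k s P t c \<tau> f h y0 (\<lambda>i. ?u (c i)) (\<lambda>i. ?u (\<tau> i))"
      unfolding hbvm_system_def
    proof (intro conjI exI[of _ u] ballI allI impI)
      fix i assume "i < s"
      then show "?u (c (i + 1)) - y0 =
         h *\<^sub>R kron_apply (I_fund s P c * D_mat s * transpose_mat (P_bar k s P t) * Omega_bar k t)
                 (\<lambda>j. f (u j)) i"
        using kron_fundamental[of i y0 h "\<lambda>j. f (u j)"] by (simp add: algebra_simps)
    next
      fix i assume i: "i < k - s"
      show "?u (\<tau> (i + 1)) =
        y0 + kron_apply (I_silent k s P \<tau> * the (mat_inverse (I_fund s P c)))
               (\<lambda>j. ?u (c (j + 1)) - y0) i"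
        using kron_silent[OF i, of "\<lambda>i. ?u (c i)"] by simp
    qed (auto simp: ut)
    show "u k = ?u (c s)" using ut[of k] by simp
    show "\<exists>j\<le>k. ?u (c i) = u j" if "i \<le> s" for i using c_node[OF that] ut by metis
    show "\<exists>j\<le>k. ?u (\<tau> i) = u j" if "i \<in> {1..k - s}" for i using \<tau>_node[OF that] ut by metis
  qed
qed

lemma hbvm_iff: "(y0, y1) \<in> hbvm k s P t c \<tau> f h \<longleftrightarrow> (\<exists>u. stages f h y0 u \<and> u k = y1)"
proof
  assume "(y0, y1) \<in> hbvm k s P t c \<tau> f h"
  then obtain y w where "hbvm_system k s P t c \<tau> f h y0 y w" "y1 = y s"
    by (auto simp: hbvm_def)
  then show "\<exists>u. stages f h y0 u \<and> u k = y1" by (metis stages_if_hbvm_system)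
next
  assume "\<exists>u. stages f h y0 u \<and> u k = y1"
  then obtain y w where "hbvm_system k s P t c \<tau> f h y0 y w" "y1 = y s"
    by (metis hbvm_system_if_stages)
  then show "(y0, y1) \<in> hbvm k s P t c \<tau> f h" by (auto simp: hbvm_def)
qed

text \<open>Unlike \<open>hbvm_near\<close>, the right-hand side also bounds the stage of index 0,
  which is \<open>y0\<close> itself; this is why the radius has to be nonnegative.\<close>

lemma hbvm_near_iff:
  assumes "0 \<le> \<rho>"
  shows "(y0, y1) \<in> hbvm_near k s P t c \<tau> \<rho> f h
    \<longleftrightarrow> (\<exists>u. stages f h y0 u \<and> u k = y1 \<and> (\<forall>i\<le>k. dist y0 (u i) \<le> \<rho>))"
proof
  assume "(y0, y1) \<in> hbvm_near k s P t c \<tau> \<rho> f h"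
  then obtain y w where yw: "hbvm_system k s P t c \<tau> f h y0 y w" "y1 = y s"
    "\<forall>i\<in>{1..s}. dist y0 (y i) \<le> \<rho>" "\<forall>i\<in>{1..k - s}. dist y0 (w i) \<le> \<rho>"
    by (auto simp: hbvm_near_def)
  obtain u where u: "stages f h y0 u" "u k = y s"
    "\<And>j. j \<le> k \<Longrightarrow> u j = y0 \<or> (\<exists>i\<in>{1..s}. u j = y i) \<or> (\<exists>i\<in>{1..k - s}. u j = w i)"
    using stages_if_hbvm_system[OF yw(1)] by blast
  have "dist y0 (u j) \<le> \<rho>" if "j \<le> k" for j
    using u(3)[OF that] yw(3,4) assms by force
  then show "\<exists>u. stages f h y0 u \<and> u k = y1 \<and> (\<forall>i\<le>k. dist y0 (u i) \<le> \<rho>)"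
    using u yw(2) by blast
next
  assume "\<exists>u. stages f h y0 u \<and> u k = y1 \<and> (\<forall>i\<le>k. dist y0 (u i) \<le> \<rho>)"
  then obtain u where u: "stages f h y0 u" "u k = y1" "\<And>i. i \<le> k \<Longrightarrow> dist y0 (u i) \<le> \<rho>" by blast
  obtain y w where yw: "hbvm_system k s P t c \<tau> f h y0 y w" "u k = y s"
    "\<And>i. i \<le> s \<Longrightarrow> \<exists>j\<le>k. y i = u j" "\<And>i. i \<in> {1..k - s} \<Longrightarrow> \<exists>j\<le>k. w i = u j"
    using hbvm_system_if_stages[OF u(1)] by blast
  have "\<forall>i\<in>{1..s}. dist y0 (y i) \<le> \<rho>" "\<forall>i\<in>{1..k - s}. dist y0 (w i) \<le> \<rho>"
    using yw(3,4) u(3) by (metis atLeastAtMost_iff)+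
  then show "(y0, y1) \<in> hbvm_near k s P t c \<tau> \<rho> f h"
    using yw(1,2) u(2) unfolding hbvm_near_def by blast
qed

end



section \<open>Symmetry, energy preservation and A-stability\<close>

lemma frechet_derivative_gradient:
  assumes "H differentiable (at y)"
  shows "frechet_derivative H (at y) v = gradient H y \<bullet> v"
proof -
  have lin: "linear (frechet_derivative H (at y))"
    using assms by (rule linear_frechet_derivative)
  have "frechet_derivative H (at y) v
      = frechet_derivative H (at y) (\<Sum>i\<in>UNIV. v $ i *\<^sub>R axis i 1)"
    by (simp add: basis_expansion flip: scalar_mult_eq_scaleR)
  also have "\<dots> = (\<Sum>i\<in>UNIV. v $ i *\<^sub>R frechet_derivative H (at y) (axis i 1))"
    by (simp add: linear_sum[OF lin] linear_scale[OF lin])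
  finally show ?thesis by (simp add: gradient_def inner_vec_def mult.commute)
qed

lemma has_vector_derivative_comp:
  assumes "(V has_vector_derivative v) (at x within A)" "(f has_derivative f') (at (V x))"
  shows "((\<lambda>x. f (V x)) has_vector_derivative f' v) (at x within A)"
proof -
  have "((\<lambda>x. f (V x)) has_derivative (\<lambda>r. f' (r *\<^sub>R v))) (at x within A)"
    using assms unfolding has_vector_derivative_def by (rule has_derivative_compose)
  moreover have "(\<lambda>r. f' (r *\<^sub>R v)) = (\<lambda>r. r *\<^sub>R f' v)"
    using has_derivative_linear[OF assms(2)] by (auto simp: linear_scale)
  ultimately show ?thesis by (simp add: has_vector_derivative_def)
qed

lemma symplectic_J_skew: "x \<bullet> (symplectic_J *v x) = 0"
proof -
  let ?J = "symplectic_J :: real ^ ('a + 'a) ^ ('a + 'a)"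
  have J: "?J $ i $ j = - ?J $ j $ i" for i j
    by (cases i; cases j) (auto simp: symplectic_J_def)
  have e: "x \<bullet> (?J *v x) = (\<Sum>i\<in>UNIV. \<Sum>j\<in>UNIV. x $ i * ?J $ i $ j * x $ j)"
    by (simp add: inner_vec_def matrix_vector_mult_def sum_distrib_left mult.assoc)
  also have "\<dots> = (\<Sum>j\<in>UNIV. \<Sum>i\<in>UNIV. - (x $ j * ?J $ j $ i * x $ i))"
    by (subst sum.swap, intro sum.cong refl, subst J) (simp add: mult_ac)
  also have "\<dots> = - (x \<bullet> (?J *v x))" by (simp add: e sum_negf)
  finally show ?thesis by simp
qed

lemma polynomial_of_degree_le_differentiable:
  assumes "polynomial_of_degree_le d H"
  shows "H differentiable (at y)"
proof -
  obtain a :: "('a \<Rightarrow> nat) \<Rightarrow> real" where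
    "H = (\<lambda>y. \<Sum>\<alpha> | (\<Sum>i\<in>UNIV. \<alpha> i) \<le> d. a \<alpha> * (\<Prod>i\<in>UNIV. (y $ i) ^ \<alpha> i))"
    using assms by (auto simp: polynomial_of_degree_le_def)
  moreover have "(\<lambda>y. \<Prod>i\<in>UNIV. (y $ i) ^ \<alpha> i) differentiable (at y)"
    for \<alpha> :: "'a \<Rightarrow> nat" and y :: "real ^ 'a"
    unfolding differentiable_def
    by (rule exI, rule has_derivative_prod)
       (auto intro!: derivative_eq_intros bounded_linear_imp_has_derivative bounded_linear_vec_nth)
  ultimately show ?thesis
    \<comment> \<open>A sum over an infinite set is 0 by convention, hence differentiable as
      well.\<close>
    by (cases "finite {\<alpha> :: 'a \<Rightarrow> nat. (\<Sum>i\<in>UNIV. \<alpha> i) \<le> d}")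
       (auto intro!: differentiable_sum differentiable_mult)
qed

section \<open>Mirror symmetry of the coefficient matrix and of the method\<close>

context hbvm_scheme
begin

lemma antideriv_P_1: "poly (antideriv (P j)) 1 = (if j = 0 then 1 else 0)"
  using P_orthogonal[of 0 j] integral_poly[of 1 "P j"] by (auto split: if_splits)

text \<open>Reflection multiplies \<open>P j\<close> by a sign \<open>r\<close>, and its
  antiderivative by \<open>- r\<close> up to the additive constant given by the integral of
  \<open>P j\<close> over the unit interval. In the product the two signs cancel, and the constant
  is nonzero only for \<open>j = 0\<close>, where it leaves the weight \<open>b l\<close>.\<close>

lemma rk_reflect:
  assumes "i \<le> k" "l \<le> k"
  shows "rk (k - i) (k - l) = b l - rk i l"
proof -
  have "poly (antideriv (P j)) (1 - x) * poly (P j) (1 - y)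
    = (if j = 0 then 1 else 0) - poly (antideriv (P j)) x * poly (P j) y" for j x y
  proof -
    obtain r where r: "r\<^sup>2 = 1" "pcompose (P j) [:1, -1:] = smult r (P j)"
      using legendre_reflect by blast
    \<comment> \<open>The derivative of \<open>Q\<close> is -P_j(1 - x) + r P_j(x) = 0, so
      \<open>Q\<close> is constant and can be read off at 0.\<close>
    define Q where "Q = pcompose (antideriv (P j)) [:1, -1:] + smult r (antideriv (P j))"
    have "pderiv Q = 0"
      using r(2) by (simp add: Q_def pderiv_add pderiv_pcompose pderiv_smult pderiv_pCons)
    then obtain q where "Q = [:q:]" by (metis pderiv_eq_0_iff degree_eq_zeroE)
    then have "poly Q x = poly Q 0" by simp
    then have 1: "poly (antideriv (P j)) (1 - x)
        = (if j = 0 then 1 else 0) - r * poly (antideriv (P j)) x"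
      by (simp add: Q_def poly_pcompose antideriv_P_1 split: if_splits)
    have 2: "poly (P j) (1 - y) = r * poly (P j) y"
      using arg_cong[OF r(2), of "\<lambda>p. poly p y"] by (simp add: poly_pcompose)
    show ?thesis
    proof (cases "j = 0")
      case True
      then show ?thesis using 1 2 by simp
    next
      case False
      then show ?thesis using 1 2 r(1) by (simp add: power2_eq_square)
    qed
  qed
  note refl = this
  have "rk (k - i) (k - l) = (\<Sum>j<s. (2 * real j + 1) * (poly (antideriv (P j)) (1 - t i) * poly (P j) (1 - t l))) * b l"
    using assms unfolding rk_def by (simp add: t_reflect b_reflect mult_ac)
  also have "\<dots> = (\<Sum>j<s. (if j = 0 then 1 else 0)
      - poly (antideriv (P j)) (t i) * (2 * real j + 1) * poly (P j) (t l)) * b l"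
    unfolding refl by (intro arg_cong2[of _ _ _ _ "(*)"] sum.cong) (auto simp: algebra_simps)
  also have "\<dots> = b l - rk i l"
    using s_pos by (simp add: sum_subtractf rk_def left_diff_distrib)
  finally show ?thesis .
qed

lemma sum_reflect: "(\<Sum>l\<le>k. g (k - l)) = (\<Sum>l\<le>k. g l)"
  by (rule sum.reindex_bij_witness[of _ "\<lambda>l. k - l" "\<lambda>l. k - l"]) auto

text \<open>Mirror image of the first row, which is zero because antiderivatives vanish at
  \<open>t 0\<close>. So the last stage is the usual Runge-Kutta result of the step.\<close>

lemma rk_k: "l \<le> k \<Longrightarrow> rk k l = b l"
  using rk_reflect[of 0 "k - l"] b_reflect[of l] by (simp add: rk_def)

text \<open>By \<open>rk_reflect\<close>, the stage of index \<open>k - i\<close> and the last stage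
  differ by a sum in which the weights cancel. What remains is row \<open>i\<close> of the method,
  applied to the reversed stages with step \<open>- h\<close>.\<close>

lemma stages_reflect:
  assumes "stages f h y0 u"
  shows "stages f (- h) (u k) (\<lambda>i. u (k - i))"
  unfolding stages_def
proof (intro allI impI)
  fix i assume i: "i \<le> k"
  let ?v = "\<lambda>l. f (u (k - l))"
  have u: "u i = y0 + h *\<^sub>R (\<Sum>l\<le>k. rk i (k - l) *\<^sub>R ?v l)" if "i \<le> k" for i
  proof -
    have "u i = y0 + h *\<^sub>R (\<Sum>l\<le>k. rk i l *\<^sub>R f (u l))"
      using assms that by (simp add: stages_def curve_rk)
    also have "(\<Sum>l\<le>k. rk i l *\<^sub>R f (u l)) = (\<Sum>l\<le>k. rk i (k - l) *\<^sub>R ?v l)"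
      by (rule sum_reflect[symmetric])
    finally show ?thesis .
  qed
  have "u (k - i) = y0 + h *\<^sub>R (\<Sum>l\<le>k. (b l - rk i l) *\<^sub>R ?v l)"
    using u[of "k - i"] i by (simp add: rk_reflect)
  moreover have "u k = y0 + h *\<^sub>R (\<Sum>l\<le>k. b l *\<^sub>R ?v l)"
    using u[of k] by (simp add: rk_k b_reflect)
  ultimately show "u (k - i) = curve (- h) (u k) ?v (t i)"
    by (simp add: curve_rk scaleR_left_diff_distrib sum_subtractf scaleR_right_diff_distrib)
qed

lemma hbvm_symmetric:
  "symmetric_method (hbvm k s P t c \<tau> :: ('b::real_vector \<Rightarrow> 'b) \<Rightarrow> real \<Rightarrow> ('b \<times> 'b) set)"
proof -
  have "(y1, y0) \<in> hbvm k s P t c \<tau> f (- h)" if yy: "(y0, y1) \<in> hbvm k s P t c \<tau> f h"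
    for y0 y1 :: "'b::real_vector" and f h
  proof -
    obtain u where u: "stages f h y0 u" "u k = y1" using yy by (auto simp: hbvm_iff)
    then show ?thesis
      using stages_reflect[OF u(1)] stages_0[OF u(1)]
      by (auto simp: hbvm_iff intro!: exI[of _ "\<lambda>i. u (k - i)"])
  qed
  note rev = this
  have "hbvm k s P t c \<tau> f h = (hbvm k s P t c \<tau> f (- h))\<inverse>" for f :: "'b::real_vector \<Rightarrow> 'b" and h :: real
    using rev[of _ _ f h] rev[of _ _ f "- h"] by fastforce
  then show ?thesis
    unfolding symmetric_method_def adjoint_method_def by (intro ext)
qed

section \<open>Energy and squared norm along the curve\<close>

definition curve_poly :: "real \<Rightarrow> 'a \<Rightarrow> (nat \<Rightarrow> 'a) \<Rightarrow> 'a::real_inner \<Rightarrow> real poly" where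
  "curve_poly h y0 v e = [:y0 \<bullet> e:] + smult h (\<Sum>j<s. smult (coef j v \<bullet> e) (antideriv (P j)))"

lemma poly_curve_poly: "poly (curve_poly h y0 v e) x = curve h y0 v x \<bullet> e"
  by (simp add: curve_poly_def curve_def inner_add_left inner_sum_left poly_sum mult.commute)

lemma poly_pderiv_curve_poly: "poly (pderiv (curve_poly h y0 v e)) x = h * (slope v x \<bullet> e)"
proof -
  show ?thesis
    by (simp add: curve_poly_def slope_def pderiv_add pderiv_pCons pderiv_smult pderiv_sum inner_sum_left
        poly_sum mult.commute)
qed

lemma degree_curve_poly: "degree (curve_poly h y0 v e) \<le> s"
proof -
  have "degree (antideriv (P j)) \<le> s" if "j < s" for j
    using degree_antideriv[of "P j"] that by simp
  then show ?thesis unfolding curve_poly_def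
    by (intro degree_add_le degree_smult_le[THEN order.trans] degree_sum_le) auto
qed

lemma curve_has_vector_derivative:
  "(curve h y0 v has_vector_derivative h *\<^sub>R slope v x) (at x within A)"
proof -
  have "((\<lambda>x. poly (antideriv (P j)) x *\<^sub>R coef j v) has_vector_derivative poly (P j) x *\<^sub>R coef j v) (at x within A)" for j
    by (rule has_vector_derivative_scaleR[where g="\<lambda>_. coef j v" and g'=0, simplified])
       (auto intro: antideriv_DERIV)
  then show ?thesis
    unfolding curve_def[abs_def] slope_def
    by (auto intro!: derivative_eq_intros has_vector_derivative_sum)
qed

text \<open>The quadrature sum sees \<open>G\<close> only through its first \<open>s\<close>
  moments, and the result is symmetric in \<open>G\<close> and \<open>v\<close>. The first fact
  brings out the skew form in the energy increment, the second makes \<open>slope\<close> a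
  self-adjoint projection.\<close>

lemma weighted_sum_slope:
  "(\<Sum>i\<le>k. b i * (G i \<bullet> slope v (t i))) = (\<Sum>j<s. (2 * real j + 1) * (moment j G \<bullet> moment j v))"
proof -
  have "(\<Sum>i\<le>k. b i * (G i \<bullet> slope v (t i)))
      = (\<Sum>i\<le>k. \<Sum>j<s. (b i * poly (P j) (t i)) * (G i \<bullet> coef j v))"
    by (simp add: slope_def inner_sum_right sum_distrib_left mult_ac)
  also have "\<dots> = (\<Sum>j<s. moment j G \<bullet> coef j v)"
    by (subst sum.swap) (simp add: moment_def[of _ G] inner_sum_left)
  finally show ?thesis by (simp add: coef_def)
qed

text \<open>The sum only pairs moments of the gradient with \<open>J\<close> times the same moments.\<close>

lemma discrete_line_integral_zero:
  "(\<Sum>i\<le>k. b i * (gradient H (u i) \<bullet> slope (\<lambda>l. hamiltonian_field H (u l)) (t i))) = 0"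
proof -
  have "moment j (\<lambda>l. hamiltonian_field H (u l)) = symplectic_J *v moment j (\<lambda>l. gradient H (u l))"
    for j
    by (simp add: moment_def hamiltonian_field_def linear_sum
        matrix_vector_mul_linear linear_scale matrix_vector_mult_scaleR)
  then show ?thesis by (simp add: weighted_sum_slope symplectic_J_skew)
qed

lemma energy_preserving_polynomial:
  fixes H :: "real ^ ('m::finite + 'm) \<Rightarrow> real"
  assumes H: "polynomial_of_degree_le d H" and d: "d * s \<le> 2 * k"
  shows "energy_preserving (hbvm k s P t c \<tau>) (hamiltonian_field H) H"
  unfolding energy_preserving_def
proof (intro allI impI)
  fix h y0 y1 assume "(y0, y1) \<in> hbvm k s P t c \<tau> (hamiltonian_field H) h"
  then obtain u where u: "stages (hamiltonian_field H) h y0 u" "u k = y1"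
    by (auto simp: hbvm_iff)
  define v where "v = (\<lambda>l. hamiltonian_field H (u l))"
  define p where "p i = curve_poly h y0 v (axis i 1)" for i
  obtain a where a: "\<And>y. H y = (\<Sum>\<alpha> | (\<Sum>i\<in>UNIV. \<alpha> i) \<le> d. a \<alpha> * (\<Prod>i\<in>UNIV. (y $ i) ^ \<alpha> i))"
    using H by (auto simp: polynomial_of_degree_le_def)
  define \<phi> where "\<phi> = (\<Sum>\<alpha> | (\<Sum>i\<in>UNIV. \<alpha> i) \<le> d. smult (a \<alpha>) (\<Prod>i\<in>UNIV. p i ^ \<alpha> i))"
  have poly_\<phi>: "poly \<phi> x = H (curve h y0 v x)" for x
    by (simp add: \<phi>_def a poly_sum poly_prod p_def poly_curve_poly inner_axis)
  have "degree (\<Prod>i\<in>UNIV. p i ^ \<alpha> i) \<le> 2 * k" if "(\<Sum>i\<in>UNIV. \<alpha> i) \<le> d" for \<alpha>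
  proof -
    have "degree (\<Prod>i\<in>UNIV. p i ^ \<alpha> i) \<le> (\<Sum>i\<in>UNIV. degree (p i ^ \<alpha> i))"
      using degree_prod_sum_le[of UNIV "\<lambda>i. p i ^ \<alpha> i"] by (simp add: o_def)
    also have "\<dots> \<le> (\<Sum>i\<in>UNIV. \<alpha> i * s)"
    proof (rule sum_mono)
      fix i
      have "degree (p i ^ \<alpha> i) \<le> degree (p i) * \<alpha> i" by (rule degree_power_le)
      also have "\<dots> \<le> \<alpha> i * s" using degree_curve_poly[of h y0 v "axis i 1"] by (simp add: p_def mult.commute)
      finally show "degree (p i ^ \<alpha> i) \<le> \<alpha> i * s" .
    qed
    also have "\<dots> \<le> d * s" using that by (simp flip: sum_distrib_right)
    finally show ?thesis using d by simp
  qed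
  then have deg: "degree \<phi> \<le> 2 * k"
    unfolding \<phi>_def
    \<comment> \<open>For an infinite index set the sum would be 0, of degree 0.\<close>
    by (cases "finite {\<alpha> :: 'm + 'm \<Rightarrow> nat. (\<Sum>i\<in>UNIV. \<alpha> i) \<le> d}")
       (auto intro!: degree_sum_le degree_smult_le[THEN order.trans])
  have dH: "H differentiable (at y)" for y
    by (rule polynomial_of_degree_le_differentiable[OF H])
  have "poly (pderiv \<phi>) x = h * (gradient H (curve h y0 v x) \<bullet> slope v x)" for x
  proof -
    have "(H has_derivative frechet_derivative H (at (curve h y0 v x))) (at (curve h y0 v x))"
      using dH by (simp add: frechet_derivative_works)
    from has_vector_derivative_comp[OF curve_has_vector_derivative this]
    have "(poly \<phi> has_real_derivative
        frechet_derivative H (at (curve h y0 v x)) (h *\<^sub>R slope v x)) (at x)"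
      by (simp add: has_real_derivative_iff_has_vector_derivative poly_\<phi>[abs_def])
    then have "poly (pderiv \<phi>) x = frechet_derivative H (at (curve h y0 v x)) (h *\<^sub>R slope v x)"
      using poly_DERIV DERIV_unique by blast
    then show ?thesis using dH by (simp add: frechet_derivative_gradient)
  qed
  moreover have "u i = curve h y0 v (t i)" if "i \<le> k" for i
    using u(1) that by (simp add: stages_def v_def)
  ultimately have "poly \<phi> 1 - poly \<phi> 0
      = (\<Sum>i\<le>k. b i * (h * (gradient H (u i) \<bullet> slope v (t i))))"
    using deg by (simp flip: quadrature_pderiv)
  also have "\<dots> = h * (\<Sum>i\<le>k. b i * (gradient H (u i) \<bullet> slope v (t i)))"
    by (simp add: sum_distrib_left mult_ac)
  also have "\<dots> = 0" by (simp add: v_def discrete_line_integral_zero)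
  finally have "poly \<phi> 1 = poly \<phi> 0" by simp
  then show "H y1 = H y0"
    using u(1) u(2) stages_0[OF u(1)] by (simp add: poly_\<phi> stages_def v_def)
qed

text \<open>The squared norm is a quadratic energy, so along the curve it has degree at most
  \<open>2 * s\<close>, within the range of \<open>quadrature_pderiv\<close> because
  \<open>s \<le> k\<close>. The field \<open>f\<close> is arbitrary here.\<close>

lemma norm_increment:
  fixes u :: "nat \<Rightarrow> 'a::euclidean_space"
  assumes "stages f h y0 u"
  shows "(norm (u k))\<^sup>2 - (norm y0)\<^sup>2
    = 2 * h * (\<Sum>j<s. (2 * real j + 1) * (moment j u \<bullet> moment j (\<lambda>l. f (u l))))"
proof -
  define v where "v = (\<lambda>l. f (u l))"
  define p where "p = curve_poly h y0 v"
  define \<phi> where "\<phi> = (\<Sum>e\<in>Basis. p e * p e)"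
  have poly_\<phi>: "poly \<phi> x = (norm (curve h y0 v x))\<^sup>2" for x
    by (simp add: \<phi>_def poly_sum p_def poly_curve_poly power2_norm_eq_inner
        euclidean_inner[of "curve h y0 v x" "curve h y0 v x"])
  have "poly (pderiv \<phi>) x = h * ((2 *\<^sub>R curve h y0 v x) \<bullet> slope v x)" for x
    by (simp add: \<phi>_def pderiv_sum pderiv_mult poly_sum p_def poly_curve_poly poly_pderiv_curve_poly
        euclidean_inner[of "curve h y0 v x" "slope v x"] sum_distrib_left mult_ac)
  moreover have "degree \<phi> \<le> 2 * k"
    unfolding \<phi>_def
  proof (intro degree_sum_le)
    fix e
    have "degree (p e * p e) \<le> degree (p e) + degree (p e)" by (rule degree_mult_le)
    also have "\<dots> \<le> 2 * k" using degree_curve_poly[of h y0 v e] s_le_k by (simp add: p_def)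
    finally show "degree (p e * p e) \<le> 2 * k" .
  qed simp
  moreover have ut: "u i = curve h y0 v (t i)" if "i \<le> k" for i
    using assms that by (simp add: stages_def v_def)
  ultimately have "poly \<phi> 1 - poly \<phi> 0
      = (\<Sum>i\<le>k. b i * (h * ((2 *\<^sub>R u i) \<bullet> slope v (t i))))"
    by (simp flip: quadrature_pderiv)
  also have "\<dots> = h * (\<Sum>i\<le>k. b i * ((2 *\<^sub>R u i) \<bullet> slope v (t i)))"
    by (simp only: sum_distrib_left mult_ac)
  also have "\<dots> = h * (\<Sum>j<s. (2 * real j + 1) * (moment j (\<lambda>l. 2 *\<^sub>R u l) \<bullet> moment j v))"
    by (simp only: weighted_sum_slope)
  finally have "poly \<phi> 1 - poly \<phi> 0
      = h * (\<Sum>j<s. (2 * real j + 1) * (moment j (\<lambda>l. 2 *\<^sub>R u l) \<bullet> moment j v))" .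
  moreover have "moment j (\<lambda>l. 2 *\<^sub>R u l) = 2 *\<^sub>R moment j u" for j
    by (simp add: moment_def scaleR_sum_right mult.commute)
  ultimately show ?thesis
    using ut[of k] by (simp add: poly_\<phi> v_def sum_distrib_left mult_ac)
qed

section \<open>The linear test equation and A-stability\<close>

lemma sum_b: "(\<Sum>l\<le>k. b l) = 1"
  using quadrature_exact[of 1] integral_poly[of 1 1] antideriv_P_1[of 0] by simp

lemma linear_norm_increment:
  fixes u :: "nat \<Rightarrow> complex"
  assumes "stages (\<lambda>y. \<mu> * y) h y0 u"
  shows "(cmod (u k))\<^sup>2 - (cmod y0)\<^sup>2
    = 2 * Re (of_real h * \<mu>) * (\<Sum>j<s. (2 * real j + 1) * (cmod (moment j u))\<^sup>2)"
proof -
  have "moment j (\<lambda>l. \<mu> * u l) = \<mu> * moment j u" for j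
    by (simp add: moment_def sum_distrib_left)
  moreover have "z \<bullet> (\<mu> * z) = Re \<mu> * (cmod z)\<^sup>2" for z
    unfolding cmod_power2 by (simp add: inner_complex_def power2_eq_square algebra_simps)
  ultimately show ?thesis
    unfolding norm_increment[OF assms] sum_distrib_left by (intro sum.cong) simp_all
qed

text \<open>Without decrease of the modulus, the nonnegative sum in
  \<open>linear_norm_increment\<close> must vanish, hence all moments of index below
  \<open>s\<close>. Then the curve is constant, and the moment of index 0 is \<open>y0\<close> times
  the sum of the weights, which is 1. The lemma serves for solvability, for uniqueness and for the
  strict bound on the stability function.\<close>

lemma linear_stages_trivial:
  fixes u :: "nat \<Rightarrow> complex"
  assumes st: "stages (\<lambda>y. \<mu> * y) h y0 u" and re: "Re (of_real h * \<mu>) < 0"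
    and le: "cmod y0 \<le> cmod (u k)"
  shows "y0 = 0 \<and> (\<forall>i\<le>k. u i = 0)"
proof -
  let ?S = "\<Sum>j<s. (2 * real j + 1) * (cmod (moment j u))\<^sup>2"
  have "0 \<le> (cmod (u k))\<^sup>2 - (cmod y0)\<^sup>2" using le by simp
  then have "0 \<le> 2 * Re (of_real h * \<mu>) * ?S" using linear_norm_increment[OF st] by simp
  then have "?S \<le> 0" using re by (simp only: zero_le_mult_iff) linarith
  moreover have "?S \<ge> 0" by (intro sum_nonneg) simp
  ultimately have "?S = 0" by simp
  then have "\<forall>j\<in>{..<s}. (2 * real j + 1) * (cmod (moment j u))\<^sup>2 = 0"
    by (subst (asm) sum_nonneg_eq_0_iff) auto
  then have m: "moment j u = 0" if "j < s" for j
    using that by (auto simp: add_nonneg_eq_0_iff)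
  have "moment j (\<lambda>l. \<mu> * u l) = \<mu> * moment j u" for j
    by (simp add: moment_def sum_distrib_left)
  then have u: "u i = y0" if "i \<le> k" for i
    using st that m by (simp add: stages_def curve_def coef_def)
  have "moment 0 u = (\<Sum>l\<le>k. b l) *\<^sub>R y0"
    unfolding scaleR_left.sum by (simp add: moment_def u)
  then show ?thesis using m[of 0] s_pos u by (simp add: sum_b)
qed

lemma linear_stages_iff:
  fixes u :: "nat \<Rightarrow> complex"
  assumes "of_real h * \<mu> = q"
  shows "stages (\<lambda>y. \<mu> * y) h y0 u \<longleftrightarrow>
    (\<forall>i\<le>k. u i = y0 + q * (\<Sum>l\<le>k. of_real (rk i l) * u l))"
proof -
  have "h *\<^sub>R (\<Sum>l\<le>k. rk i l *\<^sub>R (\<mu> * u l)) = q * (\<Sum>l\<le>k. of_real (rk i l) * u l)" for i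
    unfolding assms[symmetric] scaleR_conv_of_real sum_distrib_left
    by (intro sum.cong) (simp_all add: mult_ac)
  then show ?thesis by (simp add: stages_def curve_rk)
qed

text \<open>A kernel vector of the stage matrix is a stage vector with initial value 0, which is
  trivial in the left half plane. The solution for initial value 1 is enough, since by linearity it
  can be scaled.\<close>

lemma linear_stages_solvable:
  assumes "Re q < 0"
  obtains v where "\<And>i. i \<le> k \<Longrightarrow> v i = 1 + q * (\<Sum>l\<le>k. of_real (rk i l) * v l)"
proof -
  define A where "A = Matrix.mat (Suc k) (Suc k)
    (\<lambda>(i, l). (if i = l then 1 else 0) - q * of_real (rk i l))"
  have A: "A \<in> carrier_mat (Suc k) (Suc k)" by (simp add: A_def)
  have mult: "vec_index (A *\<^sub>v v) i = vec_index v i - q * (\<Sum>l\<le>k. of_real (rk i l) * vec_index v l)"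
    if v: "v \<in> carrier_vec (Suc k)" and i: "i \<le> k" for v i
  proof -
    have "vec_index (A *\<^sub>v v) i
        = (\<Sum>l\<le>k. ((if i = l then 1 else 0) - q * of_real (rk i l)) * vec_index v l)"
      using v i by (auto simp: A_def scalar_prod_def atLeast0LessThan lessThan_Suc_atMost intro!: sum.cong)
    also have "\<dots> = (\<Sum>l\<le>k. (if i = l then vec_index v l else 0))
        - (\<Sum>l\<le>k. q * (of_real (rk i l) * vec_index v l))"
      unfolding sum_subtractf[symmetric] by (intro sum.cong) (auto simp: algebra_simps)
    also have "\<dots> = vec_index v i - q * (\<Sum>l\<le>k. of_real (rk i l) * vec_index v l)"
      using i by (simp add: sum_distrib_left)
    finally show ?thesis .
  qed
  have "v = 0\<^sub>v (Suc k)" if v: "v \<in> carrier_vec (Suc k)" "A *\<^sub>v v = 0\<^sub>v (Suc k)" for v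
  proof -
    have "vec_index v i = 0 + q * (\<Sum>l\<le>k. of_real (rk i l) * vec_index v l)" if "i \<le> k" for i
      using mult[OF v(1) that] v(2) that by simp
    \<comment> \<open>The factorization \<open>h = 1\<close>, \<open>\<mu> = q\<close> represents
      the number \<open>q\<close>.\<close>
    then have "stages (\<lambda>y. q * y) 1 0 (vec_index v)"
      by (intro iffD2[OF linear_stages_iff[of 1 q q]]) (simp, blast)
    then have "\<forall>i\<le>k. vec_index v i = 0"
      using linear_stages_trivial assms by force
    then show ?thesis using v(1) by (intro eq_vecI) auto
  qed
  then obtain B where B: "A * B = 1\<^sub>m (Suc k)" "B \<in> carrier_mat (Suc k) (Suc k)"
    using mat_inverse_if_injective[OF A] by metis
  define e where "e = Matrix.vec (Suc k) (\<lambda>_. 1 :: complex)"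
  have e: "e \<in> carrier_vec (Suc k)" by (simp add: e_def)
  have Be: "B *\<^sub>v e \<in> carrier_vec (Suc k)" using B(2) e by simp
  have "A *\<^sub>v (B *\<^sub>v e) = e"
    using assoc_mult_mat_vec[OF A B(2) e] B(1) e by simp
  then have "vec_index (B *\<^sub>v e) i = 1 + q * (\<Sum>l\<le>k. of_real (rk i l) * vec_index (B *\<^sub>v e) l)"
    if "i \<le> k" for i
    using mult[OF Be that] that by (simp add: e_def diff_eq_eq)
  then show thesis by (rule that)
qed

text \<open>If a stability value of modulus below 1 exists, the step from 1 has negative norm
  increment, so the real part of \<open>q\<close> is negative. Conversely \<open>v\<close> depends
  on \<open>h\<close> and \<open>\<mu>\<close> only through their product, so \<open>v k\<close>
  serves for every factorization of \<open>q\<close>.\<close>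

lemma hbvm_precisely_A_stable: "precisely_A_stable (hbvm k s P t c \<tau>)"
  unfolding precisely_A_stable_def
proof (intro equalityI subsetI)
  fix q assume "q \<in> stability_region (hbvm k s P t c \<tau>)"
  then obtain R where R: "stability_value (hbvm k s P t c \<tau>) q R" "cmod R < 1"
    by (auto simp: stability_region_def)
  have "hbvm k s P t c \<tau> (\<lambda>y. q * y) 1 = {(y0, y1). y1 = R * y0}"
    using R(1) unfolding stability_value_def by (metis mult_1 of_real_1)
  then have "(1, R) \<in> hbvm k s P t c \<tau> (\<lambda>y. q * y) 1" by simp
  then obtain u where u: "stages (\<lambda>y. q * y) 1 1 u" "u k = R" by (auto simp: hbvm_iff)
  let ?S = "\<Sum>j<s. (2 * real j + 1) * (cmod (moment j u))\<^sup>2"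
  have "2 * Re q * ?S = (cmod R)\<^sup>2 - 1" using linear_norm_increment[OF u(1)] u(2) by simp
  also have "\<dots> < 0" using R(2) by (simp add: power_less_one_iff abs_square_less_1)
  finally have "2 * Re q * ?S < 0" .
  moreover have "?S \<ge> 0" by (intro sum_nonneg) simp
  ultimately show "q \<in> {q. Re q < 0}" by (auto simp: mult_less_0_iff)
next
  fix q assume "q \<in> {q. Re q < 0}"
  then have q: "Re q < 0" by simp
  obtain v where v: "\<And>i. i \<le> k \<Longrightarrow> v i = 1 + q * (\<Sum>l\<le>k. of_real (rk i l) * v l)"
    using linear_stages_solvable[OF q] by blast
  have "hbvm k s P t c \<tau> (\<lambda>y. \<mu> * y) h = {(y0, y1). y1 = v k * y0}"
    if hm: "of_real h * \<mu> = q" for h \<mu>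
  proof -
    have "(\<exists>u. stages (\<lambda>y. \<mu> * y) h y0 u \<and> u k = y1) \<longleftrightarrow> y1 = v k * y0" for y0 y1
    proof -
      have v0: "stages (\<lambda>y. \<mu> * y) h y0 (\<lambda>i. v i * y0)"
        unfolding linear_stages_iff[OF hm]
      proof (intro allI impI)
        fix i assume "i \<le> k"
        then have "v i * y0 = (1 + q * (\<Sum>l\<le>k. of_real (rk i l) * v l)) * y0" using v by metis
        then show "v i * y0 = y0 + q * (\<Sum>l\<le>k. of_real (rk i l) * (v l * y0))"
          by (simp add: sum_distrib_left sum_distrib_right algebra_simps)
      qed
      have "u k = v k * y0" if u: "stages (\<lambda>y. \<mu> * y) h y0 u" for u
      proof -
        \<comment> \<open>Uniqueness: the difference of two stage vectors starts at 0, so its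
          modulus cannot drop below the initial one and it is trivial.\<close>
        have "stages (\<lambda>y. \<mu> * y) h 0 (\<lambda>i. u i - v i * y0)"
          unfolding linear_stages_iff[OF hm]
        proof (intro allI impI)
          fix i assume i: "i \<le> k"
          let ?s = "\<lambda>u. q * (\<Sum>l\<le>k. of_real (rk i l) * u l)"
          have "u i = y0 + ?s u" "v i * y0 = y0 + ?s (\<lambda>l. v l * y0)"
            using u v0 i unfolding linear_stages_iff[OF hm] by blast+
          then have "u i - v i * y0 = ?s u - ?s (\<lambda>l. v l * y0)" by (metis add_diff_cancel_left)
          then show "u i - v i * y0 = 0 + ?s (\<lambda>l. u l - v l * y0)"
            by (simp add: sum_subtractf right_diff_distrib)
        qed
        then have "\<forall>i\<le>k. u i - v i * y0 = 0"
          using linear_stages_trivial q hm by fastforce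
        then show ?thesis by simp
      qed
      then show ?thesis using v0 by blast
    qed
    then show ?thesis by (auto simp: hbvm_iff)
  qed
  then have "stability_value (hbvm k s P t c \<tau>) q (v k)"
    unfolding stability_value_def by blast
  moreover have "cmod (v k) < 1"
  proof (rule ccontr)
    assume "\<not> cmod (v k) < 1"
    then have le: "cmod 1 \<le> cmod (v k)" by simp
    have 1: "of_real 1 * q = q" by simp
    have st: "stages (\<lambda>y. q * y) 1 1 v" unfolding linear_stages_iff[OF 1] using v by blast
    have "(1::complex) = 0" using linear_stages_trivial[OF st _ le] q unfolding 1 by blast
    then show False by simp
  qed
  ultimately show "q \<in> stability_region (hbvm k s P t c \<tau>)"
    by (auto simp: stability_region_def)
qed

end



section \<open>Scaled smoothness\<close>

lemma of_class_C_SucD: "of_class_C (Suc n) f \<Longrightarrow> of_class_C n f"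
proof (induction n arbitrary: f)
  case 0
  then show ?case by (simp add: differentiable_imp_continuous_within continuous_on_eq_continuous_within)
next
  case (Suc n)
  then show ?case by auto
qed

lemma of_class_C_mono: "of_class_C n f \<Longrightarrow> m \<le> n \<Longrightarrow> of_class_C m f"
  by (induction n rule: nat_induct) (auto simp del: of_class_C.simps(2) simp: le_Suc_eq dest: of_class_C_SucD)

lemma of_class_C_continuous: "of_class_C n f \<Longrightarrow> continuous_on UNIV f"
  using of_class_C_mono[of n f 0] by simp

lemma of_class_C_zero: "of_class_C n (\<lambda>_. 0)"
proof (induction n)
  case (Suc n)
  have "frechet_derivative (\<lambda>_::'a. 0::'b) (at y) = (\<lambda>_. 0)" for y
    by (rule frechet_derivative_at[symmetric]) simp
  with Suc show ?case by simp
qed simp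

lemma of_class_C_add: "of_class_C n f \<Longrightarrow> of_class_C n g \<Longrightarrow> of_class_C n (\<lambda>y. f y + g y)"
proof (induction n arbitrary: f g)
  case 0
  then show ?case by (auto intro: continuous_on_add)
next
  case (Suc n)
  have "frechet_derivative (\<lambda>y. f y + g y) (at y) v
      = frechet_derivative f (at y) v + frechet_derivative g (at y) v" for y v
    using Suc.prems by (subst frechet_derivative_at[symmetric, OF has_derivative_add])
      (auto simp: frechet_derivative_works[symmetric])
  with Suc show ?case by (auto intro: differentiable_add)
qed

lemma of_class_C_bounded_linear:
  assumes "bounded_linear L"
  shows "of_class_C n f \<Longrightarrow> of_class_C n (\<lambda>y. L (f y))"
proof (induction n arbitrary: f)
  case 0
  then show ?case using assms by (auto intro: bounded_linear.continuous_on)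
next
  case (Suc n)
  have D: "((\<lambda>y. L (f y)) has_derivative (\<lambda>v. L (frechet_derivative f (at y) v))) (at y)" for y
    using Suc.prems assms
    by (intro bounded_linear.has_derivative[OF assms]) (auto simp: frechet_derivative_works[symmetric])
  then have "frechet_derivative (\<lambda>y. L (f y)) (at y) v = L (frechet_derivative f (at y) v)" for y v
    by (metis frechet_derivative_at)
  with Suc D show ?case by (auto simp: differentiable_def)
qed

lemma of_class_C_sum:
  "(\<And>i. i \<in> I \<Longrightarrow> of_class_C n (f i)) \<Longrightarrow> of_class_C n (\<lambda>y. \<Sum>i\<in>I. f i y)"
  by (induction I rule: infinite_finite_induct) (auto intro: of_class_C_add of_class_C_zero)

text \<open>Since \<open>of_class_C\<close> speaks of derivatives in fixed directions, the field is
  written as a combination of such derivatives with constant vectors.\<close>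

lemma of_class_C_hamiltonian_field:
  assumes "of_class_C (Suc n) H"
  shows "of_class_C n (hamiltonian_field H)"
proof -
  have eq: "hamiltonian_field H = (\<lambda>y. \<Sum>i\<in>UNIV. frechet_derivative H (at y) (axis i 1) *\<^sub>R (symplectic_J *v axis i 1))"
  proof
    fix y
    have "gradient H y = (\<Sum>i\<in>UNIV. frechet_derivative H (at y) (axis i 1) *\<^sub>R axis i 1)"
      using basis_expansion[of "gradient H y"] by (simp add: gradient_def scalar_mult_eq_scaleR)
    then show "hamiltonian_field H y
      = (\<Sum>i\<in>UNIV. frechet_derivative H (at y) (axis i 1) *\<^sub>R (symplectic_J *v axis i 1))"
      by (simp add: hamiltonian_field_def linear_sum matrix_vector_mul_linear matrix_vector_mult_scaleR)
  qed
  have "of_class_C n (\<lambda>y. frechet_derivative H (at y) (axis i 1) *\<^sub>R (symplectic_J *v axis i 1))"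
    for i :: "'a + 'a"
    using assms by (intro of_class_C_bounded_linear[OF bounded_linear_scaleR_left]) simp
  then show ?thesis unfolding eq by (rule of_class_C_sum)
qed

lemma bound_on_cball:
  fixes f :: "'a::euclidean_space \<Rightarrow> 'b::real_normed_vector"
  assumes "continuous_on UNIV f"
  obtains B where "\<And>y. dist a y \<le> r \<Longrightarrow> norm (f y) \<le> B"
proof -
  have "compact (f ` cball a r)"
    using assms by (intro compact_continuous_image) (auto intro: continuous_on_subset)
  then have "bounded (f ` cball a r)" by (rule compact_imp_bounded)
  then obtain B where "\<forall>y\<in>cball a r. norm (f y) \<le> B" by (auto simp: bounded_iff)
  then show thesis by (intro that[of B]) simp
qed

lemma vector_derivative_bound:
  fixes g :: "real \<Rightarrow> 'a::real_normed_vector"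
  assumes "\<And>x. x \<in> {0..1} \<Longrightarrow> (g has_vector_derivative g' x) (at x within {0..1})"
    and "\<And>x. x \<in> {0..1} \<Longrightarrow> norm (g' x) \<le> B" and "x \<in> {0..1}" "y \<in> {0..1}"
  shows "norm (g x - g y) \<le> B"
proof -
  have "norm (g x - g y) \<le> B * norm (x - y)"
  proof (rule differentiable_bound[where S="{0..1}" and f'="\<lambda>x r. r *\<^sub>R g' x"])
    show "onorm (\<lambda>r. r *\<^sub>R g' x) \<le> B" if "x \<in> {0..1}" for x
      using assms(2)[OF that] by (intro onorm_le) (simp add: mult.commute[of B] mult_left_mono)
  qed (use assms in \<open>auto simp: has_vector_derivative_def\<close>)
  also have "\<dots> \<le> B * 1"
    using assms(3,4) order.trans[OF norm_ge_zero assms(2)[OF assms(3)]]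
    by (intro mult_left_mono) auto
  finally show ?thesis by simp
qed

text \<open>\<open>scaled_C S n \<phi>\<close>: for \<open>h \<in> S\<close> the derivatives of order \<open>i \<le> n\<close> of \<open>\<phi> h\<close> on \<open>[0, 1]\<close> are
  \<open>O(h^i)\<close>, as for \<open>\<phi> h x = g (h * x)\<close> with \<open>g\<close> smooth.\<close>

primrec scaled_C :: "real set \<Rightarrow> nat \<Rightarrow> (real \<Rightarrow> real \<Rightarrow> 'a::real_normed_vector) \<Rightarrow> bool" where
  "scaled_C S 0 \<phi> \<longleftrightarrow> (\<exists>B. \<forall>h\<in>S. \<forall>x\<in>{0..1}. norm (\<phi> h x) \<le> B)"
| "scaled_C S (Suc n) \<phi> \<longleftrightarrow> (\<exists>B. \<forall>h\<in>S. \<forall>x\<in>{0..1}. norm (\<phi> h x) \<le> B) \<and>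
     (\<exists>\<psi>. scaled_C S n \<psi> \<and>
       (\<forall>h\<in>S. \<forall>x\<in>{0..1}. (\<phi> h has_vector_derivative h *\<^sub>R \<psi> h x) (at x within {0..1})))"

lemma scaled_C_bounded:
  assumes "scaled_C S n \<phi>"
  obtains B where "0 \<le> B" "\<And>h x. h \<in> S \<Longrightarrow> x \<in> {0..1} \<Longrightarrow> norm (\<phi> h x) \<le> B"
proof -
  obtain B where "\<forall>h\<in>S. \<forall>x\<in>{0..1}. norm (\<phi> h x) \<le> B" using assms by (cases n) auto
  then show thesis using that[of "max B 0"] by fastforce
qed

lemma scaled_C_SucD: "scaled_C S (Suc n) \<phi> \<Longrightarrow> scaled_C S n \<phi>"
proof (induction n arbitrary: \<phi>)
  case (Suc n)
  obtain \<psi> where \<psi>: "scaled_C S (Suc n) \<psi>"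
    "\<forall>h\<in>S. \<forall>x\<in>{0..1}. (\<phi> h has_vector_derivative h *\<^sub>R \<psi> h x) (at x within {0..1})"
    using Suc.prems unfolding scaled_C.simps(2)[of S "Suc n"] by blast
  moreover have "\<exists>B. \<forall>h\<in>S. \<forall>x\<in>{0..1}. norm (\<phi> h x) \<le> B"
    using Suc.prems unfolding scaled_C.simps(2)[of S "Suc n"] by blast
  ultimately show ?case using Suc.IH[OF \<psi>(1)] unfolding scaled_C.simps(2)[of S n] by blast
qed simp

lemma scaled_C_mono: "scaled_C S n \<phi> \<Longrightarrow> m \<le> n \<Longrightarrow> scaled_C S m \<phi>"
  by (induction n rule: nat_induct) (auto simp del: scaled_C.simps(2) simp: le_Suc_eq dest: scaled_C_SucD)

lemma scaled_C_subset: "scaled_C S n \<phi> \<Longrightarrow> S' \<subseteq> S \<Longrightarrow> scaled_C S' n \<phi>"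
proof (induction n arbitrary: \<phi>)
  case 0
  then show ?case unfolding scaled_C.simps by blast
next
  case (Suc n)
  then obtain \<psi> where "scaled_C S n \<psi>"
    "\<forall>h\<in>S. \<forall>x\<in>{0..1}. (\<phi> h has_vector_derivative h *\<^sub>R \<psi> h x) (at x within {0..1})"
    unfolding scaled_C.simps by blast
  moreover have "\<exists>B. \<forall>h\<in>S'. \<forall>x\<in>{0..1}. norm (\<phi> h x) \<le> B"
    using Suc.prems unfolding scaled_C.simps by blast
  ultimately show ?case using Suc.IH[of \<psi>] Suc.prems(2) unfolding scaled_C.simps by blast
qed

lemma scaled_C_continuous: "scaled_C S (Suc n) \<phi> \<Longrightarrow> h \<in> S \<Longrightarrow> continuous_on {0..1} (\<phi> h)"
  unfolding continuous_on_eq_continuous_within scaled_C.simps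
  using has_vector_derivative_continuous by blast

lemma scaled_C_const:
  assumes "\<And>h. h \<in> S \<Longrightarrow> norm (\<gamma> h) \<le> B"
  shows "scaled_C S n (\<lambda>h x. \<gamma> h)"
  using assms
proof (induction n arbitrary: \<gamma> B)
  case (Suc n)
  have "scaled_C S n (\<lambda>h x. 0 :: 'a)" by (rule Suc.IH[of "\<lambda>_. 0" 0]) simp
  then show ?case using Suc.prems by (auto intro!: exI[of _ "\<lambda>h x. 0"])
qed auto

lemma scaled_C_add:
  "scaled_C S n \<phi> \<Longrightarrow> scaled_C S n \<eta> \<Longrightarrow> scaled_C S n (\<lambda>h x. \<phi> h x + \<eta> h x)"
proof (induction n arbitrary: \<phi> \<eta>)
  case 0
  then obtain B C where "\<forall>h\<in>S. \<forall>x\<in>{0..1}. norm (\<phi> h x) \<le> B" "\<forall>h\<in>S. \<forall>x\<in>{0..1}. norm (\<eta> h x) \<le> C"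
    by auto
  then show ?case by (auto intro!: exI[of _ "B + C"] norm_triangle_mono)
next
  case (Suc n)
  obtain \<phi>' \<eta>' where d: "scaled_C S n \<phi>'" "scaled_C S n \<eta>'"
    "\<forall>h\<in>S. \<forall>x\<in>{0..1}. (\<phi> h has_vector_derivative h *\<^sub>R \<phi>' h x) (at x within {0..1})"
    "\<forall>h\<in>S. \<forall>x\<in>{0..1}. (\<eta> h has_vector_derivative h *\<^sub>R \<eta>' h x) (at x within {0..1})"
    using Suc.prems by auto
  obtain B C where "\<forall>h\<in>S. \<forall>x\<in>{0..1}. norm (\<phi> h x) \<le> B" "\<forall>h\<in>S. \<forall>x\<in>{0..1}. norm (\<eta> h x) \<le> C"
    using Suc.prems by auto
  then have "\<exists>B. \<forall>h\<in>S. \<forall>x\<in>{0..1}. norm (\<phi> h x + \<eta> h x) \<le> B"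
    by (auto intro!: exI[of _ "B + C"] norm_triangle_mono)
  moreover have "scaled_C S n (\<lambda>h x. \<phi>' h x + \<eta>' h x)" using Suc.IH d by blast
  moreover have "((\<lambda>x. \<phi> h x + \<eta> h x) has_vector_derivative h *\<^sub>R (\<phi>' h x + \<eta>' h x)) (at x within {0..1})"
    if "h \<in> S" "x \<in> {0..1}" for h x
    using d that by (simp only: scaleR_right_distrib) (intro has_vector_derivative_add, auto)
  ultimately show ?case by auto
qed

lemma scaled_C_sum:
  "(\<And>i. i \<in> I \<Longrightarrow> scaled_C S n (\<phi> i)) \<Longrightarrow> scaled_C S n (\<lambda>h x. \<Sum>i\<in>I. \<phi> i h x)"
  by (induction I rule: infinite_finite_induct)
     (auto intro: scaled_C_add scaled_C_const[where \<gamma>="\<lambda>_. 0" and B=0])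

lemma scaled_C_bilinear:
  assumes "bounded_bilinear pr"
  shows "scaled_C S n \<phi> \<Longrightarrow> scaled_C S n \<eta> \<Longrightarrow> scaled_C S n (\<lambda>h x. pr (\<phi> h x) (\<eta> h x))"
proof (induction n arbitrary: \<phi> \<eta>)
  case bdd: 0
  interpret bounded_bilinear pr by (rule assms)
  obtain K where K: "\<And>a b. norm (pr a b) \<le> norm a * norm b * K" "0 < K" using pos_bounded by blast
  obtain B C where BC: "0 \<le> B" "\<And>h x. h \<in> S \<Longrightarrow> x \<in> {0..1} \<Longrightarrow> norm (\<phi> h x) \<le> B"
    "0 \<le> C" "\<And>h x. h \<in> S \<Longrightarrow> x \<in> {0..1} \<Longrightarrow> norm (\<eta> h x) \<le> C"
    using bdd by (metis scaled_C_bounded)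
  have "norm (pr (\<phi> h x) (\<eta> h x)) \<le> B * C * K" if "h \<in> S" "x \<in> {0..1}" for h x
    using K(2) BC that
    by (intro order.trans[OF K(1)] mult_right_mono mult_mono) auto
  then show ?case unfolding scaled_C.simps by blast
next
  case (Suc n)
  interpret bounded_bilinear pr by (rule assms)
  obtain \<phi>' \<eta>' where d: "scaled_C S n \<phi>'" "scaled_C S n \<eta>'"
    "\<forall>h\<in>S. \<forall>x\<in>{0..1}. (\<phi> h has_vector_derivative h *\<^sub>R \<phi>' h x) (at x within {0..1})"
    "\<forall>h\<in>S. \<forall>x\<in>{0..1}. (\<eta> h has_vector_derivative h *\<^sub>R \<eta>' h x) (at x within {0..1})"
    using Suc.prems by auto
  obtain K where K: "\<And>a b. norm (pr a b) \<le> norm a * norm b * K" "0 < K" using pos_bounded by blast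
  obtain B C where BC: "0 \<le> B" "\<And>h x. h \<in> S \<Longrightarrow> x \<in> {0..1} \<Longrightarrow> norm (\<phi> h x) \<le> B"
    "0 \<le> C" "\<And>h x. h \<in> S \<Longrightarrow> x \<in> {0..1} \<Longrightarrow> norm (\<eta> h x) \<le> C"
    using Suc.prems by (metis scaled_C_bounded)
  have "norm (pr (\<phi> h x) (\<eta> h x)) \<le> B * C * K" if "h \<in> S" "x \<in> {0..1}" for h x
    using K(2) BC that
    by (intro order.trans[OF K(1)] mult_right_mono mult_mono) auto
  then have "\<exists>B. \<forall>h\<in>S. \<forall>x\<in>{0..1}. norm (pr (\<phi> h x) (\<eta> h x)) \<le> B" by blast
  moreover have "scaled_C S n (\<lambda>h x. pr (\<phi> h x) (\<eta>' h x) + pr (\<phi>' h x) (\<eta> h x))"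
    using Suc.prems d by (intro scaled_C_add Suc.IH) (auto dest: scaled_C_SucD simp del: scaled_C.simps)
  moreover have "((\<lambda>x. pr (\<phi> h x) (\<eta> h x)) has_vector_derivative
      h *\<^sub>R (pr (\<phi> h x) (\<eta>' h x) + pr (\<phi>' h x) (\<eta> h x))) (at x within {0..1})"
    if "h \<in> S" "x \<in> {0..1}" for h x
    using has_vector_derivative[of "\<phi> h" "h *\<^sub>R \<phi>' h x" x "{0..1}" "\<eta> h" "h *\<^sub>R \<eta>' h x"] d(3,4) that
    by (simp add: scaleR_left scaleR_right scaleR_right_distrib)
  ultimately show ?case by auto
qed

text \<open>The direction in the chain rule varies with \<open>h\<close> and \<open>x\<close>.
  Expanding it in the basis leaves derivatives of \<open>f\<close> in fixed directions, to which the
  induction hypothesis applies.\<close>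

lemma scaled_C_compose:
  fixes f :: "'a::euclidean_space \<Rightarrow> 'b::real_normed_vector"
  shows "of_class_C n f \<Longrightarrow> scaled_C S n \<phi> \<Longrightarrow> scaled_C S n (\<lambda>h x. f (\<phi> h x))"
proof (induction n arbitrary: f \<phi>)
  case bdd: 0
  obtain B where B: "0 \<le> B" "\<And>h x. h \<in> S \<Longrightarrow> x \<in> {0..1} \<Longrightarrow> norm (\<phi> h x) \<le> B"
    using bdd by (metis scaled_C_bounded)
  obtain C where "\<And>y. dist 0 y \<le> B \<Longrightarrow> norm (f y) \<le> C"
    using bound_on_cball[of f 0 B] of_class_C_continuous bdd by blast
  then have "norm (f (\<phi> h x)) \<le> C" if "h \<in> S" "x \<in> {0..1}" for h x using B that by simp
  then show ?case unfolding scaled_C.simps by blast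
next
  case (Suc n)
  obtain \<phi>' where d: "scaled_C S n \<phi>'"
    "\<forall>h\<in>S. \<forall>x\<in>{0..1}. (\<phi> h has_vector_derivative h *\<^sub>R \<phi>' h x) (at x within {0..1})"
    using Suc.prems by auto
  obtain B where B: "0 \<le> B" "\<And>h x. h \<in> S \<Longrightarrow> x \<in> {0..1} \<Longrightarrow> norm (\<phi> h x) \<le> B"
    using Suc.prems by (metis scaled_C_bounded)
  obtain C where C: "\<And>y. dist 0 y \<le> B \<Longrightarrow> norm (f y) \<le> C"
    using bound_on_cball[of f 0 B] of_class_C_continuous Suc.prems(1) by blast
  define \<psi> where "\<psi> h x = (\<Sum>e\<in>Basis. (\<phi>' h x \<bullet> e) *\<^sub>R frechet_derivative f (at (\<phi> h x)) e)" for h x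
  have "scaled_C S n (\<lambda>h x. \<phi>' h x \<bullet> e)" for e
    using d(1) by (rule scaled_C_bilinear[OF bounded_bilinear_inner])
      (rule scaled_C_const[where \<gamma>="\<lambda>_. e"], rule order_refl)
  then have "scaled_C S n \<psi>"
    unfolding \<psi>_def[abs_def] using Suc.prems
    by (intro scaled_C_sum scaled_C_bilinear[OF bounded_bilinear_scaleR] Suc.IH)
       (auto dest: scaled_C_SucD simp del: scaled_C.simps)
  moreover have "((\<lambda>x. f (\<phi> h x)) has_vector_derivative h *\<^sub>R \<psi> h x) (at x within {0..1})"
    if hx: "h \<in> S" "x \<in> {0..1}" for h x
  proof -
    let ?D = "frechet_derivative f (at (\<phi> h x))"
    have D: "(f has_derivative ?D) (at (\<phi> h x))"
      using Suc.prems(1) by (simp flip: frechet_derivative_works)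
    have lin: "linear ?D" using D by (rule has_derivative_linear)
    have "?D (h *\<^sub>R \<phi>' h x) = h *\<^sub>R ?D (\<Sum>e\<in>Basis. (\<phi>' h x \<bullet> e) *\<^sub>R e)"
      by (simp add: linear_scale[OF lin] euclidean_representation)
    also have "\<dots> = h *\<^sub>R \<psi> h x"
      by (simp add: \<psi>_def linear_sum[OF lin] linear_scale[OF lin])
    finally show ?thesis
      using has_vector_derivative_comp[of "\<phi> h" "h *\<^sub>R \<phi>' h x" x "{0..1}", OF _ D] d(2) hx by simp
  qed
  moreover have "\<exists>B. \<forall>h\<in>S. \<forall>x\<in>{0..1}. norm (f (\<phi> h x)) \<le> B"
    using B C by (intro exI[of _ C]) simp
  ultimately show ?case by auto
qed

lemma poly_bound_01:
  obtains M where "0 \<le> M" "\<And>x. x \<in> {0..1} \<Longrightarrow> \<bar>poly p x\<bar> \<le> (M::real)"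
proof -
  have "compact (poly p ` {0..1})"
    by (intro compact_continuous_image continuous_intros compact_Icc)
  then obtain M where "\<forall>x\<in>{0..1}. norm (poly p x) \<le> M"
    using compact_imp_bounded[of "poly p ` {0..1}"] by (auto simp: bounded_iff)
  then show thesis using that[of "max M 0"] by fastforce
qed

text \<open>Each derivative in \<open>x\<close> has to be paid for with a factor \<open>h\<close>. A
  polynomial of degree at most \<open>j\<close> has only \<open>j\<close> nontrivial derivatives, so
  \<open>min j n\<close> powers of \<open>h\<close> in the coefficient suffice. The division by
  \<open>h\<close> is the reason for \<open>h \<noteq> 0\<close>.\<close>

lemma scaled_C_poly:
  assumes "\<And>h. h \<in> S \<Longrightarrow> h \<noteq> 0 \<and> \<bar>h\<bar> \<le> 1"
    and "degree p \<le> j" and "\<And>h. h \<in> S \<Longrightarrow> norm (\<gamma> h) \<le> C * \<bar>h\<bar> ^ min j n"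
  shows "scaled_C S n (\<lambda>h x. poly p x *\<^sub>R \<gamma> h)"
  using assms(2,3)
proof (induction n arbitrary: p j \<gamma>)
  case (0 p j \<gamma>)
  obtain M where "0 \<le> M" "\<And>x. x \<in> {0..1} \<Longrightarrow> \<bar>poly p x\<bar> \<le> M" using poly_bound_01[of p] by metis
  then have "norm (poly p x *\<^sub>R \<gamma> h) \<le> M * C" if "h \<in> S" "x \<in> {0..1}" for h x
    using that 0(2)[of h] by (auto intro!: mult_mono)
  then show ?case unfolding scaled_C.simps by blast
next
  case (Suc n p j \<gamma>)
  obtain M where "0 \<le> M" "\<And>x. x \<in> {0..1} \<Longrightarrow> \<bar>poly p x\<bar> \<le> M" using poly_bound_01[of p] by metis
  moreover have C: "norm (\<gamma> h) \<le> \<bar>C\<bar>" if "h \<in> S" for h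
  proof -
    have "norm (\<gamma> h) \<le> C * \<bar>h\<bar> ^ min j (Suc n)" using Suc.prems that by blast
    also have "\<dots> \<le> \<bar>C\<bar> * 1"
      using assms(1)[OF that] by (intro mult_mono power_le_one) auto
    finally show ?thesis by simp
  qed
  ultimately have "norm (poly p x *\<^sub>R \<gamma> h) \<le> M * \<bar>C\<bar>" if "h \<in> S" "x \<in> {0..1}" for h x
    using that by (auto intro!: mult_mono)
  then have "\<exists>B. \<forall>h\<in>S. \<forall>x\<in>{0..1}. norm (poly p x *\<^sub>R \<gamma> h) \<le> B" by blast
  moreover have "scaled_C S n (\<lambda>h x. poly (pderiv p) x *\<^sub>R (\<gamma> h /\<^sub>R h))"
  proof (cases "j = 0")
    case True
    then have "pderiv p = 0" using Suc.prems(1) by (simp add: pderiv_eq_0_iff)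
    then show ?thesis by (simp add: scaled_C_const[where \<gamma>="\<lambda>_. 0" and B=0])
  next
    case False
    show ?thesis
    proof (rule Suc.IH[of _ "j - 1"])
      show "degree (pderiv p) \<le> j - 1" using Suc.prems(1) by (simp add: degree_pderiv)
      fix h assume h: "h \<in> S"
      have "norm (\<gamma> h /\<^sub>R h) = norm (\<gamma> h) / \<bar>h\<bar>" by (simp add: divide_inverse mult.commute)
      also have "\<dots> \<le> C * \<bar>h\<bar> ^ min j (Suc n) / \<bar>h\<bar>"
        using Suc.prems(2)[OF h] by (intro divide_right_mono) auto
      also have "min j (Suc n) = Suc (min (j - 1) n)" using False by simp
      finally show "norm (\<gamma> h /\<^sub>R h) \<le> C * \<bar>h\<bar> ^ min (j - 1) n"
        using assms(1)[OF h] by simp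
    qed
  qed
  moreover have "((\<lambda>x. poly p x *\<^sub>R \<gamma> h) has_vector_derivative h *\<^sub>R (poly (pderiv p) x *\<^sub>R (\<gamma> h /\<^sub>R h)))
      (at x within {0..1})" if "h \<in> S" for h x
  proof -
    have "(poly p has_real_derivative poly (pderiv p) x) (at x within {0..1})"
      by (rule DERIV_subset[OF poly_DERIV]) simp
    then have "((\<lambda>x. poly p x *\<^sub>R \<gamma> h) has_vector_derivative poly (pderiv p) x *\<^sub>R \<gamma> h)
        (at x within {0..1})"
      by (rule has_vector_derivative_scaleR[where g="\<lambda>_. \<gamma> h" and g'=0, simplified])
    moreover have "h *\<^sub>R (poly (pderiv p) x *\<^sub>R (\<gamma> h /\<^sub>R h)) = poly (pderiv p) x *\<^sub>R \<gamma> h"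
      using assms(1)[OF that] by (simp add: field_simps)
    ultimately show ?thesis by (simp only:)
  qed
  ultimately show ?case by auto
qed

text \<open>Expanding the scaled derivative and integrating from 0 raises the order by one, each
  integration bringing a factor \<open>h\<close>. The constant does not depend on \<open>h\<close>,
  although the polynomial does.\<close>

lemma scaled_C_taylor:
  assumes "scaled_C S n \<phi>"
  obtains C a where "0 \<le> C"
    "\<And>h x. h \<in> S \<Longrightarrow> x \<in> {0..1} \<Longrightarrow> norm (\<phi> h x - (\<Sum>i<n. x ^ i *\<^sub>R a h i)) \<le> C * \<bar>h\<bar> ^ n"
proof -
  have "\<exists>C\<ge>0. \<exists>a. \<forall>h\<in>S. \<forall>x\<in>{0..1}. norm (\<phi> h x - (\<Sum>i<n. x ^ i *\<^sub>R a h i)) \<le> C * \<bar>h\<bar> ^ n"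
    using assms
  proof (induction n arbitrary: \<phi>)
    case 0
    then obtain B where "0 \<le> B" "\<And>h x. h \<in> S \<Longrightarrow> x \<in> {0..1} \<Longrightarrow> norm (\<phi> h x) \<le> B"
      by (metis scaled_C_bounded)
    then show ?case by auto
  next
    case (Suc n)
    obtain \<psi> where \<psi>: "scaled_C S n \<psi>"
      "\<forall>h\<in>S. \<forall>x\<in>{0..1}. (\<phi> h has_vector_derivative h *\<^sub>R \<psi> h x) (at x within {0..1})"
      using Suc.prems by auto
    obtain C a where C: "0 \<le> C"
      "\<forall>h\<in>S. \<forall>x\<in>{0..1}. norm (\<psi> h x - (\<Sum>i<n. x ^ i *\<^sub>R a h i)) \<le> C * \<bar>h\<bar> ^ n"
      using Suc.IH[OF \<psi>(1)] by blast
    \<comment> \<open>Coefficients of the integrated expansion, with the value at 0 as constant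
      term.\<close>
    define a' where "a' h i = (case i of 0 \<Rightarrow> \<phi> h 0 | Suc i \<Rightarrow> (h / real (Suc i)) *\<^sub>R a h i)" for h i
    have "norm (\<phi> h x - (\<Sum>i<Suc n. x ^ i *\<^sub>R a' h i)) \<le> C * \<bar>h\<bar> ^ Suc n"
      if h: "h \<in> S" and x: "x \<in> {0..1}" for h x
    proof -
      define g where "g y = \<phi> h y - (\<Sum>i<n. y ^ Suc i *\<^sub>R a' h (Suc i))" for y
      have "norm (g x - g 0) \<le> C * \<bar>h\<bar> ^ Suc n"
      proof (rule vector_derivative_bound[where g=g and g'="\<lambda>y. h *\<^sub>R (\<psi> h y - (\<Sum>i<n. y ^ i *\<^sub>R a h i))"])
        fix y :: real assume y: "y \<in> {0..1}"
        have "((\<lambda>y. y ^ Suc i *\<^sub>R a' h (Suc i)) has_vector_derivative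
            h *\<^sub>R (y ^ i *\<^sub>R a h i)) (at y within {0..1})" for i
        proof -
          have "((\<lambda>y. y ^ Suc i) has_real_derivative real (Suc i) * y ^ i) (at y within {0..1})"
            using DERIV_pow[of "Suc i" y "{0..1}"] by simp
          then have "((\<lambda>y. y ^ Suc i *\<^sub>R a' h (Suc i)) has_vector_derivative
              (real (Suc i) * y ^ i) *\<^sub>R a' h (Suc i)) (at y within {0..1})"
            by (rule has_vector_derivative_scaleR[where g="\<lambda>_. a' h (Suc i)" and g'=0, simplified])
          then show ?thesis by (simp add: a'_def mult.commute)
        qed
        then show "(g has_vector_derivative h *\<^sub>R (\<psi> h y - (\<Sum>i<n. y ^ i *\<^sub>R a h i))) (at y within {0..1})"
          unfolding g_def[abs_def] scaleR_right_diff_distrib scaleR_sum_right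
          using \<psi>(2) h y by (intro has_vector_derivative_diff has_vector_derivative_sum) auto
        have "norm (h *\<^sub>R (\<psi> h y - (\<Sum>i<n. y ^ i *\<^sub>R a h i))) \<le> \<bar>h\<bar> * (C * \<bar>h\<bar> ^ n)"
          using C(2) h y by (simp add: mult_left_mono)
        then show "norm (h *\<^sub>R (\<psi> h y - (\<Sum>i<n. y ^ i *\<^sub>R a h i))) \<le> C * \<bar>h\<bar> ^ Suc n"
          by (simp add: mult_ac)
      qed (use x in auto)
      moreover have "g x - g 0 = \<phi> h x - (\<Sum>i<Suc n. x ^ i *\<^sub>R a' h i)"
        by (simp add: g_def sum.lessThan_Suc_shift a'_def del: sum.lessThan_Suc)
      ultimately show ?thesis by simp
    qed
    then show ?case using C(1) by blast
  qed
  then show thesis using that by blast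
qed

text \<open>The value is prescribed at 1 because the adjoint equation is solved backwards from
  there.\<close>

lemma scaled_C_antiderivative:
  fixes \<psi> :: "real \<Rightarrow> real \<Rightarrow> 'a::banach"
  assumes \<psi>: "scaled_C S n \<psi>" and S: "\<And>h. h \<in> S \<Longrightarrow> \<bar>h\<bar> \<le> 1"
    and cont: "\<And>h. h \<in> S \<Longrightarrow> continuous_on {0..1} (\<psi> h)"
  obtains Z where "scaled_C S (Suc n) Z" "\<And>h. Z h 1 = v"
    "\<And>h x. h \<in> S \<Longrightarrow> x \<in> {0..1} \<Longrightarrow> (Z h has_vector_derivative h *\<^sub>R \<psi> h x) (at x within {0..1})"
proof -
  define Z where "Z h x = v - h *\<^sub>R integral {x..1} (\<psi> h)" for h x
  have Z1: "Z h 1 = v" for h by (simp add: Z_def)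
  have Zd: "(Z h has_vector_derivative h *\<^sub>R \<psi> h x) (at x within {0..1})"
    if "h \<in> S" "x \<in> {0..1}" for h x
    unfolding Z_def using integral_has_vector_derivative'[OF cont[OF that(1)] that(2)]
    by (auto intro!: derivative_eq_intros)
  obtain B where B: "0 \<le> B" "\<And>h x. h \<in> S \<Longrightarrow> x \<in> {0..1} \<Longrightarrow> norm (\<psi> h x) \<le> B"
    using scaled_C_bounded[OF \<psi>] by metis
  have "norm (Z h x) \<le> norm v + B" if "h \<in> S" "x \<in> {0..1}" for h x
  proof -
    have "norm (Z h x - Z h 1) \<le> B"
    proof (rule vector_derivative_bound[OF Zd[OF that(1)]])
      fix x :: real assume "x \<in> {0..1}"
      then show "norm (h *\<^sub>R \<psi> h x) \<le> B"
        using mult_mono[OF S[OF that(1)] B(2)[OF that(1)], of x] by simp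
    qed (use that in auto)
    then show ?thesis using norm_triangle_sub[of "Z h x" v] by (simp add: Z1)
  qed
  then have "scaled_C S (Suc n) Z" using \<psi> Zd unfolding scaled_C.simps by blast
  then show thesis using that Z1 Zd by blast
qed

section \<open>Errors of quadrature and projection for scaled functions\<close>

context lobatto
begin

text \<open>The Taylor polynomial has degree below \<open>2 * k\<close> and is integrated exactly.
  The remainder of size h^n enters once through the integral and once through the quadrature sum,
  which explains the two summands of the constant; the factor \<open>h\<close> in front gives one
  more power.\<close>

lemma quadrature_scaled_C:
  fixes \<psi> :: "real \<Rightarrow> real \<Rightarrow> real"
  assumes \<psi>: "scaled_C S n \<psi>" and n: "n \<le> 2 * k"
    and \<phi>: "\<And>h x. h \<in> S \<Longrightarrow> x \<in> {0..1} \<Longrightarrow> (\<phi> h has_vector_derivative h *\<^sub>R \<psi> h x) (at x within {0..1})"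
  obtains C where "\<And>h. h \<in> S \<Longrightarrow>
    \<bar>\<phi> h 1 - \<phi> h 0 - h * (\<Sum>i\<le>k. b i * \<psi> h (t i))\<bar> \<le> C * \<bar>h\<bar> ^ Suc n"
proof -
  obtain C a where C: "0 \<le> C"
    "\<And>h x. h \<in> S \<Longrightarrow> x \<in> {0..1} \<Longrightarrow> norm (\<psi> h x - (\<Sum>i<n. x ^ i *\<^sub>R a h i)) \<le> C * \<bar>h\<bar> ^ n"
    using scaled_C_taylor[OF \<psi>] by blast
  show thesis
  proof (rule that[of "C + (\<Sum>i\<le>k. \<bar>b i\<bar>) * C"])
    fix h assume h: "h \<in> S"
    define p where "p = (\<Sum>i<n. monom (a h i) i)"
    have p: "\<bar>\<psi> h x - poly p x\<bar> \<le> C * \<bar>h\<bar> ^ n" if "x \<in> {0..1}" for x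
      using C(2)[OF h that] by (simp add: p_def poly_sum poly_monom mult.commute)
    have "degree p \<le> n - 1"
      unfolding p_def by (intro degree_sum_le) (auto intro: order.trans[OF degree_monom_le])
    then have exact: "(\<Sum>i\<le>k. b i * poly p (t i)) = poly (antideriv p) 1"
      using n by (subst quadrature_exact) (auto simp: integral_poly)
    define g where "g x = \<phi> h x - h * poly (antideriv p) x" for x
    have 1: "\<bar>g 1 - g 0\<bar> \<le> C * \<bar>h\<bar> ^ Suc n"
    proof -
      have "norm (g 1 - g 0) \<le> C * \<bar>h\<bar> ^ Suc n"
      proof (rule vector_derivative_bound[where g=g and g'="\<lambda>x. h * (\<psi> h x - poly p x)"])
        fix x :: real assume x: "x \<in> {0..1}"
        have "(poly (antideriv p) has_vector_derivative poly p x) (at x within {0..1})"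
          using antideriv_DERIV by (simp flip: has_real_derivative_iff_has_vector_derivative)
        then have "((\<lambda>x. h * poly (antideriv p) x) has_vector_derivative h * poly p x) (at x within {0..1})"
          by (rule has_vector_derivative_mult_right)
        then show "(g has_vector_derivative h * (\<psi> h x - poly p x)) (at x within {0..1})"
          unfolding g_def[abs_def] right_diff_distrib using \<phi>[OF h x]
          by (intro has_vector_derivative_diff) auto
        show "norm (h * (\<psi> h x - poly p x)) \<le> C * \<bar>h\<bar> ^ Suc n"
          using mult_left_mono[OF p[OF x], of "\<bar>h\<bar>"] by (simp add: abs_mult mult_ac)
      qed auto
      then show ?thesis by simp
    qed
    have 2: "\<bar>\<Sum>i\<le>k. b i * (\<psi> h (t i) - poly p (t i))\<bar> \<le> (\<Sum>i\<le>k. \<bar>b i\<bar>) * (C * \<bar>h\<bar> ^ n)"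
      unfolding sum_distrib_right using t_bounds p
      by (intro order.trans[OF sum_abs] sum_mono) (auto simp: abs_mult intro!: mult_left_mono)
    have "\<phi> h 1 - \<phi> h 0 - h * (\<Sum>i\<le>k. b i * \<psi> h (t i))
        = (g 1 - g 0) - h * (\<Sum>i\<le>k. b i * (\<psi> h (t i) - poly p (t i)))"
      by (simp add: g_def right_diff_distrib sum_subtractf exact)
    also have "\<bar>\<dots>\<bar> \<le> C * \<bar>h\<bar> ^ Suc n + \<bar>h\<bar> * ((\<Sum>i\<le>k. \<bar>b i\<bar>) * (C * \<bar>h\<bar> ^ n))"
      using mult_left_mono[OF 2, of "\<bar>h\<bar>"]
      by (intro order.trans[OF abs_triangle_ineq4 add_mono[OF 1]]) (simp add: abs_mult)
    also have "\<dots> = (C + (\<Sum>i\<le>k. \<bar>b i\<bar>) * C) * \<bar>h\<bar> ^ Suc n" by (simp add: algebra_simps)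
    finally show "\<bar>\<phi> h 1 - \<phi> h 0 - h * (\<Sum>i\<le>k. b i * \<psi> h (t i))\<bar>
      \<le> (C + (\<Sum>i\<le>k. \<bar>b i\<bar>) * C) * \<bar>h\<bar> ^ Suc n" .
  qed
qed

end

context hbvm_scheme
begin

lemma moment_add: "moment j (\<lambda>l. v l + w l) = moment j v + moment j w"
  by (simp add: moment_def scaleR_right_distrib sum.distrib)

lemma moment_sum: "moment j (\<lambda>l. \<Sum>i\<in>I. v i l) = (\<Sum>i\<in>I. moment j (v i))"
  unfolding moment_def by (subst sum.swap) (simp add: scaleR_sum_right)

lemma slope_add: "slope (\<lambda>l. v l + w l) x = slope v x + slope w x"
  by (simp add: slope_def coef_def moment_add scaleR_right_distrib sum.distrib)

lemma slope_sum: "slope (\<lambda>l. \<Sum>i\<in>I. v i l) x = (\<Sum>i\<in>I. slope (v i) x)"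
  unfolding slope_def coef_def moment_sum by (subst sum.swap) (simp add: scaleR_sum_right)

lemma moment_bound:
  obtains K where "0 \<le> K"
    "\<And>v :: nat \<Rightarrow> 'a::real_normed_vector. \<And>B. (\<And>l. l \<le> k \<Longrightarrow> norm (v l) \<le> B) \<Longrightarrow> norm (moment j v) \<le> K * B"
proof (rule that)
  show "0 \<le> (\<Sum>l\<le>k. \<bar>b l * poly (P j) (t l)\<bar>)" by (intro sum_nonneg) auto
  show "norm (moment j v) \<le> (\<Sum>l\<le>k. \<bar>b l * poly (P j) (t l)\<bar>) * B"
    if "\<And>l. l \<le> k \<Longrightarrow> norm (v l) \<le> B" for v :: "nat \<Rightarrow> 'a" and B
    unfolding moment_def sum_distrib_right using that
    by (intro order.trans[OF norm_sum] sum_mono) (auto intro!: mult_left_mono)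
qed

lemma slope_bound:
  obtains K where "0 \<le> K"
    "\<And>v :: nat \<Rightarrow> 'a::real_normed_vector. \<And>B x. (\<And>l. l \<le> k \<Longrightarrow> norm (v l) \<le> B) \<Longrightarrow> x \<in> {0..1} \<Longrightarrow> norm (slope v x) \<le> K * B"
proof -
  have "\<exists>K\<ge>0. \<forall>(v :: nat \<Rightarrow> 'a) B. (\<forall>l\<le>k. norm (v l) \<le> B) \<longrightarrow> norm (moment j v) \<le> K * B" for j
    using moment_bound[of j] by metis
  then obtain K where K: "\<And>j. 0 \<le> K j"
    "\<And>j (v :: nat \<Rightarrow> 'a) B. (\<And>l. l \<le> k \<Longrightarrow> norm (v l) \<le> B) \<Longrightarrow> norm (moment j v) \<le> K j * B"
    by metis
  have "\<exists>M\<ge>0. \<forall>x\<in>{0..1}. \<bar>poly (P j) x\<bar> \<le> M" for j using poly_bound_01[of "P j"] by metis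
  then obtain M where M: "\<And>j. 0 \<le> M j" "\<And>j x. x \<in> {0..1} \<Longrightarrow> \<bar>poly (P j) x\<bar> \<le> M j" by metis
  show thesis
  proof (rule that)
    show "0 \<le> (\<Sum>j<s. M j * ((2 * real j + 1) * K j))" using K M by (intro sum_nonneg) auto
    fix v :: "nat \<Rightarrow> 'a" and B x
    assume v: "\<And>l. l \<le> k \<Longrightarrow> norm (v l) \<le> B" and x: "x \<in> {0..(1::real)}"
    have Kv: "norm (moment j v) \<le> K j * B" for j using v by (rule K(2))
    have "norm (poly (P j) x *\<^sub>R coef j v) \<le> M j * ((2 * real j + 1) * (K j * B))" for j
    proof -
      have "norm (coef j v) \<le> (2 * real j + 1) * (K j * B)"
        using mult_left_mono[OF Kv[of j], of "2 * real j + 1"] by (simp add: coef_def)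
      then show ?thesis using M(1)[of j] M(2)[OF x, of j] by (auto intro!: mult_mono)
    qed
    then show "norm (slope v x) \<le> (\<Sum>j<s. M j * ((2 * real j + 1) * K j)) * B"
      unfolding slope_def sum_distrib_right
      by (intro order.trans[OF norm_sum] sum_mono) (simp add: mult_ac)
  qed
qed

text \<open>The product with \<open>P j\<close> has degree less than \<open>2 * j\<close>, in the
  range of exactness because \<open>j < s\<close> and \<open>s \<le> k\<close>. So discrete and
  continuous orthogonality agree.\<close>

lemma moment_poly:
  assumes "j < s" "degree Q < j"
  shows "moment j (\<lambda>l. poly Q (t l) *\<^sub>R a) = 0"
proof -
  have "moment j (\<lambda>l. poly Q (t l) *\<^sub>R a) = (\<Sum>l\<le>k. b l * poly (Q * P j) (t l)) *\<^sub>R a"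
    unfolding scaleR_left.sum by (simp add: moment_def mult_ac)
  also have "(\<Sum>l\<le>k. b l * poly (Q * P j) (t l)) = integral {0..1} (poly (Q * P j))"
    using assms s_le_k degree_mult_le[of Q "P j"] by (intro quadrature_exact) simp
  finally show ?thesis using orthogonal_lower_degree[OF assms(2)] by simp
qed

text \<open>The first \<open>s\<close> Legendre polynomials stay orthogonal in the discrete inner
  product, as products of two of them have degree at most \<open>2 * s - 2\<close>. Hence the
  projection reproduces their span.\<close>

lemma slope_poly:
  assumes "degree Q < s"
  shows "slope (\<lambda>l. poly Q (t l) *\<^sub>R a) x = poly Q x *\<^sub>R a"
proof -
  obtain q where q: "Q = (\<Sum>i\<le>s - 1. smult (q i) (P i))"
    using legendre_expansion[of Q "s - 1"] assms
    by (metis less_imp_le_nat less_Suc_eq_le Suc_pred' gr_implies_not0 neq0_conv)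
  have "moment j (\<lambda>l. poly (P i) (t l) *\<^sub>R w) = (if i = j then 1 / (2 * real j + 1) else 0) *\<^sub>R w"
    if "i < s" "j < s" for i j and w :: 'a
  proof -
    have "moment j (\<lambda>l. poly (P i) (t l) *\<^sub>R w) = (\<Sum>l\<le>k. b l * (poly (P i) (t l) * poly (P j) (t l))) *\<^sub>R w"
      unfolding scaleR_left.sum by (simp add: moment_def mult_ac)
    then show ?thesis using that s_le_k by (subst (asm) discrete_orthogonal) auto
  qed
  then have coef: "coef j (\<lambda>l. poly (P i) (t l) *\<^sub>R w) = (if i = j then w else 0)"
    if "i < s" "j < s" for i j and w :: 'a
    using that by (simp add: coef_def add_nonneg_eq_0_iff)
  then have P: "slope (\<lambda>l. poly (P i) (t l) *\<^sub>R w) x = poly (P i) x *\<^sub>R w" if "i < s" for i and w :: 'a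
  proof -
    have "slope (\<lambda>l. poly (P i) (t l) *\<^sub>R w) x = (\<Sum>j<s. if i = j then poly (P j) x *\<^sub>R w else 0)"
      unfolding slope_def using coef that by (intro sum.cong) auto
    then show ?thesis using that by simp
  qed
  have "slope (\<lambda>l. poly Q (t l) *\<^sub>R a) x = slope (\<lambda>l. \<Sum>i\<le>s - 1. poly (P i) (t l) *\<^sub>R (q i *\<^sub>R a)) x"
    by (simp add: q poly_sum scaleR_left.sum mult.commute)
  also have "\<dots> = (\<Sum>i\<le>s - 1. poly (P i) x *\<^sub>R (q i *\<^sub>R a))"
    unfolding slope_sum using s_pos by (intro sum.cong refl P) auto
  also have "\<dots> = poly Q x *\<^sub>R a" by (simp add: q poly_sum scaleR_left.sum mult.commute)
  finally show ?thesis .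
qed

lemma slope_sum_power:
  assumes "n \<le> s"
  shows "slope (\<lambda>l. \<Sum>i<n. t l ^ i *\<^sub>R a i) x = (\<Sum>i<n. x ^ i *\<^sub>R a i)"
proof -
  have "slope (\<lambda>l. t l ^ i *\<^sub>R w) x = x ^ i *\<^sub>R w" if "i < n" for i and w :: 'a
  proof -
    have "degree (monom (1::real) i) < s" using that assms degree_monom_le[of "1::real" i] by linarith
    from slope_poly[OF this] show ?thesis by (simp add: poly_monom)
  qed
  then show ?thesis by (subst slope_sum) simp
qed

text \<open>The moment annihilates the Taylor polynomial of degree below \<open>min j n\<close>, and
  only the remainder is left. This decay matches the hypothesis of
  \<open>scaled_C_poly\<close>.\<close>

lemma moment_scaled_C:
  assumes "scaled_C S n \<phi>" "j < s"
  obtains C where "\<And>h. h \<in> S \<Longrightarrow> norm (moment j (\<lambda>l. \<phi> h (t l))) \<le> C * \<bar>h\<bar> ^ min j n"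
proof -
  let ?m = "min j n"
  have "scaled_C S ?m \<phi>" using assms(1) by (rule scaled_C_mono) simp
  then obtain C a where C: "0 \<le> C"
    "\<And>h x. h \<in> S \<Longrightarrow> x \<in> {0..1} \<Longrightarrow> norm (\<phi> h x - (\<Sum>i<?m. x ^ i *\<^sub>R a h i)) \<le> C * \<bar>h\<bar> ^ ?m"
    using scaled_C_taylor by blast
  obtain K where K: "0 \<le> K"
    "\<And>v :: nat \<Rightarrow> 'a. \<And>B. (\<And>l. l \<le> k \<Longrightarrow> norm (v l) \<le> B) \<Longrightarrow> norm (moment j v) \<le> K * B"
    using moment_bound[of j] by metis
  show thesis
  proof (rule that[of "K * C"])
    fix h assume h: "h \<in> S"
    have "moment j (\<lambda>l. t l ^ i *\<^sub>R w) = 0" if "i < ?m" for i and w :: 'a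
    proof -
      have "degree (monom (1::real) i) < j" using that degree_monom_le[of "1::real" i] by linarith
      from moment_poly[OF assms(2) this] show ?thesis by (simp add: poly_monom)
    qed
    then have "moment j (\<lambda>l. \<Sum>i<?m. t l ^ i *\<^sub>R a h i) = 0"
      by (subst moment_sum) (simp add: sum.neutral)
    then have "moment j (\<lambda>l. \<phi> h (t l)) = moment j (\<lambda>l. \<phi> h (t l) - (\<Sum>i<?m. t l ^ i *\<^sub>R a h i))"
      using moment_add[of j "\<lambda>l. \<phi> h (t l) - (\<Sum>i<?m. t l ^ i *\<^sub>R a h i)" "\<lambda>l. \<Sum>i<?m. t l ^ i *\<^sub>R a h i"]
      by simp
    also have "norm \<dots> \<le> K * (C * \<bar>h\<bar> ^ ?m)"
      using C(2)[OF h] t_bounds by (intro K(2)) auto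
    finally show "norm (moment j (\<lambda>l. \<phi> h (t l))) \<le> K * C * \<bar>h\<bar> ^ ?m" by simp
  qed
qed

text \<open>The Taylor polynomial is reproduced and the projection is bounded, so only the remainder
  and its projection contribute.\<close>

lemma slope_scaled_C:
  assumes "scaled_C S n \<phi>" "n \<le> s"
  obtains C where "0 \<le> C" "\<And>h x. h \<in> S \<Longrightarrow> x \<in> {0..1} \<Longrightarrow>
    norm (slope (\<lambda>l. \<phi> h (t l)) x - \<phi> h x) \<le> C * \<bar>h\<bar> ^ n"
proof -
  obtain C a where C: "0 \<le> C"
    "\<And>h x. h \<in> S \<Longrightarrow> x \<in> {0..1} \<Longrightarrow> norm (\<phi> h x - (\<Sum>i<n. x ^ i *\<^sub>R a h i)) \<le> C * \<bar>h\<bar> ^ n"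
    using scaled_C_taylor[OF assms(1)] by blast
  obtain K where K: "0 \<le> K"
    "\<And>v :: nat \<Rightarrow> 'a. \<And>B x. (\<And>l. l \<le> k \<Longrightarrow> norm (v l) \<le> B) \<Longrightarrow> x \<in> {0..1} \<Longrightarrow> norm (slope v x) \<le> K * B"
    using slope_bound by metis
  show thesis
  proof (rule that[of "K * C + C"])
    show "0 \<le> K * C + C" using K C by simp
    fix h x assume h: "h \<in> S" and x: "x \<in> {0..(1::real)}"
    let ?p = "\<lambda>x. \<Sum>i<n. x ^ i *\<^sub>R a h i"
    have "slope (\<lambda>l. ?p (t l)) x = ?p x" using assms(2) by (rule slope_sum_power)
    then have "slope (\<lambda>l. \<phi> h (t l)) x - \<phi> h x
        = slope (\<lambda>l. \<phi> h (t l) - ?p (t l)) x - (\<phi> h x - ?p x)"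
      using slope_add[of "\<lambda>l. \<phi> h (t l) - ?p (t l)" "\<lambda>l. ?p (t l)" x] by simp
    also have "norm \<dots> \<le> K * (C * \<bar>h\<bar> ^ n) + C * \<bar>h\<bar> ^ n"
    proof (rule order.trans[OF norm_triangle_ineq4], rule add_mono)
      show "norm (slope (\<lambda>l. \<phi> h (t l) - ?p (t l)) x) \<le> K * (C * \<bar>h\<bar> ^ n)"
        using C(2)[OF h] t_bounds x by (intro K(2)) auto
    qed (rule C(2)[OF h x])
    finally show "norm (slope (\<lambda>l. \<phi> h (t l)) x - \<phi> h x) \<le> (K * C + C) * \<bar>h\<bar> ^ n"
      by (simp add: algebra_simps)
  qed
qed

end



section \<open>The numerical solution for small step sizes\<close>

text \<open>Bounds for derivatives are available one direction at a time; this combines those in the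
  basis directions into an operator bound.\<close>

lemma linear_bound_Basis:
  fixes D :: "'a::euclidean_space \<Rightarrow> 'b::real_normed_vector"
  assumes lin: "linear D" and B: "\<And>e. e \<in> Basis \<Longrightarrow> norm (D e) \<le> B e"
  shows "norm (D v) \<le> (\<Sum>e\<in>Basis. B e) * norm v"
proof -
  have "norm (D v) = norm (\<Sum>e\<in>Basis. (v \<bullet> e) *\<^sub>R D e)"
    using linear_sum[OF lin, of "\<lambda>e. (v \<bullet> e) *\<^sub>R e" Basis]
    by (simp add: linear_scale[OF lin] euclidean_representation)
  also have "\<dots> \<le> (\<Sum>e\<in>Basis. B e * norm v)"
  proof (rule order.trans[OF norm_sum], rule sum_mono)
    fix e :: 'a assume "e \<in> Basis"
    then show "norm ((v \<bullet> e) *\<^sub>R D e) \<le> B e * norm v"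
      using mult_mono[OF Basis_le_norm B, of e e v] by (simp add: mult.commute)
  qed
  finally show ?thesis by (simp add: sum_distrib_right)
qed

lemma of_class_C_lipschitz:
  fixes f :: "'a::euclidean_space \<Rightarrow> 'b::real_normed_vector"
  assumes "of_class_C (Suc 0) f"
  obtains L where "0 \<le> L" "\<And>x y. dist a x \<le> r \<Longrightarrow> dist a y \<le> r \<Longrightarrow> norm (f x - f y) \<le> L * norm (x - y)"
proof -
  let ?D = "\<lambda>y. frechet_derivative f (at y)"
  have D: "(f has_derivative ?D y) (at y)" for y
    using assms by (simp flip: frechet_derivative_works)
  have "\<exists>B. \<forall>y. dist a y \<le> r \<longrightarrow> norm (?D y e) \<le> B" for e
  proof -
    have "continuous_on UNIV (\<lambda>y. ?D y e)" using assms by simp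
    then show ?thesis by (rule bound_on_cball[of _ a r]) blast
  qed
  then obtain B where B: "\<And>e y. dist a y \<le> r \<Longrightarrow> norm (?D y e) \<le> B e" by metis
  define L where "L = (\<Sum>e\<in>Basis. \<bar>B e\<bar>)"
  have on: "onorm (?D y) \<le> L" if "y \<in> cball a r" for y
  proof (rule onorm_le)
    fix v
    have "norm (?D y e) \<le> \<bar>B e\<bar>" for e using that B[of y e] by simp
    then show "norm (?D y v) \<le> L * norm v"
      unfolding L_def by (intro linear_bound_Basis has_derivative_linear[OF D])
  qed
  show thesis
  proof (rule that)
    show "0 \<le> L" by (simp add: L_def sum_nonneg)
    show "norm (f x - f y) \<le> L * norm (x - y)" if "dist a x \<le> r" "dist a y \<le> r" for x y
      using that D by (intro differentiable_bound[OF convex_cball[of a r], where f'="?D", OF has_derivative_at_withinI[OF D] on]) auto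
  qed
qed

lemma scaled_C_frechet_derivative:
  fixes f :: "'a::euclidean_space \<Rightarrow> 'b::real_normed_vector"
  assumes "of_class_C (Suc n) f" "scaled_C S n \<phi>" "scaled_C S n \<eta>"
  shows "scaled_C S n (\<lambda>h x. frechet_derivative f (at (\<phi> h x)) (\<eta> h x))"
proof -
  let ?D = "\<lambda>h x. frechet_derivative f (at (\<phi> h x))"
  have eq: "(\<lambda>h x. ?D h x (\<eta> h x)) = (\<lambda>h x. \<Sum>e\<in>Basis. (\<eta> h x \<bullet> e) *\<^sub>R ?D h x e)"
  proof (intro ext)
    fix h x
    have lin: "linear (?D h x)" using assms(1) by (auto intro: linear_frechet_derivative)
    show "?D h x (\<eta> h x) = (\<Sum>e\<in>Basis. (\<eta> h x \<bullet> e) *\<^sub>R ?D h x e)"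
      using linear_sum[OF lin, of "\<lambda>e. (\<eta> h x \<bullet> e) *\<^sub>R e" Basis]
      by (simp add: linear_scale[OF lin] euclidean_representation)
  qed
  have "scaled_C S n (\<lambda>h x. \<eta> h x \<bullet> e)" for e
    using assms(3) by (rule scaled_C_bilinear[OF bounded_bilinear_inner])
      (rule scaled_C_const[where \<gamma>="\<lambda>_. e"], rule order_refl)
  moreover have "scaled_C S n (\<lambda>h x. ?D h x e)" for e
    using assms(1,2) by (intro scaled_C_compose[where f="\<lambda>y. frechet_derivative f (at y) e"]) auto
  ultimately have "scaled_C S n (\<lambda>h x. \<Sum>e\<in>Basis. (\<eta> h x \<bullet> e) *\<^sub>R ?D h x e)"
    by (intro scaled_C_sum scaled_C_bilinear[OF bounded_bilinear_scaleR])
  then show ?thesis by (rule ssubst[OF eq, of "scaled_C S n"])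
qed

text \<open>Picard iteration from the constant \<open>y0\<close>. Only indices up to
  \<open>k\<close> count, and a common bound \<open>D\<close> replaces the maximum distance. The
  first step has length at most 1 because the iterates stay in the unit ball, so the increments are
  dominated by powers of 1/2.\<close>

lemma finite_contraction_fixpoint:
  fixes G :: "(nat \<Rightarrow> 'a::banach) \<Rightarrow> nat \<Rightarrow> 'a"
  assumes into: "\<And>u i. (\<And>i. i \<le> k \<Longrightarrow> dist y0 (u i) \<le> 1) \<Longrightarrow> i \<le> k \<Longrightarrow> dist y0 (G u i) \<le> 1"
    and contr: "\<And>u v D i. (\<And>i. i \<le> k \<Longrightarrow> dist y0 (u i) \<le> 1) \<Longrightarrow> (\<And>i. i \<le> k \<Longrightarrow> dist y0 (v i) \<le> 1) \<Longrightarrow>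
      (\<And>i. i \<le> k \<Longrightarrow> dist (u i) (v i) \<le> D) \<Longrightarrow> i \<le> k \<Longrightarrow> dist (G u i) (G v i) \<le> D / 2"
  shows "\<exists>u. \<forall>i\<le>k. dist y0 (u i) \<le> 1 \<and> G u i = u i"
proof -
  define z where "z n = (G ^^ n) (\<lambda>_. y0)" for n
  have z_Suc: "z (Suc n) = G (z n)" for n by (simp add: z_def)
  have z_0: "z 0 i = y0" for i by (simp add: z_def)
  have z1: "dist y0 (z n i) \<le> 1" if "i \<le> k" for n i
    using that
  proof (induction n arbitrary: i)
    case (Suc n)
    show ?case unfolding z_Suc by (rule into[OF Suc.IH Suc.prems])
  qed (simp add: z_def)
  have step: "dist (z (Suc n) i) (z n i) \<le> (1 / 2) ^ n" if "i \<le> k" for n i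
    using that
  proof (induction n arbitrary: i)
    case 0
    then show ?case using z1[of i 1] by (simp add: z_def dist_commute)
  next
    case (Suc n)
    have "dist (G (z (Suc n)) i) (G (z n) i) \<le> (1 / 2) ^ n / 2"
      by (rule contr[OF z1 z1 Suc.IH Suc.prems])
    then show ?case by (simp add: z_Suc)
  qed
  have "\<exists>l. (\<lambda>n. z n i) \<longlonglongrightarrow> l" if "i \<le> k" for i
  proof -
    have "summable (\<lambda>n. z (Suc n) i - z n i)"
      using step[OF that]
      by (intro summable_comparison_test[OF _ summable_geometric[of "1/2 :: real"]])
         (auto simp: dist_norm)
    then have "(\<lambda>n. y0 + (\<Sum>m<n. z (Suc m) i - z m i)) \<longlonglongrightarrow> y0 + (\<Sum>n. z (Suc n) i - z n i)"
      by (intro tendsto_add tendsto_const summable_LIMSEQ)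
    moreover have "y0 + (\<Sum>m<n. z (Suc m) i - z m i) = z n i" for n
      by (induction n) (simp_all add: z_0 algebra_simps)
    ultimately show ?thesis by auto
  qed
  then obtain u where u: "\<And>i. i \<le> k \<Longrightarrow> (\<lambda>n. z n i) \<longlonglongrightarrow> u i" by metis
  have u1: "dist y0 (u i) \<le> 1" if "i \<le> k" for i
    using tendsto_dist[OF tendsto_const u[OF that]] z1[OF that]
    by (intro LIMSEQ_le_const2[of "\<lambda>n. dist y0 (z n i)"]) auto
  have "G u i = u i" if i: "i \<le> k" for i
  proof -
    \<comment> \<open>The sum dominates every single distance, as the contraction hypothesis
      demands, and tends to 0 term by term.\<close>
    define D where "D n = (\<Sum>i\<le>k. dist (u i) (z n i))" for n
    have "(\<lambda>n. D n / 2) \<longlonglongrightarrow> (\<Sum>i\<le>k. dist (u i) (u i)) / 2"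
      unfolding D_def by (intro tendsto_intros u) auto
    then have lim: "(\<lambda>n. D n / 2) \<longlonglongrightarrow> 0" by simp
    have "dist (z (Suc n) i) (G u i) \<le> D n / 2" for n
    proof -
      have "dist (u l) (z n l) \<le> D n" if "l \<le> k" for l
        unfolding D_def using that by (intro member_le_sum) auto
      then have "dist (G u i) (G (z n) i) \<le> D n / 2"
        by (intro contr[OF u1 z1 _ i])
      then show ?thesis by (simp add: z_Suc dist_commute)
    qed
    then have "(\<lambda>n. dist (z (Suc n) i) (G u i)) \<longlonglongrightarrow> 0"
      by (intro tendsto_sandwich[OF _ _ tendsto_const[of 0] lim] always_eventually allI zero_le_dist)
    then have "(\<lambda>n. z (Suc n) i) \<longlonglongrightarrow> G u i" by (rule iffD2[OF tendsto_dist_iff])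
    then show ?thesis using LIMSEQ_Suc[OF u[OF i]] LIMSEQ_unique by blast
  qed
  then show ?thesis using u1 by blast
qed

context hbvm_scheme
begin

lemma stages_exist:
  fixes f :: "'a::euclidean_space \<Rightarrow> 'a"
  assumes f: "of_class_C (Suc 0) f"
  obtains h0 U where "0 < h0" "h0 \<le> 1"
    "\<And>h. \<bar>h\<bar> \<le> h0 \<Longrightarrow> stages f h y0 (U h)"
    "\<And>h i. \<bar>h\<bar> \<le> h0 \<Longrightarrow> i \<le> k \<Longrightarrow> dist y0 (U h i) \<le> 1"
    "\<And>h u i. \<bar>h\<bar> \<le> h0 \<Longrightarrow> stages f h y0 u \<Longrightarrow> \<forall>i\<le>k. dist y0 (u i) \<le> 1 \<Longrightarrow>
      i \<le> k \<Longrightarrow> u i = U h i"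
proof -
  obtain L where L: "0 \<le> L" "\<And>x y. dist y0 x \<le> 1 \<Longrightarrow> dist y0 y \<le> 1 \<Longrightarrow> norm (f x - f y) \<le> L * norm (x - y)"
    using of_class_C_lipschitz[OF f] by metis
  obtain B where B: "\<And>x. dist y0 x \<le> 1 \<Longrightarrow> norm (f x) \<le> B"
    using bound_on_cball[OF of_class_C_continuous[OF f]] by metis
  have "B \<ge> 0" using B[of y0] norm_ge_zero[of "f y0"] by (simp del: norm_ge_zero)
  define M where "M = (\<Sum>i\<le>k. \<Sum>l\<le>k. \<bar>rk i l\<bar>)"
  have M0: "0 \<le> M" by (simp add: M_def sum_nonneg)
  have M: "norm (\<Sum>l\<le>k. rk i l *\<^sub>R v l) \<le> M * C"
    if "i \<le> k" "0 \<le> C" "\<And>l. l \<le> k \<Longrightarrow> norm (v l) \<le> C" for i C and v :: "nat \<Rightarrow> 'a"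
  proof -
    have "norm (\<Sum>l\<le>k. rk i l *\<^sub>R v l) \<le> (\<Sum>l\<le>k. \<bar>rk i l\<bar> * C)"
      using that by (intro order.trans[OF norm_sum] sum_mono) (auto intro!: mult_left_mono)
    also have "\<dots> = (\<Sum>l\<le>k. \<bar>rk i l\<bar>) * C" by (simp add: sum_distrib_right)
    also have "\<dots> \<le> M * C"
      unfolding M_def using that
      by (intro mult_right_mono member_le_sum[of i "{..k}" "\<lambda>i. \<Sum>l\<le>k. \<bar>rk i l\<bar>"]) (auto intro: sum_nonneg)
    finally show ?thesis .
  qed
  \<comment> \<open>Chosen such that \<open>h0 * (M * B) \<le> 1\<close>, so that the unit ball is
    mapped into itself, and \<open>h0 * (M * L) \<le> 1 / 2\<close>, the contraction factor. The
    leading 1 in the denominator keeps \<open>h0\<close> at most 1.\<close>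
  define h0 where "h0 = 1 / (1 + M * (B + 2 * L))"
  have den: "1 \<le> 1 + M * (B + 2 * L)" using M0 L \<open>B \<ge> 0\<close> by simp
  have h0: "0 < h0" "h0 \<le> 1" using den by (simp_all add: h0_def)
  have "h0 * (1 + M * (B + 2 * L)) = 1" using den by (simp add: h0_def)
  then have hMB: "h0 * (M * B) \<le> 1" and hML: "h0 * (M * L) \<le> 1 / 2"
  proof -
    assume "h0 * (1 + M * (B + 2 * L)) = 1"
    then have "h0 + h0 * (M * B) + 2 * (h0 * (M * L)) = 1" by (simp add: algebra_simps)
    moreover have "0 \<le> h0 * (M * B)" "0 \<le> h0 * (M * L)" using h0 M0 L(1) \<open>B \<ge> 0\<close> by simp_all
    ultimately show "h0 * (M * B) \<le> 1" "h0 * (M * L) \<le> 1 / 2" using h0(1) by linarith+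
  qed
  define G where "G h u i = y0 + h *\<^sub>R (\<Sum>l\<le>k. rk i l *\<^sub>R f (u l))"
    for h and u :: "nat \<Rightarrow> 'a" and i
  have st: "stages f h y0 u \<longleftrightarrow> (\<forall>i\<le>k. G h u i = u i)" for h u
    by (auto simp: stages_def curve_rk G_def)
  have into: "dist y0 (G h u i) \<le> 1"
    if "\<bar>h\<bar> \<le> h0" "\<And>i. i \<le> k \<Longrightarrow> dist y0 (u i) \<le> 1" "i \<le> k" for h u i
  proof -
    have "norm (h *\<^sub>R (\<Sum>l\<le>k. rk i l *\<^sub>R f (u l))) \<le> h0 * (M * B)"
      unfolding norm_scaleR using that h0 B \<open>B \<ge> 0\<close> by (intro mult_mono M) auto
    then show ?thesis using hMB by (simp add: G_def dist_norm)
  qed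
  have contr: "dist (G h u i) (G h v i) \<le> D / 2"
    if h: "\<bar>h\<bar> \<le> h0" and u: "\<And>i. i \<le> k \<Longrightarrow> dist y0 (u i) \<le> 1" "\<And>i. i \<le> k \<Longrightarrow> dist y0 (v i) \<le> 1"
      and D: "\<And>i. i \<le> k \<Longrightarrow> dist (u i) (v i) \<le> D" and i: "i \<le> k" for h u v D i
  proof -
    have D0: "0 \<le> D" using D[OF i] zero_le_dist[of "u i" "v i"] by linarith
    have "G h u i - G h v i = h *\<^sub>R (\<Sum>l\<le>k. rk i l *\<^sub>R (f (u l) - f (v l)))"
      by (simp add: G_def sum_subtractf algebra_simps)
    also have "norm \<dots> \<le> h0 * (M * (L * D))"
      unfolding norm_scaleR
    proof (intro mult_mono M)
      fix l assume l: "l \<le> k"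
      have "norm (f (u l) - f (v l)) \<le> L * norm (u l - v l)" using u l by (intro L(2)) auto
      also have "\<dots> \<le> L * D" using L(1) D[OF l] by (intro mult_left_mono) (auto simp: dist_norm)
      finally show "norm (f (u l) - f (v l)) \<le> L * D" .
    qed (use h h0 i L(1) D0 in auto)
    also have "\<dots> = h0 * (M * L) * D" by simp
    also have "\<dots> \<le> 1 / 2 * D" using hML D0 by (rule mult_right_mono)
    finally show ?thesis by (simp add: dist_norm)
  qed
  have "\<exists>u. \<forall>i\<le>k. dist y0 (u i) \<le> 1 \<and> G h u i = u i" if "\<bar>h\<bar> \<le> h0" for h
    using into[OF that] contr[OF that] by (rule finite_contraction_fixpoint)
  then obtain U where U: "\<And>h i. \<bar>h\<bar> \<le> h0 \<Longrightarrow> i \<le> k \<Longrightarrow> dist y0 (U h i) \<le> 1 \<and> G h (U h) i = U h i"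
    by metis
  show thesis
  proof (rule that[OF h0])
    show "stages f h y0 (U h)" if "\<bar>h\<bar> \<le> h0" for h using U[OF that] by (simp add: st)
    show "dist y0 (U h i) \<le> 1" if "\<bar>h\<bar> \<le> h0" "i \<le> k" for h i using U[OF that] by simp
    fix h u i
    assume h: "\<bar>h\<bar> \<le> h0" and u: "stages f h y0 u" "\<forall>i\<le>k. dist y0 (u i) \<le> 1" and i: "i \<le> k"
    \<comment> \<open>At an index where the maximum is attained, contraction gives
      \<open>D \<le> D / 2\<close>.\<close>
    define D where "D = Max ((\<lambda>i. dist (u i) (U h i)) ` {..k})"
    have D: "dist (u i) (U h i) \<le> D" if "i \<le> k" for i using that by (simp add: D_def)
    have "D \<in> (\<lambda>i. dist (u i) (U h i)) ` {..k}" unfolding D_def by (rule Max_in) auto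
    then obtain m where m: "m \<le> k" "D = dist (u m) (U h m)" by auto
    have "dist (G h u m) (G h (U h) m) \<le> D / 2"
      using u(2) U[OF h] D m(1) by (intro contr[OF h]) auto
    then have "D \<le> 0" using u(1) U[OF h m(1)] m by (simp add: st)
    then show "u i = U h i" using D[OF i] by (metis dist_le_zero_iff order_trans)
  qed
qed

text \<open>The bootstrap: control of order \<open>m\<close> for the curve passes to
  \<open>f\<close> along it, hence by \<open>moment_scaled_C\<close> to the coefficients and by
  \<open>scaled_C_poly\<close> to the slope. As the derivative of the curve is \<open>h\<close>
  times the slope, order \<open>m + 1\<close> follows. It ends at \<open>Suc n\<close>, when the
  smoothness of \<open>f\<close> is used up.\<close>

lemma numerical_solution:
  fixes f :: "'a::euclidean_space \<Rightarrow> 'a"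
  assumes f: "of_class_C n f" and n: "1 \<le> n"
  obtains h0 U where "0 < h0" "h0 \<le> 1"
    "numerical_branch (hbvm_near k s P t c \<tau>) f y0 (\<lambda>h. U h k)"
    "\<And>h. \<bar>h\<bar> \<le> h0 \<Longrightarrow> stages f h y0 (U h)"
    "scaled_C {h. h \<noteq> 0 \<and> \<bar>h\<bar> \<le> h0} (Suc n) (\<lambda>h. curve h y0 (\<lambda>l. f (U h l)))"
    "scaled_C {h. h \<noteq> 0 \<and> \<bar>h\<bar> \<le> h0} n (\<lambda>h. slope (\<lambda>l. f (U h l)))"
proof -
  have "of_class_C (Suc 0) f" using n by (intro of_class_C_mono[OF f]) simp
  then obtain h0 U where h0: "0 < h0" "h0 \<le> 1"
    and U: "\<And>h. \<bar>h\<bar> \<le> h0 \<Longrightarrow> stages f h y0 (U h)"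
      "\<And>h i. \<bar>h\<bar> \<le> h0 \<Longrightarrow> i \<le> k \<Longrightarrow> dist y0 (U h i) \<le> 1"
      "\<And>h u i. \<bar>h\<bar> \<le> h0 \<Longrightarrow> stages f h y0 u \<Longrightarrow> \<forall>i\<le>k. dist y0 (u i) \<le> 1 \<Longrightarrow>
        i \<le> k \<Longrightarrow> u i = U h i"
    by (rule stages_exist[of f y0]) (rule that; assumption)
  let ?S = "{h. h \<noteq> 0 \<and> \<bar>h\<bar> \<le> h0}"
  let ?V = "\<lambda>h l. f (U h l)"
  let ?u = "\<lambda>h. curve h y0 (?V h)"
  have branch: "numerical_branch (hbvm_near k s P t c \<tau>) f y0 (\<lambda>h. U h k)"
    unfolding numerical_branch_def
  proof (intro exI[of _ 1] conjI)
    show "\<forall>\<^sub>F h in at 0. {y1. (y0, y1) \<in> hbvm_near k s P t c \<tau> 1 f h} = {U h k}"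
      unfolding eventually_at
    proof (intro exI[of _ h0] conjI ballI impI)
      fix h :: real assume "h \<noteq> 0 \<and> dist h 0 < h0"
      then have h: "\<bar>h\<bar> \<le> h0" by simp
      show "{y1. (y0, y1) \<in> hbvm_near k s P t c \<tau> 1 f h} = {U h k}"
      proof (intro equalityI subsetI)
        fix y1 assume "y1 \<in> {y1. (y0, y1) \<in> hbvm_near k s P t c \<tau> 1 f h}"
        then obtain u where "stages f h y0 u" "u k = y1" "\<forall>i\<le>k. dist y0 (u i) \<le> 1"
          by (auto simp: hbvm_near_iff)
        then show "y1 \<in> {U h k}" using U(3)[OF h, of u k] by simp
      next
        fix y1 assume "y1 \<in> {U h k}"
        then show "y1 \<in> {y1. (y0, y1) \<in> hbvm_near k s P t c \<tau> 1 f h}"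
          using U(1,2)[OF h] by (auto simp: hbvm_near_iff intro!: exI[of _ "U h"])
      qed
    qed (rule h0)
  qed simp
  have ut: "?u h (t l) = U h l" if "h \<in> ?S" "l \<le> k" for h l
    using U(1)[of h] that by (simp add: stages_def)
  have deriv: "(?u h has_vector_derivative h *\<^sub>R slope (?V h) x) (at x within {0..1})" for h x
    by (rule curve_has_vector_derivative)
  obtain B where B: "\<And>x. dist y0 x \<le> 1 \<Longrightarrow> norm (f x) \<le> B"
    using bound_on_cball[OF of_class_C_continuous[OF f]] by metis
  obtain K where K: "\<And>v :: nat \<Rightarrow> 'a. \<And>B x. (\<And>l. l \<le> k \<Longrightarrow> norm (v l) \<le> B) \<Longrightarrow> x \<in> {0..1} \<Longrightarrow> norm (slope v x) \<le> K * B"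
    using slope_bound by metis
  have bdd: "norm (?u h x) \<le> norm y0 + K * B" if h: "h \<in> ?S" and x: "x \<in> {0..1}" for h x
  proof -
    have "norm (?u h x - ?u h 0) \<le> K * B"
    proof (rule vector_derivative_bound[where g="?u h", OF deriv])
      fix x :: real assume "x \<in> {0..1}"
      then have "norm (slope (?V h) x) \<le> K * B" using h U(2) B by (intro K) auto
      moreover have "\<bar>h\<bar> \<le> 1" using h h0 by auto
      ultimately show "norm (h *\<^sub>R slope (?V h) x) \<le> K * B"
        using mult_mono[of "\<bar>h\<bar>" 1 "norm (slope (?V h) x)" "K * B"] by simp
    qed (use x in auto)
    then show ?thesis using norm_triangle_sub[of "?u h x" y0] by simp
  qed
  \<comment> \<open>The coefficients are moments of \<open>f\<close> along the curve, as the curve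
    passes through the stages at the nodes.\<close>
  have step: "scaled_C ?S m (\<lambda>h. slope (?V h)) \<and> scaled_C ?S (Suc m) ?u"
    if m: "m \<le> n" and u: "scaled_C ?S m ?u" for m
  proof
    have F: "scaled_C ?S m (\<lambda>h x. f (?u h x))"
      using of_class_C_mono[OF f m] u by (rule scaled_C_compose)
    have "scaled_C ?S m (\<lambda>h x. poly (P j) x *\<^sub>R coef j (?V h))" if j: "j < s" for j
    proof -
      obtain C where C: "\<And>h. h \<in> ?S \<Longrightarrow> norm (moment j (\<lambda>l. f (?u h (t l)))) \<le> C * \<bar>h\<bar> ^ min j m"
        using moment_scaled_C[OF F j] by blast
      show ?thesis
      proof (rule scaled_C_poly)
        fix h assume h: "h \<in> ?S"
        show "h \<noteq> 0 \<and> \<bar>h\<bar> \<le> 1" using h h0 by auto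
        have "moment j (\<lambda>l. f (?u h (t l))) = moment j (?V h)"
          using ut[OF h] by (intro moment_cong) simp
        then have "norm (coef j (?V h)) \<le> (2 * real j + 1) * (C * \<bar>h\<bar> ^ min j m)"
          using mult_left_mono[OF C[OF h], of "2 * real j + 1"] by (simp add: coef_def)
        then show "norm (coef j (?V h)) \<le> (2 * real j + 1) * C * \<bar>h\<bar> ^ min j m" by simp
      qed simp
    qed
    then show slope: "scaled_C ?S m (\<lambda>h. slope (?V h))"
      unfolding slope_def[abs_def] by (intro scaled_C_sum) auto
    show "scaled_C ?S (Suc m) ?u"
      unfolding scaled_C.simps using bdd slope deriv by blast
  qed
  have "scaled_C ?S m ?u" if "m \<le> Suc n" for m
    using that
  proof (induction m)
    case 0
    then show ?case unfolding scaled_C.simps using bdd by blast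
  next
    case (Suc m)
    then show ?case using step[of m] by simp
  qed
  then show thesis using that[OF h0 branch U(1)] step[of n] by simp
qed

lemma bigo_at_0:
  assumes "0 < h0" "\<And>h. h \<in> {h. h \<noteq> 0 \<and> \<bar>h\<bar> \<le> h0} \<Longrightarrow> \<bar>e h\<bar> \<le> C * \<bar>h\<bar> ^ p"
  shows "e \<in> O[at 0](\<lambda>h. h ^ p :: real)"
proof (rule bigoI)
  show "\<forall>\<^sub>F h in at 0. norm (e h) \<le> C * norm (h ^ p)"
    unfolding eventually_at using assms by (intro exI[of _ h0]) (auto simp: power_abs)
qed

lemma energy_error:
  fixes H :: "real ^ ('m::finite + 'm) \<Rightarrow> real"
  assumes H: "of_class_C (2 * k + 1) H"
  shows "has_energy_error (hbvm_near k s P t c \<tau>) (hamiltonian_field H) H (2 * k + 1)"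
  unfolding has_energy_error_def
proof
  fix y0
  let ?f = "hamiltonian_field H"
  have H': "of_class_C (Suc (2 * k)) H" using H by simp
  obtain h0 U where h0: "0 < h0" "h0 \<le> 1"
    and branch: "numerical_branch (hbvm_near k s P t c \<tau>) ?f y0 (\<lambda>h. U h k)"
    and U: "\<And>h. \<bar>h\<bar> \<le> h0 \<Longrightarrow> stages ?f h y0 (U h)"
    and u: "scaled_C {h. h \<noteq> 0 \<and> \<bar>h\<bar> \<le> h0} (Suc (2 * k)) (\<lambda>h. curve h y0 (\<lambda>l. ?f (U h l)))"
    and sl: "scaled_C {h. h \<noteq> 0 \<and> \<bar>h\<bar> \<le> h0} (2 * k) (\<lambda>h. slope (\<lambda>l. ?f (U h l)))"
  proof (rule numerical_solution[OF of_class_C_hamiltonian_field[OF H'], of y0])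
    show "1 \<le> 2 * k" using k_pos by simp
  qed (rule that; assumption)
  let ?S = "{h. h \<noteq> 0 \<and> \<bar>h\<bar> \<le> h0}"
  let ?u = "\<lambda>h. curve h y0 (\<lambda>l. ?f (U h l))"
  define \<psi> where "\<psi> h x = frechet_derivative H (at (?u h x)) (slope (\<lambda>l. ?f (U h l)) x)" for h x
  have \<psi>: "scaled_C ?S (2 * k) \<psi>"
    unfolding \<psi>_def[abs_def] by (rule scaled_C_frechet_derivative[OF H' scaled_C_SucD[OF u] sl])
  have dH: "H differentiable (at y)" for y using H' by simp
  have d: "((\<lambda>x. H (?u h x)) has_vector_derivative h *\<^sub>R \<psi> h x) (at x within {0..1})" for h x
  proof -
    have D: "(H has_derivative frechet_derivative H (at (?u h x))) (at (?u h x))"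
      using dH by (simp flip: frechet_derivative_works)
    show ?thesis
      using has_vector_derivative_comp[of "?u h", OF curve_has_vector_derivative D]
      by (simp add: \<psi>_def linear_scale[OF has_derivative_linear[OF D]])
  qed
  obtain C where C: "\<And>h. h \<in> ?S \<Longrightarrow>
    \<bar>H (?u h 1) - H (?u h 0) - h * (\<Sum>i\<le>k. b i * \<psi> h (t i))\<bar> \<le> C * \<bar>h\<bar> ^ Suc (2 * k)"
    by (rule quadrature_scaled_C[OF \<psi> order_refl d]) (rule that; assumption)
  have "\<bar>H (U h k) - H y0\<bar> \<le> C * \<bar>h\<bar> ^ (2 * k + 1)" if h: "h \<in> ?S" for h
  proof -
    have ut: "?u h (t l) = U h l" if "l \<le> k" for l
      using U[of h] that h by (simp add: stages_def)
    have "(\<Sum>i\<le>k. b i * \<psi> h (t i)) = (\<Sum>i\<le>k. b i * (gradient H (U h i) \<bullet> slope (\<lambda>l. ?f (U h l)) (t i)))"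
      using ut dH by (intro sum.cong) (auto simp: \<psi>_def frechet_derivative_gradient)
    then have "(\<Sum>i\<le>k. b i * \<psi> h (t i)) = 0" by (simp add: discrete_line_integral_zero)
    then show ?thesis using C[OF h] ut[of k] by simp
  qed
  then have "(\<lambda>h. H (U h k) - H y0) \<in> O[at 0](\<lambda>h. h ^ (2 * k + 1))"
    by (rule bigo_at_0[OF h0(1)])
  then show "\<exists>\<psi>. numerical_branch (hbvm_near k s P t c \<tau>) ?f y0 \<psi> \<and>
        (\<lambda>h. H (\<psi> h) - H y0) \<in> O[at 0](\<lambda>h. h ^ (2 * k + 1))"
    using branch by blast
qed

end



section \<open>Order of accuracy\<close>

text \<open>Mean value inequality for f(z) - Df(x) z. On the ball around \<open>x\<close> that
  reaches to \<open>y\<close>, its derivative is at most a Lipschitz constant of the derivative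
  times the distance of \<open>x\<close> and \<open>y\<close>; intersecting with the given ball
  keeps the domain convex.\<close>

lemma of_class_C_quadratic_remainder:
  fixes f :: "'a::euclidean_space \<Rightarrow> 'b::real_normed_vector"
  assumes f: "of_class_C (Suc (Suc 0)) f"
  obtains L where "0 \<le> L" "\<And>x y. dist a x \<le> r \<Longrightarrow> dist a y \<le> r \<Longrightarrow>
    norm (f y - f x - frechet_derivative f (at x) (y - x)) \<le> L * (norm (y - x))\<^sup>2"
proof -
  let ?D = "\<lambda>y. frechet_derivative f (at y)"
  have D: "(f has_derivative ?D y) (at y)" for y
    using f by (simp flip: frechet_derivative_works)
  have "\<exists>L\<ge>0. \<forall>x y. dist a x \<le> r \<longrightarrow> dist a y \<le> r \<longrightarrow> norm (?D x e - ?D y e) \<le> L * norm (x - y)" for e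
  proof -
    have "of_class_C (Suc 0) (\<lambda>y. ?D y e)" using f by simp
    then show ?thesis by (rule of_class_C_lipschitz[of _ a r]) blast
  qed
  then obtain L where L: "\<And>e. 0 \<le> L e"
    "\<And>e x y. dist a x \<le> r \<Longrightarrow> dist a y \<le> r \<Longrightarrow> norm (?D x e - ?D y e) \<le> L e * norm (x - y)"
    by metis
  show thesis
  proof (rule that)
    show "0 \<le> (\<Sum>e\<in>Basis. L e)" using L(1) by (intro sum_nonneg) auto
    fix x y assume xy: "dist a x \<le> r" "dist a y \<le> r"
    let ?K = "(\<Sum>e\<in>Basis. L e) * norm (y - x)"
    let ?S = "cball a r \<inter> cball x (norm (y - x))"
    have lin: "linear (?D z)" for z using D by (rule has_derivative_linear)
    have bl: "bounded_linear (?D z)" for z using D by (rule has_derivative_bounded_linear)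
    have d: "((\<lambda>z. f z - ?D x z) has_derivative (\<lambda>v. ?D z v - ?D x v)) (at z within ?S)" for z
      by (intro has_derivative_diff has_derivative_at_withinI[OF D]
          bounded_linear_imp_has_derivative[OF bl])
    have "onorm (\<lambda>v. ?D z v - ?D x v) \<le> ?K" if z: "z \<in> ?S" for z
    proof (rule onorm_le)
      fix v
      have "norm (?D z v - ?D x v) \<le> (\<Sum>e\<in>Basis. L e * norm (y - x)) * norm v"
      proof (rule linear_bound_Basis)
        show "linear (\<lambda>v. ?D z v - ?D x v)" using lin by (intro linear_compose_sub)
        fix e :: 'a
        have "norm (?D z e - ?D x e) \<le> L e * norm (z - x)" using z xy by (intro L(2)) auto
        also have "\<dots> \<le> L e * norm (y - x)"
          using z L(1) by (intro mult_left_mono) (auto simp: dist_norm norm_minus_commute)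
        finally show "norm (?D z e - ?D x e) \<le> L e * norm (y - x)" .
      qed
      then show "norm (?D z v - ?D x v) \<le> ?K * norm v" by (simp add: sum_distrib_right)
    qed
    then have "norm ((f y - ?D x y) - (f x - ?D x x)) \<le> ?K * norm (y - x)"
      using xy by (intro differentiable_bound[OF _ d]) (auto simp: dist_norm norm_minus_commute intro: convex_Int)
    moreover have "(f y - ?D x y) - (f x - ?D x x) = f y - f x - ?D x (y - x)"
      by (simp add: linear_diff[OF lin])
    ultimately show "norm (f y - f x - ?D x (y - x)) \<le> (\<Sum>e\<in>Basis. L e) * (norm (y - x))\<^sup>2"
      by (simp add: power2_eq_square mult.assoc)
  qed
qed

lemma scaled_C_diff:
  assumes "scaled_C S n \<phi>" "scaled_C S n \<eta>"
  shows "scaled_C S n (\<lambda>h x. \<phi> h x - \<eta> h x)"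
proof -
  have "scaled_C S n (\<lambda>h x. - 1 *\<^sub>R \<eta> h x)"
    using scaled_C_const[of S "\<lambda>_. - 1 :: real" 1] assms(2)
    by (intro scaled_C_bilinear[OF bounded_bilinear_scaleR]) auto
  from scaled_C_add[OF assms(1) this] show ?thesis by simp
qed

text \<open>Approximate solutions, to any order in \<open>h\<close>, of the adjoint variational equation backwards
  from \<open>x = 1\<close>, by Picard iteration. Exact solutions would need an existence theorem for linear
  differential equations, and the error estimate tolerates a small defect \<open>\<delta>\<close>.\<close>

lemma adjoint_solution:
  fixes f :: "'a::euclidean_space \<Rightarrow> 'a"
  assumes S: "\<And>h. h \<in> S \<Longrightarrow> \<bar>h\<bar> \<le> 1"
    and f: "of_class_C (Suc (Suc n)) f" and u: "scaled_C S (Suc n) u"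
  shows "\<exists>z \<delta> C. scaled_C S (Suc (Suc n)) z \<and> (\<forall>h. z h 1 = v) \<and> (\<forall>h\<in>S. \<forall>x\<in>{0..1}.
    norm (\<delta> h x) \<le> C * \<bar>h\<bar> ^ m \<and>
    (\<exists>z'. (z h has_vector_derivative z') (at x within {0..1}) \<and>
      (\<forall>e. z' \<bullet> e = - h * (z h x \<bullet> frechet_derivative f (at (u h x)) e + \<delta> h x \<bullet> e))))"
proof -
  let ?D = "\<lambda>h x. frechet_derivative f (at (u h x))"
  \<comment> \<open>The transpose of the derivative of \<open>f\<close> along \<open>u\<close>,
    written in coordinates so that scaled smoothness follows from that of fixed directional
    derivatives.\<close>
  define adj where "adj h x z = (\<Sum>e\<in>Basis. (?D h x e \<bullet> z) *\<^sub>R e)" for h x z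
  have dD: "f differentiable (at y)" for y using f by simp
  have lin: "linear (?D h x)" for h x using dD by (rule linear_frechet_derivative)
  have adj_inner: "adj h x z \<bullet> e = z \<bullet> ?D h x e" for h x z e
  proof -
    have "?D h x (\<Sum>i\<in>Basis. (e \<bullet> i) *\<^sub>R i) = (\<Sum>i\<in>Basis. (e \<bullet> i) *\<^sub>R ?D h x i)"
      by (simp only: linear_sum[OF lin] linear_scale[OF lin])
    then have "?D h x e = (\<Sum>i\<in>Basis. (e \<bullet> i) *\<^sub>R ?D h x i)"
      by (simp only: euclidean_representation)
    then show ?thesis
      by (simp add: adj_def inner_sum_left inner_sum_right inner_commute mult.commute)
  qed
  have adj_diff: "adj h x (z - w) = adj h x z - adj h x w" for h x z w
    by (simp add: adj_def inner_diff_right scaleR_left_diff_distrib sum_subtractf)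
  have De: "scaled_C S (Suc n) (\<lambda>h x. ?D h x e)" for e
    by (rule scaled_C_frechet_derivative[OF f u]) (rule scaled_C_const[where B="norm e"], simp)
  have adj_scaled: "scaled_C S (Suc n) (\<lambda>h x. adj h x (z h x))" if "scaled_C S (Suc n) z" for z
    unfolding adj_def
    by (intro scaled_C_sum scaled_C_bilinear[OF bounded_bilinear_scaleR]
        scaled_C_bilinear[OF bounded_bilinear_inner] De that
        scaled_C_const[where \<gamma>="\<lambda>_. e" and B="norm e" for e] order_refl)
  have "\<exists>B\<ge>0. \<forall>h\<in>S. \<forall>x\<in>{0..1}. norm (?D h x e) \<le> B" for e
    using scaled_C_bounded[OF De[of e]] by metis
  then obtain B where B: "\<And>e. 0 \<le> B e" "\<And>e h x. h \<in> S \<Longrightarrow> x \<in> {0..1} \<Longrightarrow> norm (?D h x e) \<le> B e"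
    by metis
  define K where "K = (\<Sum>e\<in>Basis. B e)"
  have K: "0 \<le> K" "\<And>h x z. h \<in> S \<Longrightarrow> x \<in> {0..1} \<Longrightarrow> norm (adj h x z) \<le> K * norm z"
  proof -
    show "0 \<le> K" unfolding K_def using B(1) by (intro sum_nonneg) auto
    fix h x and z :: 'a assume hx: "h \<in> S" "x \<in> {0..(1::real)}"
    have "norm (adj h x z) \<le> (\<Sum>e\<in>Basis. B e * norm z)"
      unfolding adj_def
    proof (rule order.trans[OF norm_sum], rule sum_mono)
      fix e :: 'a assume e: "e \<in> Basis"
      have "\<bar>?D h x e \<bullet> z\<bar> \<le> norm (?D h x e) * norm z" by (rule Cauchy_Schwarz_ineq2)
      also have "\<dots> \<le> B e * norm z" using B(2)[OF hx] by (intro mult_right_mono) auto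
      finally show "norm ((?D h x e \<bullet> z) *\<^sub>R e) \<le> B e * norm z" using e by simp
    qed
    then show "norm (adj h x z) \<le> K * norm z" by (simp add: K_def sum_distrib_right)
  qed
  have "\<exists>z \<delta> C. scaled_C S (Suc (Suc n)) z \<and> (\<forall>h. z h 1 = v) \<and> (\<forall>h\<in>S. \<forall>x\<in>{0..1}.
    norm (\<delta> h x) \<le> C * \<bar>h\<bar> ^ m \<and>
    (z h has_vector_derivative - h *\<^sub>R (adj h x (z h x) + \<delta> h x)) (at x within {0..1}))"
  proof (induction m)
    case 0
    \<comment> \<open>The constant \<open>v\<close> solves the equation with a bounded defect that
      cancels the whole right-hand side.\<close>
    have "scaled_C S (Suc (Suc n)) (\<lambda>h x. v)" by (rule scaled_C_const[where B="norm v"]) simp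
    moreover have "norm (- adj h x v) \<le> K * norm v * \<bar>h\<bar> ^ 0" if "h \<in> S" "x \<in> {0..1}" for h x
      using K(2)[OF that] by simp
    moreover have "((\<lambda>x. v) has_vector_derivative - h *\<^sub>R (adj h x v + - adj h x v)) (at x within {0..1})" for h x
      by simp
    ultimately show ?case
      by (intro exI[of _ "\<lambda>h x. v"] exI[of _ "\<lambda>h x. - adj h x v"] exI[of _ "K * norm v"]) blast
  next
    case (Suc m)
    then obtain z \<delta> C where z: "scaled_C S (Suc (Suc n)) z" "\<And>h. z h 1 = v"
      and \<delta>: "\<And>h x. h \<in> S \<Longrightarrow> x \<in> {0..1} \<Longrightarrow> norm (\<delta> h x) \<le> C * \<bar>h\<bar> ^ m"
      and zd: "\<And>h x. h \<in> S \<Longrightarrow> x \<in> {0..1} \<Longrightarrow>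
        (z h has_vector_derivative - h *\<^sub>R (adj h x (z h x) + \<delta> h x)) (at x within {0..1})"
      by blast
    let ?\<psi> = "\<lambda>h x. 0 - adj h x (z h x)"
    have \<psi>: "scaled_C S (Suc n) ?\<psi>"
    proof (rule scaled_C_diff)
      show "scaled_C S (Suc n) (\<lambda>h x. 0)" by (rule scaled_C_const[where B=0]) simp
    qed (rule adj_scaled[OF scaled_C_SucD[OF z(1)]])
    obtain w where w: "scaled_C S (Suc (Suc n)) w" "\<And>h. w h 1 = v"
      "\<And>h x. h \<in> S \<Longrightarrow> x \<in> {0..1} \<Longrightarrow> (w h has_vector_derivative h *\<^sub>R ?\<psi> h x) (at x within {0..1})"
      by (rule scaled_C_antiderivative[OF \<psi> S scaled_C_continuous[OF \<psi>], of v]) (assumption | rule that)+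
    \<comment> \<open>The new iterate \<open>w\<close> uses the old \<open>z\<close> on the
      right-hand side, which makes this its defect. The difference \<open>z h x - w h x\<close>
      vanishes at 1 and has derivative \<open>h\<close> times the old defect up to sign, whence one
      more power of \<open>h\<close>.\<close>
    define \<epsilon> where "\<epsilon> h x = adj h x (z h x - w h x)" for h x
    have zw: "norm (z h x - w h x) \<le> C * \<bar>h\<bar> ^ Suc m" if h: "h \<in> S" and x: "x \<in> {0..1}" for h x
    proof -
      have "norm ((z h x - w h x) - (z h 1 - w h 1)) \<le> C * \<bar>h\<bar> ^ Suc m"
      proof (rule vector_derivative_bound[where g="\<lambda>x. z h x - w h x" and g'="\<lambda>x. - h *\<^sub>R \<delta> h x"])
        fix x :: real assume x: "x \<in> {0..1}"
        show "((\<lambda>x. z h x - w h x) has_vector_derivative - h *\<^sub>R \<delta> h x) (at x within {0..1})"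
          using has_vector_derivative_diff[OF zd[OF h x] w(3)[OF h x]] by (simp add: algebra_simps)
        show "norm (- h *\<^sub>R \<delta> h x) \<le> C * \<bar>h\<bar> ^ Suc m"
          using mult_left_mono[OF \<delta>[OF h x], of "\<bar>h\<bar>"] by (simp add: mult_ac)
      qed (use x in auto)
      then show ?thesis by (simp add: z w)
    qed
    have "norm (\<epsilon> h x) \<le> K * C * \<bar>h\<bar> ^ Suc m" if hx: "h \<in> S" "x \<in> {0..1}" for h x
    proof -
      have "norm (\<epsilon> h x) \<le> K * norm (z h x - w h x)" unfolding \<epsilon>_def by (rule K(2)[OF hx])
      also have "\<dots> \<le> K * (C * \<bar>h\<bar> ^ Suc m)" using zw[OF hx] K(1) by (rule mult_left_mono)
      finally show ?thesis by simp
    qed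
    moreover have "(w h has_vector_derivative - h *\<^sub>R (adj h x (w h x) + \<epsilon> h x)) (at x within {0..1})"
      if "h \<in> S" "x \<in> {0..1}" for h x
      using w(3)[OF that] by (simp add: \<epsilon>_def adj_diff)
    ultimately show ?case using w(1,2) by blast
  qed
  then obtain z \<delta> C where z: "scaled_C S (Suc (Suc n)) z" "\<forall>h. z h 1 = v"
    and \<delta>: "\<And>h x. h \<in> S \<Longrightarrow> x \<in> {0..1} \<Longrightarrow> norm (\<delta> h x) \<le> C * \<bar>h\<bar> ^ m"
    and zd: "\<And>h x. h \<in> S \<Longrightarrow> x \<in> {0..1} \<Longrightarrow>
      (z h has_vector_derivative - h *\<^sub>R (adj h x (z h x) + \<delta> h x)) (at x within {0..1})"
    by blast
  have "(- h *\<^sub>R (adj h x (z h x) + \<delta> h x)) \<bullet> e = - h * (z h x \<bullet> ?D h x e + \<delta> h x \<bullet> e)" for h x e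
    by (simp add: inner_add_left adj_inner)
  then show ?thesis using z \<delta> zd by blast
qed

context hbvm_scheme
begin

lemma slope_cong: "(\<And>l. l \<le> k \<Longrightarrow> v l = w l) \<Longrightarrow> slope v = slope w"
  using moment_cong[of v w] by (simp add: fun_eq_iff slope_def coef_def)

text \<open>By the symmetry of \<open>weighted_sum_slope\<close> the projection can be moved onto
  the polynomial factor, which it reproduces.\<close>

lemma residual_orthogonal:
  fixes v :: "nat \<Rightarrow> 'a::real_inner"
  assumes "n \<le> s"
  shows "(\<Sum>i\<le>k. b i * ((\<Sum>j<n. t i ^ j *\<^sub>R a j) \<bullet> (slope v (t i) - v i))) = 0"
proof -
  let ?p = "\<lambda>l. \<Sum>j<n. t l ^ j *\<^sub>R a j"
  have "(\<Sum>i\<le>k. b i * (?p i \<bullet> v i)) = (\<Sum>i\<le>k. b i * (v i \<bullet> slope ?p (t i)))"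
    by (simp add: slope_sum_power[OF assms] inner_commute)
  also have "\<dots> = (\<Sum>j<s. (2 * real j + 1) * (moment j v \<bullet> moment j ?p))"
    by (rule weighted_sum_slope)
  also have "\<dots> = (\<Sum>j<s. (2 * real j + 1) * (moment j ?p \<bullet> moment j v))"
    by (simp add: inner_commute)
  also have "\<dots> = (\<Sum>i\<le>k. b i * (?p i \<bullet> slope v (t i)))"
    by (rule weighted_sum_slope[symmetric])
  finally show ?thesis by (simp add: inner_diff_right right_diff_distrib sum_subtractf)
qed

text \<open>With \<open>e\<close> the error, \<open>r\<close> the residual and \<open>z\<close> the adjoint solution, \<open>(z \<bullet> e)'\<close> equals
  \<open>h * (z \<bullet> r)\<close> up to \<open>O(h^(2 s + 2))\<close>. The integral of \<open>z \<bullet> r\<close> is computed by the quadrature up to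
  \<open>O(h^(2 s))\<close>, and the discrete sum is \<open>O(h^s) * O(h^s)\<close>, because \<open>r\<close> is orthogonal to the Taylor
  polynomial of \<open>z\<close>.\<close>

lemma local_error:
  fixes f :: "'a::euclidean_space \<Rightarrow> 'a"
  assumes f: "of_class_C (2 * s) f" and T: "T > 0" and \<phi>0: "\<phi> 0 = y0"
    and \<phi>: "\<And>x. x \<in> {-T..T} \<Longrightarrow> (\<phi> has_vector_derivative f (\<phi> x)) (at x within {-T..T})"
  shows "\<exists>\<psi>. numerical_branch (hbvm_near k s P t c \<tau>) f y0 \<psi> \<and>
    (\<lambda>h. norm (\<psi> h - \<phi> h)) \<in> O[at 0](\<lambda>h. h ^ (2 * s + 1))"
proof -
  have s2: "1 \<le> 2 * s" using s_pos by simp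
  obtain h1 U where h1: "0 < h1" "h1 \<le> 1"
    and branch: "numerical_branch (hbvm_near k s P t c \<tau>) f y0 (\<lambda>h. U h k)"
    and U: "\<And>h. \<bar>h\<bar> \<le> h1 \<Longrightarrow> stages f h y0 (U h)"
    and u1: "scaled_C {h. h \<noteq> 0 \<and> \<bar>h\<bar> \<le> h1} (Suc (2 * s)) (\<lambda>h. curve h y0 (\<lambda>l. f (U h l)))"
    and sl1: "scaled_C {h. h \<noteq> 0 \<and> \<bar>h\<bar> \<le> h1} (2 * s) (\<lambda>h. slope (\<lambda>l. f (U h l)))"
    by (rule numerical_solution[OF f s2, of y0]) (rule that; assumption)
  let ?V = "\<lambda>h l. f (U h l)"
  define u where "u h = curve h y0 (?V h)" for h
  have u2: "scaled_C {h. h \<noteq> 0 \<and> \<bar>h\<bar> \<le> h1} (Suc (2 * s)) u"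
    unfolding u_def[abs_def] by (rule u1)
  obtain B1 where B1: "\<And>h x. h \<in> {h. h \<noteq> 0 \<and> \<bar>h\<bar> \<le> h1} \<Longrightarrow> x \<in> {0..1} \<Longrightarrow> norm (u h x) \<le> B1"
    by (rule scaled_C_bounded[OF u2]) (rule that; assumption)
  have "continuous_on {-T..T} \<phi>"
    unfolding continuous_on_eq_continuous_within using has_vector_derivative_continuous[OF \<phi>] by blast
  then have "bounded (\<phi> ` {-T..T})" by (intro compact_imp_bounded compact_continuous_image) auto
  then obtain B2 where B2: "\<forall>x\<in>{-T..T}. norm (\<phi> x) \<le> B2" by (auto simp: bounded_iff)
  \<comment> \<open>A ball around 0 that contains numerical curve and exact solution, so that single
    constants \<open>L\<close> and \<open>Q\<close> serve for both.\<close>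
  define R where "R = max B1 B2"
  have f1: "of_class_C (Suc 0) f" and f2: "of_class_C (Suc (Suc 0)) f"
    using s_pos by (auto intro!: of_class_C_mono[OF f] simp del: of_class_C.simps)
  obtain L where L: "0 \<le> L" "\<And>x y. dist 0 x \<le> R \<Longrightarrow> dist 0 y \<le> R \<Longrightarrow> norm (f x - f y) \<le> L * norm (x - y)"
    by (rule of_class_C_lipschitz[OF f1, of 0 R]) (rule that; assumption)
  obtain Q where Q: "0 \<le> Q" "\<And>x y. dist 0 x \<le> R \<Longrightarrow> dist 0 y \<le> R \<Longrightarrow>
    norm (f y - f x - frechet_derivative f (at x) (y - x)) \<le> Q * (norm (y - x))\<^sup>2"
    by (rule of_class_C_quadratic_remainder[OF f2, of 0 R]) (rule that; assumption)
  \<comment> \<open>The bound \<open>T\<close> keeps \<open>h * x\<close> in the domain of the exact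
    solution; the last entry yields \<open>\<bar>h\<bar> * L \<le> 1 / 2\<close>, by which the
    Lipschitz term is absorbed below.\<close>
  define h0 where "h0 = min h1 (min T (1 / (2 * L + 1)))"
  have h0: "0 < h0" "h0 \<le> h1" "h0 \<le> T" using h1 T L(1) by (auto simp: h0_def)
  define S where "S = {h. h \<noteq> 0 \<and> \<bar>h\<bar> \<le> h0}"
  have Sh: "h \<noteq> 0" "\<bar>h\<bar> \<le> h1" "\<bar>h\<bar> \<le> 1" "\<bar>h\<bar> \<le> T" "\<bar>h\<bar> * L \<le> 1 / 2" if "h \<in> S" for h
  proof -
    show "h \<noteq> 0" "\<bar>h\<bar> \<le> h1" "\<bar>h\<bar> \<le> 1" "\<bar>h\<bar> \<le> T" using that h0 h1 by (auto simp: S_def)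
    have "\<bar>h\<bar> * L \<le> 1 / (2 * L + 1) * L"
      using that L(1) by (intro mult_right_mono) (auto simp: S_def h0_def)
    also have "\<dots> \<le> 1 / 2" using L(1) by (simp add: field_simps)
    finally show "\<bar>h\<bar> * L \<le> 1 / 2" .
  qed
  have sub: "S \<subseteq> {h. h \<noteq> 0 \<and> \<bar>h\<bar> \<le> h1}" using Sh by auto
  have u: "scaled_C S (Suc (2 * s)) u" by (rule scaled_C_subset[OF u2 sub])
  have sl: "scaled_C S (2 * s) (\<lambda>h. slope (?V h))" by (rule scaled_C_subset[OF sl1 sub])
  have ut: "u h (t l) = U h l" if "h \<in> S" "l \<le> k" for h l
    using U[of h] Sh(2)[OF that(1)] that(2) by (simp add: stages_def u_def)
  have ud: "(u h has_vector_derivative h *\<^sub>R slope (?V h) x) (at x within {0..1})" for h x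
    unfolding u_def by (rule curve_has_vector_derivative)
  have uR: "dist 0 (u h x) \<le> R" if "h \<in> S" "x \<in> {0..1}" for h x
    using B1[OF subsetD[OF sub that(1)] that(2)] by (simp add: R_def)
  have hx: "h * x \<in> {-T..T}" if "h \<in> S" "x \<in> {0..1}" for h x
  proof -
    have "\<bar>h * x\<bar> \<le> T * 1" using Sh(4)[OF that(1)] that(2) by (simp only: abs_mult) (intro mult_mono, auto)
    then show ?thesis by auto
  qed
  have \<phi>R: "dist 0 (\<phi> (h * x)) \<le> R" if "h \<in> S" "x \<in> {0..1}" for h x
    using bspec[OF B2 hx[OF that]] by (simp add: R_def)
  have \<phi>d: "((\<lambda>x. \<phi> (h * x)) has_vector_derivative h *\<^sub>R f (\<phi> (h * x))) (at x within {0..1})"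
    if h: "h \<in> S" and x: "x \<in> {0..1}" for h x
  proof -
    have "((\<lambda>x. h * x) has_vector_derivative h) (at x within {0..1})"
      by (auto intro!: derivative_eq_intros)
    moreover have "(\<phi> has_vector_derivative f (\<phi> (h * x))) (at (h * x) within (\<lambda>x. h * x) ` {0..1})"
      using \<phi>[OF hx[OF h x]] by (rule has_vector_derivative_within_subset) (use hx[OF h] in auto)
    ultimately show ?thesis using vector_diff_chain_within[of "\<lambda>x. h * x" h x "{0..1}" \<phi>] by (simp add: o_def)
  qed
  define e where "e h x = u h x - \<phi> (h * x)" for h x
  define r where "r h x = slope (?V h) x - f (u h x)" for h x
  have e0: "e h 0 = 0" for h by (simp add: e_def u_def \<phi>0)
  have fu: "scaled_C S (2 * s) (\<lambda>h x. f (u h x))"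
    by (rule scaled_C_compose[OF f scaled_C_SucD[OF u]])
  have r_scaled: "scaled_C S (2 * s) r"
    unfolding r_def[abs_def] by (rule scaled_C_diff[OF sl fu])
  obtain C1 where C1: "0 \<le> C1" "\<And>h x. h \<in> S \<Longrightarrow> x \<in> {0..1} \<Longrightarrow> norm (r h x) \<le> C1 * \<bar>h\<bar> ^ s"
  proof (rule slope_scaled_C[OF scaled_C_mono[OF fu, of s] order_refl])
    fix C assume C: "0 \<le> C" "\<And>h x. h \<in> S \<Longrightarrow> x \<in> {0..1} \<Longrightarrow>
      norm (slope (\<lambda>l. f (u h (t l))) x - f (u h x)) \<le> C * \<bar>h\<bar> ^ s"
    have "slope (\<lambda>l. f (u h (t l))) = slope (?V h)" if "h \<in> S" for h
      using ut[OF that] by (intro slope_cong) simp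
    then show thesis using C by (intro that[of C]) (auto simp: r_def)
  qed simp
  have ed: "(e h has_vector_derivative h *\<^sub>R (r h x + (f (u h x) - f (\<phi> (h * x))))) (at x within {0..1})"
    if "h \<in> S" "x \<in> {0..1}" for h x
    unfolding e_def[abs_def] using has_vector_derivative_diff[OF ud \<phi>d[OF that]]
    by (simp add: r_def scaleR_right_diff_distrib)
  have e_bound: "norm (e h x) \<le> 2 * C1 * \<bar>h\<bar> ^ Suc s" if h: "h \<in> S" and x: "x \<in> {0..1}" for h x
  proof -
    have "continuous_on {0..1} (e h)"
      unfolding continuous_on_eq_continuous_within
      using has_vector_derivative_continuous[OF ed[OF h]] by blast
    then have "continuous_on {0..1} (\<lambda>x. norm (e h x))" by (rule continuous_on_norm)
    then obtain m where m: "m \<in> {0..1}" "\<And>x. x \<in> {0..1} \<Longrightarrow> norm (e h x) \<le> norm (e h m)"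
      using continuous_attains_sup[of "{0..1::real}" "\<lambda>x. norm (e h x)"] by auto
    \<comment> \<open>At the maximum point \<open>m\<close> the right-hand side contains at most
      half of \<open>norm (e h m)\<close>, which moves to the left. This replaces a Gronwall
      argument.\<close>
    have "norm (e h m - e h 0) \<le> \<bar>h\<bar> * (C1 * \<bar>h\<bar> ^ s + L * norm (e h m))"
    proof (rule vector_derivative_bound[where g="e h", OF ed[OF h]])
      fix x :: real assume x: "x \<in> {0..1}"
      have "norm (f (u h x) - f (\<phi> (h * x))) \<le> L * norm (e h x)"
        unfolding e_def using uR[OF h x] \<phi>R[OF h x] by (rule L(2))
      also have "\<dots> \<le> L * norm (e h m)" using m(2)[OF x] L(1) by (rule mult_left_mono)
      finally have "norm (r h x + (f (u h x) - f (\<phi> (h * x)))) \<le> C1 * \<bar>h\<bar> ^ s + L * norm (e h m)"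
        using C1(2)[OF h x] by (intro norm_triangle_mono)
      then show "norm (h *\<^sub>R (r h x + (f (u h x) - f (\<phi> (h * x)))))
          \<le> \<bar>h\<bar> * (C1 * \<bar>h\<bar> ^ s + L * norm (e h m))"
        by (simp add: mult_left_mono)
    qed (use m in auto)
    also have "\<dots> = C1 * \<bar>h\<bar> ^ Suc s + \<bar>h\<bar> * L * norm (e h m)" by (simp add: algebra_simps)
    also have "\<bar>h\<bar> * L * norm (e h m) \<le> 1 / 2 * norm (e h m)"
      using Sh(5)[OF h] by (rule mult_right_mono) simp
    finally have "norm (e h m) \<le> 2 * C1 * \<bar>h\<bar> ^ Suc s" by (simp add: e0)
    then show ?thesis using m(2)[OF x] by linarith
  qed
  \<comment> \<open>The error is tested against a fixed vector \<open>v\<close>, the end value of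
    the adjoint solution; at 0 the error is zero.\<close>
  have component: "\<exists>C. \<forall>h\<in>S. \<bar>v \<bullet> e h 1\<bar> \<le> C * \<bar>h\<bar> ^ (2 * s + 1)" for v
  proof -
    obtain n where n: "2 * s = Suc (Suc n)" using s_pos by (metis One_nat_def Suc_le_D mult_2 add_Suc add_Suc_right)
    \<comment> \<open>Defect order \<open>s\<close> suffices, since the defect is paired with the
      error, already known to be of size h^(s+1).\<close>
    have "\<exists>z \<delta> C. scaled_C S (2 * s) z \<and> (\<forall>h. z h 1 = v) \<and> (\<forall>h\<in>S. \<forall>x\<in>{0..1}.
      norm (\<delta> h x) \<le> C * \<bar>h\<bar> ^ s \<and>
      (\<exists>z'. (z h has_vector_derivative z') (at x within {0..1}) \<and>
        (\<forall>e. z' \<bullet> e = - h * (z h x \<bullet> frechet_derivative f (at (u h x)) e + \<delta> h x \<bullet> e))))"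
      unfolding n
    proof (rule adjoint_solution)
      show "of_class_C (Suc (Suc n)) f" using f unfolding n .
      show "scaled_C S (Suc n) u" using scaled_C_SucD[OF scaled_C_SucD[OF u[unfolded n]]] .
    qed (rule Sh(3))
    then obtain z \<delta> Cd where z: "scaled_C S (2 * s) z" "\<And>h. z h 1 = v"
      and \<delta>z: "\<forall>h\<in>S. \<forall>x\<in>{0..1}. norm (\<delta> h x) \<le> Cd * \<bar>h\<bar> ^ s \<and>
      (\<exists>z'. (z h has_vector_derivative z') (at x within {0..1}) \<and>
        (\<forall>e. z' \<bullet> e = - h * (z h x \<bullet> frechet_derivative f (at (u h x)) e + \<delta> h x \<bullet> e)))"
      by blast
    obtain Bz where Bz: "0 \<le> Bz" "\<And>h x. h \<in> S \<Longrightarrow> x \<in> {0..1} \<Longrightarrow> norm (z h x) \<le> Bz"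
      by (rule scaled_C_bounded[OF z(1)]) (rule that; assumption)
    define \<psi> where "\<psi> h x = z h x \<bullet> r h x" for h x
    have \<psi>: "scaled_C S (2 * s) \<psi>"
      unfolding \<psi>_def[abs_def] by (rule scaled_C_bilinear[OF bounded_bilinear_inner z(1) r_scaled])
    have \<psi>c: "continuous_on {0..1} (\<psi> h)" if "h \<in> S" for h
      using scaled_C_continuous[OF \<psi>[unfolded n] that] .
    obtain \<Phi> where \<Phi>: "\<And>h x. h \<in> S \<Longrightarrow> x \<in> {0..1} \<Longrightarrow> (\<Phi> h has_vector_derivative h *\<^sub>R \<psi> h x) (at x within {0..1})"
      by (rule scaled_C_antiderivative[OF \<psi> Sh(3) \<psi>c, of 0]) (assumption | rule that)+
    have sk: "2 * s \<le> 2 * k" using s_le_k by simp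
    obtain C2 where C2: "\<And>h. h \<in> S \<Longrightarrow>
      \<bar>\<Phi> h 1 - \<Phi> h 0 - h * (\<Sum>i\<le>k. b i * \<psi> h (t i))\<bar> \<le> C2 * \<bar>h\<bar> ^ Suc (2 * s)"
      by (rule quadrature_scaled_C[OF \<psi> sk \<Phi>]) (assumption | rule that)+
    have zs: "scaled_C S s z" using z(1) by (rule scaled_C_mono) simp
    obtain C3 a where C3: "0 \<le> C3"
      "\<And>h x. h \<in> S \<Longrightarrow> x \<in> {0..1} \<Longrightarrow> norm (z h x - (\<Sum>i<s. x ^ i *\<^sub>R a h i)) \<le> C3 * \<bar>h\<bar> ^ s"
      by (rule scaled_C_taylor[OF zs]) (rule that; assumption)
    define W where "W = (\<Sum>i\<le>k. \<bar>b i\<bar> * (C3 * C1))"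
    have sum\<psi>: "\<bar>\<Sum>i\<le>k. b i * \<psi> h (t i)\<bar> \<le> W * \<bar>h\<bar> ^ (2 * s)" if h: "h \<in> S" for h
    proof -
      let ?p = "\<lambda>x. \<Sum>i<s. x ^ i *\<^sub>R a h i"
      have rt: "r h (t i) = slope (?V h) (t i) - ?V h i" if "i \<le> k" for i
        using ut[OF h that] by (simp add: r_def)
      have "(\<Sum>i\<le>k. b i * (?p (t i) \<bullet> r h (t i))) = 0"
        using residual_orthogonal[OF order_refl, of "a h" "?V h"] by (simp add: rt)
      then have "(\<Sum>i\<le>k. b i * \<psi> h (t i)) = (\<Sum>i\<le>k. b i * ((z h (t i) - ?p (t i)) \<bullet> r h (t i)))"
        by (simp add: \<psi>_def inner_diff_left right_diff_distrib sum_subtractf)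
      also have "\<bar>\<dots>\<bar> \<le> (\<Sum>i\<le>k. \<bar>b i\<bar> * ((C3 * \<bar>h\<bar> ^ s) * (C1 * \<bar>h\<bar> ^ s)))"
      proof (rule order.trans[OF sum_abs], rule sum_mono)
        fix i assume "i \<in> {..k}"
        then have ti: "t i \<in> {0..1}" using t_bounds by simp
        have "\<bar>(z h (t i) - ?p (t i)) \<bullet> r h (t i)\<bar> \<le> norm (z h (t i) - ?p (t i)) * norm (r h (t i))"
          by (rule Cauchy_Schwarz_ineq2)
        also have "\<dots> \<le> (C3 * \<bar>h\<bar> ^ s) * (C1 * \<bar>h\<bar> ^ s)"
          using C3(2)[OF h ti] C1(2)[OF h ti] C3(1) by (intro mult_mono) auto
        finally show "\<bar>b i * ((z h (t i) - ?p (t i)) \<bullet> r h (t i))\<bar>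
            \<le> \<bar>b i\<bar> * ((C3 * \<bar>h\<bar> ^ s) * (C1 * \<bar>h\<bar> ^ s))"
          by (simp only: abs_mult) (intro mult_left_mono, auto)
      qed
      also have "\<dots> = W * \<bar>h\<bar> ^ (2 * s)"
        unfolding W_def sum_distrib_right mult_2 power_add by (intro sum.cong) (simp_all only: mult_ac)
      finally show ?thesis .
    qed
    \<comment> \<open>Linearization error. The remainder estimate is centred at \<open>u\<close>,
      where the adjoint equation is linearized, which reverses the sign of the increment.\<close>
    let ?q = "\<lambda>h x. f (u h x) - f (\<phi> (h * x)) - frechet_derivative f (at (u h x)) (e h x)"
    have q: "norm (?q h x) \<le> Q * (2 * C1 * \<bar>h\<bar> ^ Suc s)\<^sup>2" if h: "h \<in> S" and x: "x \<in> {0..1}" for h x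
    proof -
      have lin: "linear (frechet_derivative f (at (u h x)))"
        using f2 by (auto intro: linear_frechet_derivative)
      have "frechet_derivative f (at (u h x)) (\<phi> (h * x) - u h x)
          = - frechet_derivative f (at (u h x)) (e h x)"
        using linear_neg[OF lin, of "e h x"] by (simp add: e_def)
      then have "?q h x = - (f (\<phi> (h * x)) - f (u h x) - frechet_derivative f (at (u h x)) (\<phi> (h * x) - u h x))"
        by simp
      then have "norm (?q h x) \<le> Q * (norm (\<phi> (h * x) - u h x))\<^sup>2"
        using Q(2)[OF uR[OF h x] \<phi>R[OF h x]] by (simp only: norm_minus_cancel)
      also have "\<dots> \<le> Q * (2 * C1 * \<bar>h\<bar> ^ Suc s)\<^sup>2"
        using e_bound[OF h x] Q(1)
        by (intro mult_left_mono power_mono) (auto simp: e_def norm_minus_commute)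
      finally show ?thesis .
    qed
    define M where "M = Bz * (Q * (2 * C1)\<^sup>2) + Cd * (2 * C1)"
    have g: "\<bar>(z h 1 \<bullet> e h 1 - \<Phi> h 1) - (z h 0 \<bullet> e h 0 - \<Phi> h 0)\<bar> \<le> M * \<bar>h\<bar> ^ (2 * s + 1)"
      if h: "h \<in> S" for h
    proof -
      \<comment> \<open>In the derivative of \<open>z \<bullet> e - \<Phi>\<close>, the residual
        cancels against \<open>\<psi>\<close> and the linear part of \<open>f\<close> against the
        adjoint equation; linearization error and defect remain.\<close>
      let ?g' = "\<lambda>x. h * (z h x \<bullet> ?q h x - \<delta> h x \<bullet> e h x)"
      have "norm ((z h 1 \<bullet> e h 1 - \<Phi> h 1) - (z h 0 \<bullet> e h 0 - \<Phi> h 0)) \<le> M * \<bar>h\<bar> ^ (2 * s + 1)"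
      proof (rule vector_derivative_bound[where g="\<lambda>x. z h x \<bullet> e h x - \<Phi> h x" and g'="?g'"])
        fix x :: real assume x: "x \<in> {0..1}"
        let ?e' = "h *\<^sub>R (r h x + (f (u h x) - f (\<phi> (h * x))))"
        obtain z' where z': "(z h has_vector_derivative z') (at x within {0..1})"
          "\<And>e. z' \<bullet> e = - h * (z h x \<bullet> frechet_derivative f (at (u h x)) e + \<delta> h x \<bullet> e)"
          using \<delta>z h x by blast
        have "((\<lambda>x. z h x \<bullet> e h x) has_vector_derivative z h x \<bullet> ?e' + z' \<bullet> e h x) (at x within {0..1})"
          using z'(1) ed[OF h x] by (rule bounded_bilinear.has_vector_derivative[OF bounded_bilinear_inner])
        from has_vector_derivative_diff[OF this \<Phi>[OF h x]]
        show "((\<lambda>x. z h x \<bullet> e h x - \<Phi> h x) has_vector_derivative ?g' x) (at x within {0..1})"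
          by (rule has_vector_derivative_eq_rhs)
             (simp add: z'(2) \<psi>_def inner_add_right inner_diff_right algebra_simps)
        have zq: "\<bar>z h x \<bullet> ?q h x\<bar> \<le> Bz * (Q * (2 * C1 * \<bar>h\<bar> ^ Suc s)\<^sup>2)"
          by (rule order.trans[OF Cauchy_Schwarz_ineq2])
             (rule mult_mono[OF Bz(2)[OF h x] q[OF h x] Bz(1) norm_ge_zero])
        have \<delta>e: "\<bar>\<delta> h x \<bullet> e h x\<bar> \<le> (Cd * \<bar>h\<bar> ^ s) * (2 * C1 * \<bar>h\<bar> ^ Suc s)"
        proof -
          have d: "norm (\<delta> h x) \<le> Cd * \<bar>h\<bar> ^ s" using \<delta>z h x by blast
          then show ?thesis
            by (intro order.trans[OF Cauchy_Schwarz_ineq2]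
                mult_mono[OF d e_bound[OF h x] order.trans[OF norm_ge_zero d] norm_ge_zero])
        qed
        have h1': "\<bar>h\<bar> \<le> 1" using Sh(3)[OF h] .
        have "(\<bar>h\<bar> ^ Suc s)\<^sup>2 = \<bar>h\<bar> * \<bar>h\<bar> ^ (2 * s + 1)"
          by (simp only: power_mult[symmetric] power_Suc[symmetric]) (simp add: mult.commute)
        also have "\<dots> \<le> \<bar>h\<bar> ^ (2 * s + 1)" using h1' by (intro mult_left_le_one_le) auto
        finally have "(2 * C1 * \<bar>h\<bar> ^ Suc s)\<^sup>2 \<le> (2 * C1)\<^sup>2 * \<bar>h\<bar> ^ (2 * s + 1)"
          by (subst power_mult_distrib) (simp only: mult_left_mono zero_le_power2)
        then have "Bz * (Q * (2 * C1 * \<bar>h\<bar> ^ Suc s)\<^sup>2) \<le> Bz * (Q * ((2 * C1)\<^sup>2 * \<bar>h\<bar> ^ (2 * s + 1)))"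
          using Bz(1) Q(1) by (simp only: mult_left_mono)
        from order.trans[OF zq this]
        have zq': "\<bar>z h x \<bullet> ?q h x\<bar> \<le> Bz * (Q * (2 * C1)\<^sup>2) * \<bar>h\<bar> ^ (2 * s + 1)"
          by (simp only: mult.assoc)
        have \<delta>e': "\<bar>\<delta> h x \<bullet> e h x\<bar> \<le> Cd * (2 * C1) * \<bar>h\<bar> ^ (2 * s + 1)"
        proof -
          have "\<bar>h\<bar> ^ s * \<bar>h\<bar> ^ Suc s = \<bar>h\<bar> ^ (2 * s + 1)"
            by (simp only: power_add[symmetric]) (simp add: mult_2)
          then have "(Cd * \<bar>h\<bar> ^ s) * (2 * C1 * \<bar>h\<bar> ^ Suc s) = Cd * (2 * C1) * \<bar>h\<bar> ^ (2 * s + 1)"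
            by (metis mult.assoc mult.left_commute)
          then show ?thesis using \<delta>e by (simp only:)
        qed
        have "\<bar>z h x \<bullet> ?q h x - \<delta> h x \<bullet> e h x\<bar> \<le> M * \<bar>h\<bar> ^ (2 * s + 1)"
          using zq' \<delta>e' unfolding M_def distrib_right by linarith
        then show "norm (?g' x) \<le> M * \<bar>h\<bar> ^ (2 * s + 1)"
          using mult_mono[OF h1', of "\<bar>z h x \<bullet> ?q h x - \<delta> h x \<bullet> e h x\<bar>" "M * \<bar>h\<bar> ^ (2 * s + 1)"]
          by (simp add: abs_mult)
      qed auto
      then show ?thesis by simp
    qed
    have "\<bar>v \<bullet> e h 1\<bar> \<le> (M + C2 + W) * \<bar>h\<bar> ^ (2 * s + 1)" if h: "h \<in> S" for h
    proof -
      \<comment> \<open>Three contributions: the perturbed adjoint identity, the quadrature error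
        for \<open>\<psi>\<close>, and the quadrature sum. They add up because
        \<open>e h 0 = 0\<close> and \<open>z h 1 = v\<close>.\<close>
      let ?A = "(z h 1 \<bullet> e h 1 - \<Phi> h 1) - (z h 0 \<bullet> e h 0 - \<Phi> h 0)"
      let ?B = "\<Phi> h 1 - \<Phi> h 0 - h * (\<Sum>i\<le>k. b i * \<psi> h (t i))"
      let ?C = "h * (\<Sum>i\<le>k. b i * \<psi> h (t i))"
      have "v \<bullet> e h 1 = ?A + ?B + ?C" by (simp add: z(2) e0)
      then have "\<bar>v \<bullet> e h 1\<bar> \<le> \<bar>?A\<bar> + \<bar>?B\<bar> + \<bar>?C\<bar>"
        using abs_triangle_ineq[of "?A + ?B" ?C] abs_triangle_ineq[of ?A ?B] by linarith
      also have "\<dots> \<le> M * \<bar>h\<bar> ^ (2 * s + 1) + C2 * \<bar>h\<bar> ^ (2 * s + 1) + W * \<bar>h\<bar> ^ (2 * s + 1)"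
      proof (intro add_mono g[OF h] C2[OF h, unfolded Suc_eq_plus1])
        show "\<bar>?C\<bar> \<le> W * \<bar>h\<bar> ^ (2 * s + 1)"
          using mult_left_mono[OF sum\<psi>[OF h], of "\<bar>h\<bar>"] by (simp add: abs_mult mult_ac)
      qed
      finally show ?thesis by (simp only: distrib_right)
    qed
    then show ?thesis by blast
  qed
  then obtain C where C: "\<And>v h. h \<in> S \<Longrightarrow> \<bar>v \<bullet> e h 1\<bar> \<le> C v * \<bar>h\<bar> ^ (2 * s + 1)" by metis
  have "\<bar>norm (U h k - \<phi> h)\<bar> \<le> (\<Sum>v\<in>Basis. C v) * \<bar>h\<bar> ^ (2 * s + 1)" if h: "h \<in> S" for h
  proof -
    have "U h k - \<phi> h = e h 1" using ut[OF h, of k] by (simp add: e_def)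
    then have "norm (U h k - \<phi> h) \<le> (\<Sum>v\<in>Basis. \<bar>e h 1 \<bullet> v\<bar>)" using norm_le_l1 by metis
    also have "\<dots> \<le> (\<Sum>v\<in>Basis. C v * \<bar>h\<bar> ^ (2 * s + 1))"
      using C[OF h] by (intro sum_mono) (simp add: inner_commute)
    finally show ?thesis by (simp add: sum_distrib_right)
  qed
  then have "(\<lambda>h. norm (U h k - \<phi> h)) \<in> O[at 0](\<lambda>h. h ^ (2 * s + 1))"
    unfolding S_def by (rule bigo_at_0[OF h0(1)])
  then show ?thesis using branch by blast
qed

end

theorem theorem4:
  fixes k s :: nat and P :: "nat \<Rightarrow> real poly" and t c \<tau> :: "nat \<Rightarrow> real"
  assumes "1 \<le> s" and "s \<le> k"
    and "shifted_legendre P"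
    and "lobatto_abscissae P k t"
    and "abscissae_split k s t c \<tau>"
  shows
    "has_order (hbvm_near k s P t c \<tau>
        :: real \<Rightarrow> ('a::euclidean_space \<Rightarrow> 'a) \<Rightarrow> real \<Rightarrow> ('a \<times> 'a) set) (2 * s) \<and>
     (\<forall>(H :: real ^ ('m::finite + 'm) \<Rightarrow> real) d.
        polynomial_of_degree_le d H \<and> real d \<le> 2 * real k / real s \<longrightarrow>
        energy_preserving (hbvm k s P t c \<tau>) (hamiltonian_field H) H) \<and>
     (\<forall>H :: real ^ ('m + 'm) \<Rightarrow> real.
        of_class_C (2 * k + 1) H \<longrightarrow>
        has_energy_error (hbvm_near k s P t c \<tau>) (hamiltonian_field H) H (2 * k + 1)) \<and>
     symmetric_method (hbvm k s P t c \<tau>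
        :: ('a \<Rightarrow> 'a) \<Rightarrow> real \<Rightarrow> ('a \<times> 'a) set) \<and>
     precisely_A_stable (hbvm k s P t c \<tau>)"
proof -
  interpret hbvm_scheme P k t s c \<tau>
    using assms by unfold_locales auto
  have "has_order (hbvm_near k s P t c \<tau>
      :: real \<Rightarrow> ('a::euclidean_space \<Rightarrow> 'a) \<Rightarrow> real \<Rightarrow> ('a \<times> 'a) set) (2 * s)"
    unfolding has_order_def by (intro allI impI, elim conjE, rule local_error) auto
  moreover have "energy_preserving (hbvm k s P t c \<tau>) (hamiltonian_field H) H"
    if "polynomial_of_degree_le d H" "real d \<le> 2 * real k / real s"
    for H :: "real ^ ('m + 'm) \<Rightarrow> real" and d
  proof -
    have "real (d * s) \<le> real (2 * k)" using that(2) s_pos by (simp add: field_simps)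
    then have "d * s \<le> 2 * k" by (simp only: of_nat_le_iff)
    then show ?thesis using that(1) by (rule energy_preserving_polynomial[rotated])
  qed
  ultimately show ?thesis
    using energy_error hbvm_symmetric hbvm_precisely_A_stable by blast
qed

end
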